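(* Let $1<p,q<\infty$ with $\frac1p+\frac1q=1$. Let $\Omega\subset\mathbb R^n$ ($n\ge2$) be a bounded Hölder-$\alpha$ domain, with $0<\alpha\le1$, let $d(x)$ denote the distance from $x\in\Omega$ to $\partial\Omega$, and let $\beta\in\mathbb R$ satisfy $\beta p>-\alpha$. Then there exist an open covering $\{U_t\}_{t\in\Gamma}$ of $\Omega$ and a constant $C$ such that every $g\in L^q(\Omega,d^{-\beta q})$ with $\int_\Omega g=0$ has a $\mathcal C$-decomposition $\{g_t\}_{t\in\Gamma}$ subordinate to $\{U_t\}_{t\in\Gamma}$ satisfying $$\sum_{t\in\Gamma} \int_{U_t}|g_t(x)|^q\, d(x)^{(-\beta-\alpha+1) q }\,dx \leq C \int_{\Omega} |g(x)|^q\, d(x)^{-\beta q}\,dx.$$ In addition, the covering is formed by one smooth domain $\Omega_0$ with positive distance to $\partial\Omega$, and countably many sets each of which is a cube or a cube extended by a factor $3/2$ in one direction.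
   Context: Bounded Hölder-$\alpha$ domain: a bounded domain $\Omega\subset\mathbb R^n$ whose boundary is locally the graph of a function $\varphi$ with $|\varphi(x')-\varphi(y')|\le K_\varphi|x'-y'|^\alpha$; that is, near each boundary point, in suitable rigidly moved coordinates $(x',x_n)\in\mathbb R^{n-1}\times\mathbb R$ and within an open box around the point, $\Omega$ coincides with $\{x_n<\varphi(x')\}$ for such a $\varphi$. $\|f\|_{L^q(\Omega,\eta)}=\left(\int_\Omega|f|^q\eta\right)^{1/q}$ for a weight $\eta$ (measurable, positive a.e.). Open covering: a collection $\{U_t\}_{t\in\Gamma}$ of open subsets of $\Omega$ covering $\Omega$ up to a Lebesgue-null set and such that each $U_t$ intersects only finitely many $U_s$. $\mathcal C$-decomposition: for $g\in L^1(\Omega)$ with $\int_\Omega g=0$, a $\mathcal C$-decomposition of $g$ subordinate to $\{U_t\}_{t\in\Gamma}$ is a collection $\{g_t\}_{t\in\Gamma}\subset L^1(\Omega)$ with (1) $g=\sum_{t\in\Gamma}g_t$; (2) $\operatorname{supp}(g_t)\subset U_t$, in the sense that $g_t=0$ a.e. outside $U_t$; (3) $\int_{U_t}g_t=0$ for all $t\in\Gamma$. (For $\beta p>-\alpha$ the weight $d^{\beta p}$ is integrable on $\Omega$, so $L^q(\Omega,d^{-\beta q})\subset L^1(\Omega)$.) *)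

theory Defs
  imports "HOL-Analysis.Analysis"
begin

definition rigid_motion :: "(real^'n \<Rightarrow> real^'n) \<Rightarrow> bool" where
  "rigid_motion T \<longleftrightarrow> (\<exists>c f. orthogonal_transformation f \<and> T = (\<lambda>x. c + f x))"

text \<open>
  Points of \<open>R^n\<close> are split as \<open>x = (x', x\<^sub>k)\<close>, where the distinguished coordinate \<open>k\<close>
  plays the role of the last one.  The point \<open>x'\<close> of \<open>R^(n-1)\<close> is encoded as the point of
  the hyperplane \<open>x\<^sub>k = 0\<close> with the same remaining coordinates; a function of \<open>x'\<close> is a
  function on \<open>R^n\<close> that is only ever evaluated on this hyperplane.
\<close>

definition base_point :: "'n \<Rightarrow> real^'n \<Rightarrow> real^'n" where
  "base_point k x = (\<chi> i. if i = k then 0 else x $ i)"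

text \<open>
  Near each boundary point, in rigidly moved coordinates and within an open box \<open>B\<close>, the
  set \<open>D\<close> is \<open>{x\<^sub>k < \<phi>(x')}\<close>.  The parameter \<open>P k B \<phi>\<close> is the regularity required of \<open>\<phi>\<close>
  on the base of \<open>B\<close>.
\<close>

definition locally_subgraph ::
    "('n::finite \<Rightarrow> (real^'n) set \<Rightarrow> (real^'n \<Rightarrow> real) \<Rightarrow> bool) \<Rightarrow> (real^'n) set \<Rightarrow> bool" where
  "locally_subgraph P D \<longleftrightarrow>
     (\<forall>z\<in>frontier D. \<exists>T k a b \<phi>.
        rigid_motion T \<and> T z \<in> box a b \<and> P k (box a b) \<phi> \<and>
        T ` D \<inter> box a b = {x \<in> box a b. x $ k < \<phi> (base_point k x)})"

definition holder_graph ::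
    "real \<Rightarrow> 'n::finite \<Rightarrow> (real^'n) set \<Rightarrow> (real^'n \<Rightarrow> real) \<Rightarrow> bool" where
  "holder_graph \<alpha> k B \<phi> \<longleftrightarrow>
     (\<exists>K. \<forall>x\<in>B. \<forall>y\<in>B. \<bar>\<phi> (base_point k x) - \<phi> (base_point k y)\<bar>
                          \<le> K * norm (base_point k x - base_point k y) powr \<alpha>)"

primrec Ck_on :: "nat \<Rightarrow> (real^'n::finite) set \<Rightarrow> (real^'n \<Rightarrow> real) \<Rightarrow> bool" where
  "Ck_on 0 S f \<longleftrightarrow> continuous_on S f"
| "Ck_on (Suc m) S f \<longleftrightarrow>
     (\<forall>x\<in>S. f differentiable (at x)) \<and>
     (\<forall>i. Ck_on m S (\<lambda>x. frechet_derivative f (at x) (axis i 1)))"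

text \<open>
  \<open>\<phi>\<close> is \<open>C\<^sup>\<infinity>\<close> on the base of the open box \<open>B\<close> iff \<open>x \<mapsto> \<phi>(x')\<close>, which is constant
  in direction \<open>k\<close>, is \<open>C\<^sup>\<infinity>\<close> on \<open>B\<close>.
\<close>

definition smooth_graph ::
    "'n::finite \<Rightarrow> (real^'n) set \<Rightarrow> (real^'n \<Rightarrow> real) \<Rightarrow> bool" where
  "smooth_graph k B \<phi> \<longleftrightarrow> (\<forall>m. Ck_on m B (\<lambda>x. \<phi> (base_point k x)))"

definition euclidean_domain :: "(real^'n) set \<Rightarrow> bool" where
  "euclidean_domain D \<longleftrightarrow> D \<noteq> {} \<and> open D \<and> connected D"

definition bounded_holder_domain :: "real \<Rightarrow> (real^'n::finite) set \<Rightarrow> bool" where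
  "bounded_holder_domain \<alpha> D \<longleftrightarrow>
     euclidean_domain D \<and> bounded D \<and> locally_subgraph (holder_graph \<alpha>) D"

definition smooth_domain :: "(real^'n::finite) set \<Rightarrow> bool" where
  "smooth_domain D \<longleftrightarrow> euclidean_domain D \<and> locally_subgraph smooth_graph D"

text \<open>Cubes are open and may have any orientation.\<close>

definition open_cube :: "(real^'n::finite) set \<Rightarrow> bool" where
  "open_cube Q \<longleftrightarrow>
     (\<exists>T a b l. rigid_motion T \<and> 0 < l \<and> (\<forall>i. b $ i - a $ i = l) \<and> Q = T ` box a b)"

definition open_extended_cube :: "(real^'n::finite) set \<Rightarrow> bool" where
  "open_extended_cube Q \<longleftrightarrow>
     (\<exists>T a b l j. rigid_motion T \<and> 0 < l \<and>
        (\<forall>i. b $ i - a $ i = (if i = j then 3 / 2 * l else l)) \<and> Q = T ` box a b)"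

definition bdist :: "(real^'n::finite) set \<Rightarrow> real^'n \<Rightarrow> real" where
  "bdist D x = infdist x (frontier D)"

definition weighted_Lq ::
    "real \<Rightarrow> (real^'n::finite) set \<Rightarrow> (real^'n \<Rightarrow> real) \<Rightarrow> (real^'n \<Rightarrow> real) set" where
  "weighted_Lq q D \<eta> =
     {f. f \<in> borel_measurable (lebesgue_on D) \<and>
         (\<integral>\<^sup>+x. ennreal (\<bar>f x\<bar> powr q * \<eta> x) \<partial>lebesgue_on D) < \<infinity>}"

definition open_covering ::
    "(real^'n::finite) set \<Rightarrow> 't set \<Rightarrow> ('t \<Rightarrow> (real^'n) set) \<Rightarrow> bool" where
  "open_covering D \<Gamma> U \<longleftrightarrow>
     (\<forall>t\<in>\<Gamma>. open (U t) \<and> U t \<subseteq> D) \<and>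
     negligible (D - (\<Union>t\<in>\<Gamma>. U t)) \<and>
     (\<forall>t\<in>\<Gamma>. finite {s \<in> \<Gamma>. U s \<inter> U t \<noteq> {}})"

text \<open>
  The identity \<open>g = \<Sum>\<^sub>t g\<^sub>t\<close> holds pointwise almost everywhere; subordinate to an open
  covering the sum has only finitely many nonzero terms at almost every point.
\<close>

definition C_decomposition ::
    "(real^'n::finite) set \<Rightarrow> 't set \<Rightarrow> ('t \<Rightarrow> (real^'n) set) \<Rightarrow> (real^'n \<Rightarrow> real) \<Rightarrow>
     ('t \<Rightarrow> real^'n \<Rightarrow> real) \<Rightarrow> bool" where
  "C_decomposition D \<Gamma> U g G \<longleftrightarrow>
     (\<forall>t\<in>\<Gamma>. integrable (lebesgue_on D) (G t)) \<and>
     (AE x in lebesgue_on D. ((\<lambda>t. G t x) has_sum g x) \<Gamma>) \<and>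
     (\<forall>t\<in>\<Gamma>. AE x in lebesgue_on D. x \<notin> U t \<longrightarrow> G t x = 0) \<and>
     (\<forall>t\<in>\<Gamma>. integral\<^sup>L (lebesgue_on (U t)) (G t) = 0)"

end

theory Submission
  imports Defs
begin

text \<open>
  Near a boundary point take the maximal dyadic cubes (relative to a fixed grid in the rigidly moved
  coordinates) whose dilates stay below the graph.  Lowering a cube keeps it admissible, so the cube
  directly below a maximal cube is at least as large and covers its base: the cubes form a rooted
  tree, and the mass of \<open>g\<close> is transported down this tree.  With \<open>A\<^sub>R\<close> the integral of \<open>g\<close> over all
  cubes descending from \<open>R\<close>, and \<open>b\<^sub>R\<close> the normalised indicator of \<open>R\<close>, the piece attached to \<open>R\<close>
  is \<open>g 1\<^sub>R - (\<integral>\<^sub>R g) b\<^sub>R + A\<^sub>R (b\<^sub>R - b\<^sub>P)\<close> with \<open>P\<close> the parent of \<open>R\<close>; it lives in the triple of \<open>P\<close>.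
  The norm estimate is a weighted Hardy inequality on the tree.  The Hoelder condition enters only
  through the fact that a vertical line meets at most \<open>C 2^(m (1 - \<alpha>))\<close> cubes of side \<open>2^(-m)\<close>.
  The mass collected at the roots is moved through finitely many interior cubes to one fixed cube,
  where it cancels because \<open>g\<close> has mean zero.  As every piece lives in a cube, \<open>\<Omega>\<^sub>0\<close> can be any
  small ball, carrying the zero piece.
\<close>

section \<open>Families of pieces and mass transport\<close>

text \<open>The obstacle is the shape of a column under a Hoelder graph: over one base of level
  \<open>m\<close> it can hold of the order of 2^(m (1 - \<alpha>)) cells of that level, not
  boundedly many. The loss is paid by the gain (1 - \<alpha>) q in the exponent of the weight on the
  pieces: (1 - \<alpha>) (q - 1) of it is spent in Hoelder's inequality for the mass of a column,
  the remaining 1 - \<alpha> in the sum over the ancestors of a cell. By the same count the cells of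
  level \<open>m\<close> over a fixed base have total measure of order at most 2^(- m \<alpha>), so
  that \<beta> p > - \<alpha> makes the weight d^(\<beta> p) summable over the levels. Maximality of
  cubes is tested against the graph and not by the distance to the frontier, since lowering a cube
  keeps it under the graph while that distance need not grow. Local results are glued by restricting
  the data to measurable sets instead of using cut-off functions. This destroys mean zero, which is
  why every local statement carries the integral along as a multiple of one bump, and bounds
  it.\<close>

locale weighted_domain =
  fixes \<Omega> :: "(real^'n::finite) set" and p q \<alpha> \<beta> :: real
  assumes open_dom: "open \<Omega>" and bounded_dom: "bounded \<Omega>"
    and connected_dom: "connected \<Omega>" and nonempty_dom: "\<Omega> \<noteq> {}"
    and p_gt1: "1 < p" and q_gt1: "1 < q" and conj_exp: "1 / p + 1 / q = 1"
    and \<alpha>_pos: "0 < \<alpha>" and \<alpha>_le1: "\<alpha> \<le> 1" and \<beta>_gt: "- \<alpha> < \<beta> * p"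
begin

abbreviation "\<mu> \<equiv> lebesgue_on \<Omega>"
abbreviation "d \<equiv> bdist \<Omega>"

definition data_norm :: "(real^'n \<Rightarrow> real) \<Rightarrow> ennreal" where
  "data_norm f = (\<integral>\<^sup>+x. ennreal (\<bar>f x\<bar> powr q * d x powr (- \<beta> * q)) \<partial>\<mu>)"

definition piece_norm :: "(real^'n \<Rightarrow> real) \<Rightarrow> ennreal" where
  "piece_norm f = (\<integral>\<^sup>+x. ennreal (\<bar>f x\<bar> powr q * d x powr ((- \<beta> - \<alpha> + 1) * q)) \<partial>\<mu>)"

abbreviation "data_space \<equiv> weighted_Lq q \<Omega> (\<lambda>x. d x powr (- \<beta> * q))"

lemma \<Omega>_sets: "\<Omega> \<in> sets lebesgue"
  using open_dom by (simp add: borel_open lmeasurable_open sets_completionI_sets)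

lemma space_\<mu>: "space \<mu> = \<Omega>"
  by (simp add: space_restrict_space)

lemma sets_\<mu>: "A \<in> sets \<mu> \<longleftrightarrow> A \<subseteq> \<Omega> \<and> A \<in> sets lebesgue"
  using \<Omega>_sets by (auto simp: sets_restrict_space_iff)

lemma finite_\<mu>: "finite_measure \<mu>"
proof (rule finite_measureI)
  have "emeasure lebesgue \<Omega> < \<infinity>"
    using bounded_set_imp_lmeasurable[OF bounded_dom \<Omega>_sets] by (rule fmeasurableD2[THEN less_top[THEN iffD1], simplified infinity_ennreal_def[symmetric]])
  then show "emeasure \<mu> (space \<mu>) \<noteq> \<infinity>"
    using \<Omega>_sets by (simp add: emeasure_restrict_space)
qed

lemma frontier_nonempty: "frontier \<Omega> \<noteq> {}"
  using bounded_dom nonempty_dom frontier_not_empty not_bounded_UNIV by blast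

lemma d_pos: assumes "x \<in> \<Omega>" shows "0 < d x"
proof -
  have "x \<notin> frontier \<Omega>" using open_dom assms by (simp add: frontier_def interior_open)
  then have "infdist x (frontier \<Omega>) \<noteq> 0"
    using frontier_nonempty by (simp add: in_closed_iff_infdist_zero)
  then show ?thesis unfolding bdist_def using infdist_nonneg[of x "frontier \<Omega>"] by linarith
qed

lemma continuous_d: "continuous_on S d"
  unfolding bdist_def by (intro continuous_intros)

lemma measurable_d [measurable]: "d \<in> borel_measurable \<mu>"
proof -
  have "d \<in> borel_measurable borel"
    using continuous_d[of UNIV] by (rule borel_measurable_continuous_onI)
  then have "d \<in> borel_measurable lebesgue"
    by (intro measurable_completion) (simp add: measurable_lborel2)
  then show ?thesis by (rule measurable_restrict_space1)
qed

lemma d_powr_bounded: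
  assumes "compact K" "K \<subseteq> \<Omega>"
  obtains C where "0 < C" "\<And>x. x \<in> K \<Longrightarrow> d x powr \<gamma> \<le> C"
proof -
  have "continuous_on K (\<lambda>x. d x powr \<gamma>)"
    by (intro continuous_intros continuous_d) (use assms d_pos in fastforce)
  then have "bounded ((\<lambda>x. d x powr \<gamma>) ` K)"
    using assms compact_continuous_image compact_imp_bounded by blast
  then obtain C where "0 < C" "\<And>y. y \<in> (\<lambda>x. d x powr \<gamma>) ` K \<Longrightarrow> norm y \<le> C"
    unfolding bounded_pos by blast
  then have "norm (d x powr \<gamma>) \<le> C" if "x \<in> K" for x using that by blast
  then have "d x powr \<gamma> \<le> C" if "x \<in> K" for x using that by fastforce
  with \<open>0 < C\<close> show ?thesis by (rule that)
qed

text \<open>Finiteness is required on compact subsets of \<Omega>, not just between members, because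
  this form survives joining unrelated families; the closure of a member is such a compact set,
  which gives back the finiteness demanded of an open covering.\<close>

definition good_family :: "nat set \<Rightarrow> (nat \<Rightarrow> (real^'n) set) \<Rightarrow> bool" where
  "good_family \<Gamma> U \<longleftrightarrow>
     (\<forall>t\<in>\<Gamma>. open_cube (U t) \<and> closure (U t) \<subseteq> \<Omega>) \<and>
     (\<forall>K. compact K \<and> K \<subseteq> \<Omega> \<longrightarrow> finite {t\<in>\<Gamma>. U t \<inter> K \<noteq> {}})"

definition decomposes ::
    "nat set \<Rightarrow> (nat \<Rightarrow> (real^'n) set) \<Rightarrow> (real^'n \<Rightarrow> real) \<Rightarrow> ennreal \<Rightarrow> bool" where
  "decomposes \<Gamma> U h c \<longleftrightarrow> (\<exists>G.
     (\<forall>t\<in>\<Gamma>. integrable \<mu> (G t) \<and> (\<forall>x\<in>\<Omega>. x \<notin> U t \<longrightarrow> G t x = 0) \<and> integral\<^sup>L \<mu> (G t) = 0) \<and>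
     (AE x in \<mu>. ((\<lambda>t. G t x) has_sum h x) \<Gamma>) \<and>
     (\<Sum>\<^sub>\<infinity>t\<in>\<Gamma>. piece_norm (G t)) \<le> c)"

text \<open>A disjoint union inside \<open>nat\<close> by parity: the same cube may occur in both
  families, and each copy keeps its own piece.\<close>

definition join_index :: "nat set \<Rightarrow> nat set \<Rightarrow> nat set" where
  "join_index \<Gamma> \<Delta> = (\<lambda>t. 2 * t) ` \<Gamma> \<union> (\<lambda>t. 2 * t + 1) ` \<Delta>"

definition join_fam :: "(nat \<Rightarrow> 'b) \<Rightarrow> (nat \<Rightarrow> 'b) \<Rightarrow> nat \<Rightarrow> 'b" where
  "join_fam U V t = (if even t then U (t div 2) else V (t div 2))"

lemma join_fam_simps [simp]:
  "join_fam U V (2 * t) = U t" "join_fam U V (2 * t + 1) = V t" "join_fam U V (Suc (2 * t)) = V t"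
  by (auto simp: join_fam_def)

lemma UN_join: "(\<Union>t\<in>join_index \<Gamma> \<Delta>. join_fam U V t) = (\<Union>t\<in>\<Gamma>. U t) \<union> (\<Union>t\<in>\<Delta>. V t)"
  by (auto simp: join_index_def)

lemma good_family_join:
  assumes "good_family \<Gamma> U" "good_family \<Delta> V"
  shows "good_family (join_index \<Gamma> \<Delta>) (join_fam U V)"
proof -
  have "finite {t \<in> join_index \<Gamma> \<Delta>. join_fam U V t \<inter> K \<noteq> {}}"
    if "compact K" "K \<subseteq> \<Omega>" for K
  proof -
    have "{t \<in> join_index \<Gamma> \<Delta>. join_fam U V t \<inter> K \<noteq> {}}
        = (\<lambda>t. 2 * t) ` {t\<in>\<Gamma>. U t \<inter> K \<noteq> {}} \<union> (\<lambda>t. 2 * t + 1) ` {t\<in>\<Delta>. V t \<inter> K \<noteq> {}}"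
      unfolding join_index_def by (force simp: image_iff)
    then show ?thesis using assms that by (auto simp: good_family_def)
  qed
  then show ?thesis
    using assms unfolding good_family_def by (simp add: join_index_def ball_Un)
qed

lemma decomposes_join:
  assumes "decomposes \<Gamma> U h c" "decomposes \<Delta> V k e"
  shows "decomposes (join_index \<Gamma> \<Delta>) (join_fam U V) (\<lambda>x. h x + k x) (c + e)"
proof -
  obtain G where G: "\<And>t. t \<in> \<Gamma> \<Longrightarrow> integrable \<mu> (G t) \<and> (\<forall>x\<in>\<Omega>. x \<notin> U t \<longrightarrow> G t x = 0) \<and> integral\<^sup>L \<mu> (G t) = 0"
    "AE x in \<mu>. ((\<lambda>t. G t x) has_sum h x) \<Gamma>" "(\<Sum>\<^sub>\<infinity>t\<in>\<Gamma>. piece_norm (G t)) \<le> c"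
    using assms(1) unfolding decomposes_def by blast
  obtain H where H: "\<And>t. t \<in> \<Delta> \<Longrightarrow> integrable \<mu> (H t) \<and> (\<forall>x\<in>\<Omega>. x \<notin> V t \<longrightarrow> H t x = 0) \<and> integral\<^sup>L \<mu> (H t) = 0"
    "AE x in \<mu>. ((\<lambda>t. H t x) has_sum k x) \<Delta>" "(\<Sum>\<^sub>\<infinity>t\<in>\<Delta>. piece_norm (H t)) \<le> e"
    using assms(2) unfolding decomposes_def by blast
  define J where "J = join_fam G H"
  have disj: "(\<lambda>t. 2 * t) ` \<Gamma> \<inter> (\<lambda>t. 2 * t + 1) ` \<Delta> = {}"
    by (auto, presburger)
  have inj: "inj_on (\<lambda>t::nat. 2 * t) A" "inj_on (\<lambda>t::nat. 2 * t + 1) A" for A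
    by (auto simp: inj_on_def)
  have "((\<lambda>t. J t x) has_sum (h x + k x)) (join_index \<Gamma> \<Delta>)"
    if "((\<lambda>t. G t x) has_sum h x) \<Gamma>" "((\<lambda>t. H t x) has_sum k x) \<Delta>" for x
  proof -
    have "((\<lambda>t. J t x) has_sum h x) ((\<lambda>t. 2 * t) ` \<Gamma>)"
      using that(1) by (subst has_sum_reindex[OF inj(1)]) (simp add: o_def J_def)
    moreover have "((\<lambda>t. J t x) has_sum k x) ((\<lambda>t. 2 * t + 1) ` \<Delta>)"
      using that(2) by (subst has_sum_reindex[OF inj(2)]) (simp add: o_def J_def)
    ultimately show ?thesis
      unfolding join_index_def using disj by (rule has_sum_Un_disjoint)
  qed
  note J_sum = this
  have "AE x in \<mu>. ((\<lambda>t. J t x) has_sum (h x + k x)) (join_index \<Gamma> \<Delta>)"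
    by (rule AE_mp[OF G(2) AE_mp[OF H(2) AE_I2]]) (use J_sum in simp)
  moreover have "(\<Sum>\<^sub>\<infinity>t\<in>join_index \<Gamma> \<Delta>. piece_norm (J t)) \<le> c + e"
  proof -
    have "(\<Sum>\<^sub>\<infinity>t\<in>join_index \<Gamma> \<Delta>. piece_norm (J t))
       = (\<Sum>\<^sub>\<infinity>t\<in>(\<lambda>t. 2 * t) ` \<Gamma>. piece_norm (J t)) + (\<Sum>\<^sub>\<infinity>t\<in>(\<lambda>t. 2 * t + 1) ` \<Delta>. piece_norm (J t))"
      unfolding join_index_def
      by (rule infsum_Un_disjoint[OF _ _ disj]) (auto intro!: nonneg_summable_on_complete)
    also have "\<dots> = (\<Sum>\<^sub>\<infinity>t\<in>\<Gamma>. piece_norm (G t)) + (\<Sum>\<^sub>\<infinity>t\<in>\<Delta>. piece_norm (H t))"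
      by (simp only: infsum_reindex[OF inj(1)] infsum_reindex[OF inj(2)]) (simp add: o_def J_def)
    finally show ?thesis using G(3) H(3) by (simp add: add_mono)
  qed
  moreover have "\<forall>t\<in>join_index \<Gamma> \<Delta>. integrable \<mu> (J t) \<and> (\<forall>x\<in>\<Omega>. x \<notin> join_fam U V t \<longrightarrow> J t x = 0) \<and> integral\<^sup>L \<mu> (J t) = 0"
    using G(1) H(1) by (auto simp: join_index_def J_def)
  ultimately show ?thesis unfolding decomposes_def by blast
qed

lemma decomposes_mono: "decomposes \<Gamma> U h c \<Longrightarrow> c \<le> e \<Longrightarrow> decomposes \<Gamma> U h e"
  unfolding decomposes_def by (meson order_trans)

lemma decomposes_cong: "decomposes \<Gamma> U h c \<Longrightarrow> (\<And>x. x \<in> \<Omega> \<Longrightarrow> h x = k x) \<Longrightarrow> decomposes \<Gamma> U k c"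
proof -
  assume "decomposes \<Gamma> U h c" and eq: "\<And>x. x \<in> \<Omega> \<Longrightarrow> h x = k x"
  moreover have "(AE x in \<mu>. ((\<lambda>t. G t x) has_sum h x) \<Gamma>) \<longleftrightarrow> (AE x in \<mu>. ((\<lambda>t. G t x) has_sum k x) \<Gamma>)" for G
    by (rule AE_cong) (simp add: space_\<mu> eq)
  ultimately show ?thesis unfolding decomposes_def by simp
qed

text \<open>One family serves every mass \<open>a\<close>, so chains of cubes can be composed before
  the data are known.\<close>

definition linked :: "(real^'n \<Rightarrow> real) \<Rightarrow> (real^'n \<Rightarrow> real) \<Rightarrow> bool" where
  "linked h k \<longleftrightarrow> (\<exists>\<Gamma> U C. good_family \<Gamma> U \<and> 0 \<le> C \<and>
     (\<forall>a. decomposes \<Gamma> U (\<lambda>x. a * (h x - k x)) (ennreal (C * \<bar>a\<bar> powr q))))"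

text \<open>No mean zero is asked of \<open>f\<close>: its mass is collected in the profile
  \<open>h\<close>, which makes the notion stable under unions of \<open>E\<close>. The bound on the
  integral belongs to the definition because the collected mass is moved on later and that cost has
  to be charged to \<open>data_norm f\<close>.\<close>

definition transports ::
    "nat set \<Rightarrow> (nat \<Rightarrow> (real^'n) set) \<Rightarrow> real \<Rightarrow> (real^'n) set \<Rightarrow> (real^'n \<Rightarrow> real) \<Rightarrow> bool" where
  "transports \<Gamma> U C E h \<longleftrightarrow>
     good_family \<Gamma> U \<and> 0 \<le> C \<and> negligible (E - (\<Union>t\<in>\<Gamma>. U t)) \<and>
     (\<forall>f\<in>data_space. (\<forall>x\<in>\<Omega> - E. f x = 0) \<longrightarrow>
        integrable \<mu> f \<and> ennreal (\<bar>integral\<^sup>L \<mu> f\<bar> powr q) \<le> ennreal C * data_norm f \<and>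
        decomposes \<Gamma> U (\<lambda>x. f x - integral\<^sup>L \<mu> f * h x) (ennreal C * data_norm f))"

definition transportable :: "(real^'n) set \<Rightarrow> (real^'n \<Rightarrow> real) \<Rightarrow> bool" where
  "transportable E h \<longleftrightarrow> (\<exists>\<Gamma> U C. transports \<Gamma> U C E h)"

lemma transportsD:
  assumes "transports \<Gamma> U C E h"
  shows "good_family \<Gamma> U" "0 \<le> C" "negligible (E - (\<Union>t\<in>\<Gamma>. U t))"
    "f \<in> data_space \<Longrightarrow> \<forall>x\<in>\<Omega> - E. f x = 0 \<Longrightarrow>
        integrable \<mu> f \<and> ennreal (\<bar>integral\<^sup>L \<mu> f\<bar> powr q) \<le> ennreal C * data_norm f \<and>
        decomposes \<Gamma> U (\<lambda>x. f x - integral\<^sup>L \<mu> f * h x) (ennreal C * data_norm f)"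
  using assms unfolding transports_def by simp_all

lemma transportableI:
  assumes "good_family \<Gamma> U" "0 \<le> C" "negligible (E - (\<Union>t\<in>\<Gamma>. U t))"
    and "\<And>f. f \<in> data_space \<Longrightarrow> \<forall>x\<in>\<Omega> - E. f x = 0 \<Longrightarrow>
        integrable \<mu> f \<and> ennreal (\<bar>integral\<^sup>L \<mu> f\<bar> powr q) \<le> ennreal C * data_norm f \<and>
        decomposes \<Gamma> U (\<lambda>x. f x - integral\<^sup>L \<mu> f * h x) (ennreal C * data_norm f)"
  shows "transportable E h"
  using assms unfolding transportable_def transports_def by meson

lemma linked_sym: "linked h k \<Longrightarrow> linked k h"
proof -
  assume "linked h k"
  then obtain \<Gamma> U C where *: "good_family \<Gamma> U" "0 \<le> C"
    "\<And>a. decomposes \<Gamma> U (\<lambda>x. a * (h x - k x)) (ennreal (C * \<bar>a\<bar> powr q))"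
    unfolding linked_def by blast
  have "decomposes \<Gamma> U (\<lambda>x. a * (k x - h x)) (ennreal (C * \<bar>a\<bar> powr q))" for a
  proof -
    have "decomposes \<Gamma> U (\<lambda>x. - a * (h x - k x)) (ennreal (C * \<bar>a\<bar> powr q))"
      using *(3)[of "- a"] by simp
    then show ?thesis by (rule decomposes_cong) (simp add: algebra_simps)
  qed
  with * show ?thesis unfolding linked_def by blast
qed

lemma linked_trans: assumes "linked h k" "linked k l" shows "linked h l"
proof -
  obtain \<Gamma> U C where *: "good_family \<Gamma> U" "0 \<le> C"
    "\<And>a. decomposes \<Gamma> U (\<lambda>x. a * (h x - k x)) (ennreal (C * \<bar>a\<bar> powr q))"
    using assms(1) unfolding linked_def by blast
  obtain \<Delta> V D where **: "good_family \<Delta> V" "0 \<le> D"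
    "\<And>a. decomposes \<Delta> V (\<lambda>x. a * (k x - l x)) (ennreal (D * \<bar>a\<bar> powr q))"
    using assms(2) unfolding linked_def by blast
  have "decomposes (join_index \<Gamma> \<Delta>) (join_fam U V) (\<lambda>x. a * (h x - l x)) (ennreal ((C + D) * \<bar>a\<bar> powr q))" for a
    using decomposes_join[OF *(3)[of a] **(3)[of a]] *(2) **(2)
    by (simp add: algebra_simps flip: ennreal_plus)
  then show ?thesis
    unfolding linked_def using good_family_join[OF *(1) **(1)] *(2) **(2)
    by (intro exI[of _ "join_index \<Gamma> \<Delta>"] exI[of _ "join_fam U V"] exI[of _ "C + D"]) simp
qed

text \<open>The extra move costs \<open>D * \<bar>I\<bar> powr q\<close> with \<open>I\<close> the
  integral of \<open>f\<close>; the mass bound turns this into \<open>D * C\<close> times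
  \<open>data_norm f\<close>, hence the constant \<open>C + D * C\<close>.\<close>

lemma transportable_linked: assumes "transportable E h" "linked h k" shows "transportable E k"
proof -
  obtain \<Delta> V D where **: "good_family \<Delta> V" "0 \<le> D"
    "\<And>a. decomposes \<Delta> V (\<lambda>x. a * (h x - k x)) (ennreal (D * \<bar>a\<bar> powr q))"
    using assms(2) unfolding linked_def by blast
  obtain \<Gamma> U C where "transports \<Gamma> U C E h"
    using assms(1) unfolding transportable_def by blast
  note * = transportsD[OF this]
  define B where "B = C + D * C"
  have B: "0 \<le> B" "C \<le> B" using *(2) **(2) by (auto simp: B_def)
  have "integrable \<mu> f \<and> ennreal (\<bar>integral\<^sup>L \<mu> f\<bar> powr q) \<le> ennreal B * data_norm f \<and>
        decomposes (join_index \<Gamma> \<Delta>) (join_fam U V) (\<lambda>x. f x - integral\<^sup>L \<mu> f * k x) (ennreal B * data_norm f)"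
    if f: "f \<in> data_space" "\<forall>x\<in>\<Omega> - E. f x = 0" for f
  proof -
    let ?I = "integral\<^sup>L \<mu> f"
    note f' = *(4)[OF f]
    have CB: "ennreal C * data_norm f \<le> ennreal B * data_norm f"
      using B by (intro mult_right_mono ennreal_leI) auto
    have "ennreal (D * \<bar>?I\<bar> powr q) \<le> ennreal D * (ennreal C * data_norm f)"
      using f' **(2) by (simp add: ennreal_mult mult_left_mono)
    then have "ennreal C * data_norm f + ennreal (D * \<bar>?I\<bar> powr q)
        \<le> ennreal C * data_norm f + ennreal D * (ennreal C * data_norm f)"
      by (rule add_left_mono)
    also have "\<dots> = ennreal B * data_norm f"
      unfolding B_def using *(2) **(2)
      by (simp add: ennreal_plus ennreal_mult distrib_right mult.assoc)
    finally have le: "ennreal C * data_norm f + ennreal (D * \<bar>?I\<bar> powr q) \<le> ennreal B * data_norm f" .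
    have "decomposes (join_index \<Gamma> \<Delta>) (join_fam U V) (\<lambda>x. f x - ?I * k x) (ennreal B * data_norm f)"
      by (rule decomposes_mono[OF decomposes_cong[OF decomposes_join] le])
         (use f' **(3) in \<open>auto simp: algebra_simps\<close>)
    then show ?thesis using f' CB order_trans by blast
  qed
  moreover have "negligible (E - (\<Union>t\<in>join_index \<Gamma> \<Delta>. join_fam U V t))"
    unfolding UN_join by (rule negligible_subset[OF *(3)]) auto
  ultimately show ?thesis
    using transportableI[OF good_family_join[OF *(1) **(1)] B(1)] by blast
qed

lemma transportable_mono: assumes "transportable E h" "F \<subseteq> E" shows "transportable F h"
proof -
  obtain \<Gamma> U C where "transports \<Gamma> U C E h"
    using assms(1) unfolding transportable_def by blast
  note * = transportsD[OF this]
  have "negligible (F - (\<Union>t\<in>\<Gamma>. U t))"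
    by (rule negligible_subset[OF *(3)]) (use assms(2) in auto)
  then show ?thesis
    by (rule transportableI[OF *(1,2)]) (use *(4) assms(2) in blast)
qed

lemma data_norm_restrict_add:
  assumes "f \<in> borel_measurable \<mu>" "E \<in> sets \<mu>"
  shows "data_norm (\<lambda>x. f x * indicator E x) + data_norm (\<lambda>x. f x * indicator (- E) x) = data_norm f"
proof -
  have [measurable]: "f \<in> borel_measurable \<mu>" "E \<in> sets \<mu>" using assms by auto
  have *: "(\<lambda>x. f x * indicator (- E) x) \<in> borel_measurable \<mu>"
  proof -
    have "(\<lambda>x. f x * indicator (\<Omega> - E) x) \<in> borel_measurable \<mu>"
      using sets.compl_sets[OF assms(2)] by (simp add: space_\<mu>)
    then show ?thesis
      by (rule measurable_cong[THEN iffD1, rotated]) (auto simp: space_\<mu> indicator_def)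
  qed
  show ?thesis
    unfolding data_norm_def
    by (subst nn_integral_add[symmetric])
       (use * in \<open>auto intro!: nn_integral_cong simp: indicator_def\<close>)
qed

text \<open>\<open>f\<close> is cut into its restrictions to \<open>E\<close> and to the complement
  of \<open>E\<close>, under which \<open>data_norm\<close> is additive; the second one vanishes
  outside \<open>F\<close>. The factor \<open>2 powr q\<close> in \<open>B\<close> comes from the
  q-th power of a sum of two integrals.\<close>

lemma transportable_Un:
  assumes "transportable E h" "transportable F h" "E \<in> sets \<mu>"
  shows "transportable (E \<union> F) h"
proof -
  obtain \<Gamma> U C where "transports \<Gamma> U C E h"
    using assms(1) unfolding transportable_def by blast
  note * = transportsD[OF this]
  obtain \<Delta> V D where "transports \<Delta> V D F h"
    using assms(2) unfolding transportable_def by blast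
  note ** = transportsD[OF this]
  define B where "B = 2 powr q * (C + D)"
  have q2: "1 \<le> 2 powr q" using q_gt1 by (simp add: ge_one_powr_ge_zero)
  have B: "0 \<le> B" "C + D \<le> B"
    using *(2) **(2) q2 mult_right_mono[OF q2, of "C + D"] by (auto simp: B_def)
  have "integrable \<mu> f \<and> ennreal (\<bar>integral\<^sup>L \<mu> f\<bar> powr q) \<le> ennreal B * data_norm f \<and>
        decomposes (join_index \<Gamma> \<Delta>) (join_fam U V) (\<lambda>x. f x - integral\<^sup>L \<mu> f * h x) (ennreal B * data_norm f)"
    if f: "f \<in> data_space" "\<forall>x\<in>\<Omega> - (E \<union> F). f x = 0" for f
  proof -
    define f1 where "f1 = (\<lambda>x. f x * indicator E x)"
    define f2 where "f2 = (\<lambda>x. f x * indicator (- E) x)"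
    have fm [measurable]: "f \<in> borel_measurable \<mu>" and fn: "data_norm f < \<infinity>"
      using f(1) by (auto simp: weighted_Lq_def data_norm_def)
    have f12: "f x = f1 x + f2 x" for x by (auto simp: f1_def f2_def indicator_def)
    have add: "data_norm f1 + data_norm f2 = data_norm f"
      unfolding f1_def f2_def by (rule data_norm_restrict_add[OF fm assms(3)])
    have le: "data_norm f1 \<le> data_norm f" "data_norm f2 \<le> data_norm f"
      unfolding add[symmetric] by auto
    have m1 [measurable]: "f1 \<in> borel_measurable \<mu>" unfolding f1_def using assms(3) by measurable
    have "(\<lambda>x. f x - f1 x) \<in> borel_measurable \<mu>" by measurable
    then have m2 [measurable]: "f2 \<in> borel_measurable \<mu>" by (simp add: f12)
    have "f1 \<in> data_space" "f2 \<in> data_space"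
      using m1 m2 le fn by (auto simp: weighted_Lq_def data_norm_def)
    then have g1: "integrable \<mu> f1 \<and> ennreal (\<bar>integral\<^sup>L \<mu> f1\<bar> powr q) \<le> ennreal C * data_norm f1 \<and>
        decomposes \<Gamma> U (\<lambda>x. f1 x - integral\<^sup>L \<mu> f1 * h x) (ennreal C * data_norm f1)"
      and g2: "integrable \<mu> f2 \<and> ennreal (\<bar>integral\<^sup>L \<mu> f2\<bar> powr q) \<le> ennreal D * data_norm f2 \<and>
        decomposes \<Delta> V (\<lambda>x. f2 x - integral\<^sup>L \<mu> f2 * h x) (ennreal D * data_norm f2)"
      by - (rule *(4), assumption, use f(2) in \<open>simp add: f1_def\<close>,
            rule **(4), assumption, use f(2) in \<open>auto simp: f2_def indicator_def\<close>)
    have int: "integrable \<mu> f" "integral\<^sup>L \<mu> f = integral\<^sup>L \<mu> f1 + integral\<^sup>L \<mu> f2"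
      using g1 g2 by (auto simp: f12[abs_def])
    have CD: "ennreal C * data_norm f1 + ennreal D * data_norm f2 \<le> ennreal (C + D) * data_norm f"
      using *(2) **(2) le by (simp add: ennreal_plus distrib_right add_mono mult_left_mono)
    also have "\<dots> \<le> ennreal B * data_norm f" using B(2) by (intro mult_right_mono ennreal_leI) auto
    finally have le2: "ennreal C * data_norm f1 + ennreal D * data_norm f2 \<le> ennreal B * data_norm f" .
    have "\<bar>integral\<^sup>L \<mu> f\<bar> powr q \<le> (2 * max \<bar>integral\<^sup>L \<mu> f1\<bar> \<bar>integral\<^sup>L \<mu> f2\<bar>) powr q"
      using q_gt1 by (intro powr_mono2) (auto simp: int(2))
    also have "\<dots> = 2 powr q * max \<bar>integral\<^sup>L \<mu> f1\<bar> \<bar>integral\<^sup>L \<mu> f2\<bar> powr q"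
      by (simp add: powr_mult)
    also have "\<dots> \<le> 2 powr q * (\<bar>integral\<^sup>L \<mu> f1\<bar> powr q + \<bar>integral\<^sup>L \<mu> f2\<bar> powr q)"
      by (auto simp: max_def)
    finally have "ennreal (\<bar>integral\<^sup>L \<mu> f\<bar> powr q)
        \<le> ennreal (2 powr q) * (ennreal (\<bar>integral\<^sup>L \<mu> f1\<bar> powr q) + ennreal (\<bar>integral\<^sup>L \<mu> f2\<bar> powr q))"
      by (simp add: ennreal_leI flip: ennreal_mult ennreal_plus)
    also have "\<dots> \<le> ennreal (2 powr q) * (ennreal C * data_norm f1 + ennreal D * data_norm f2)"
      using g1 g2 by (intro mult_left_mono add_mono) auto
    also have "\<dots> \<le> ennreal (2 powr q) * (ennreal (C + D) * data_norm f)"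
      using CD by (rule mult_left_mono) simp
    also have "\<dots> = ennreal B * data_norm f"
      using *(2) **(2) by (simp add: B_def ennreal_mult mult.assoc)
    finally have "ennreal (\<bar>integral\<^sup>L \<mu> f\<bar> powr q) \<le> ennreal B * data_norm f" .
    moreover have "decomposes (join_index \<Gamma> \<Delta>) (join_fam U V) (\<lambda>x. f x - integral\<^sup>L \<mu> f * h x) (ennreal B * data_norm f)"
      by (rule decomposes_mono[OF decomposes_cong[OF decomposes_join] le2])
         (use g1 g2 in \<open>auto simp: algebra_simps int(2) f12\<close>)
    ultimately show ?thesis using int by blast
  qed
  moreover have "negligible (E \<union> F - (\<Union>t\<in>join_index \<Gamma> \<Delta>. join_fam U V t))"
    unfolding UN_join by (rule negligible_subset[OF negligible_Un[OF *(3) **(3)]]) auto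
  ultimately show ?thesis
    using transportableI[OF good_family_join[OF *(1) **(1)] B(1)] by blast
qed

end

section \<open>Transport inside a cube and along chains of cubes\<close>

lemma rigid_motion_dist: "rigid_motion T \<Longrightarrow> dist (T x) (T y) = dist x y"
  unfolding rigid_motion_def
  by (auto simp: dist_norm orthogonal_transformation_norm orthogonal_transformation_linear
      simp flip: linear_diff)

lemma rigid_motion_inverse:
  fixes T :: "real^'n::finite \<Rightarrow> real^'n"
  assumes "rigid_motion T"
  obtains S where "rigid_motion S" "\<And>x. S (T x) = x" "\<And>x. T (S x) = x"
proof -
  obtain c f where f: "orthogonal_transformation f" and T: "T = (\<lambda>x. c + f x)"
    using assms by (auto simp: rigid_motion_def)
  have inv: "orthogonal_transformation (inv f)" using f by (rule orthogonal_transformation_inv)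
  have b: "bij f" using f by (rule orthogonal_transformation_bij)
  define S where "S = (\<lambda>y. - inv f c + inv f y)"
  have lin: "linear (inv f)" using inv by (rule orthogonal_transformation_linear)
  have "rigid_motion S" unfolding rigid_motion_def S_def using inv by blast
  moreover have "S (T x) = x" for x
    using b by (simp add: S_def T linear_add[OF lin] bij_is_inj)
  moreover have "T (S x) = x" for x
    using b orthogonal_transformation_linear[OF f]
    by (simp add: S_def T linear_add linear_diff bij_is_surj surj_f_inv_f)
  ultimately show ?thesis using that by blast
qed

lemma rigid_motion_continuous: "rigid_motion T \<Longrightarrow> continuous_on A T"
  unfolding continuous_on_iff by (auto simp: rigid_motion_dist)

lemma rigid_motion_id: "rigid_motion (\<lambda>x. x)"
  unfolding rigid_motion_def by (rule exI[of _ 0], rule exI[of _ "\<lambda>x. x"]) (simp add: orthogonal_transformation)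

lemma rigid_motion_bounded: 
  fixes T :: "real^'n::finite \<Rightarrow> real^'n"
  assumes "rigid_motion T" "bounded A" shows "bounded (T ` A)"
proof -
  obtain e x where "\<forall>y\<in>A. dist x y \<le> e" using assms(2) by (auto simp: bounded_def)
  then have "\<forall>y\<in>T ` A. dist (T x) y \<le> e" using rigid_motion_dist[OF assms(1)] by auto
  then show ?thesis unfolding bounded_def by blast
qed

lemma rigid_motion_image_vimage:
  assumes "\<And>x. S (T x) = x" "\<And>x. T (S x) = x"
  shows "T ` A = S -` A"
  by (auto simp: assms image_iff) (metis assms(2))

lemma open_cube_open_bounded:
  assumes "open_cube Q" shows "open Q" "bounded Q"
proof -
  obtain T a b where T: "rigid_motion T" and Q: "Q = T ` box a b"
    using assms by (auto simp: open_cube_def)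
  obtain S where S: "rigid_motion S" "\<And>x. S (T x) = x" "\<And>x. T (S x) = x"
    using rigid_motion_inverse[OF T] by blast
  show "open Q"
    unfolding Q rigid_motion_image_vimage[OF S(2,3)]
    by (intro open_vimage open_box rigid_motion_continuous S)
  show "bounded Q" unfolding Q by (rule rigid_motion_bounded[OF T bounded_box])
qed

lemma open_cube_axis_parallel:
  fixes x :: "real^'n::finite"
  assumes "0 < r" shows "open_cube (box (x - (\<chi> i. r)) (x + (\<chi> i. r)))"
  unfolding open_cube_def
  by (intro exI[of _ "\<lambda>x. x"] exI[of _ "x - (\<chi> i. r)"] exI[of _ "x + (\<chi> i. r)"] exI[of _ "2 * r"])
     (use assms rigid_motion_id in auto)

lemma open_contains_axis_cbox:
  fixes y :: "real^'n::finite"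
  assumes "open A" "y \<in> A"
  obtains e where "0 < e" "\<And>x. (\<And>i. \<bar>x $ i - y $ i\<bar> \<le> e) \<Longrightarrow> x \<in> A"
proof -
  obtain r where r: "0 < r" "cball y r \<subseteq> A" using assms open_contains_cball by blast
  have "x \<in> A" if "\<And>i. \<bar>x $ i - y $ i\<bar> \<le> r / CARD('n)" for x
  proof -
    have "norm (x - y) \<le> (\<Sum>i\<in>UNIV. \<bar>(x - y) $ i\<bar>)" by (rule norm_le_l1_cart)
    also have "\<dots> \<le> (\<Sum>i\<in>(UNIV::'n set). r / CARD('n))" by (intro sum_mono) (use that in simp)
    also have "\<dots> = r" by simp
    finally show ?thesis using r(2) by (auto simp: dist_norm norm_minus_commute)
  qed
  moreover have "0 < r / CARD('n)" using r(1) by simp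
  ultimately show ?thesis using that by blast
qed

section \<open>Hoelder's inequality for nonnegative integrals\<close>

lemma abs_add_powr_le:
  fixes a b :: real
  assumes "0 \<le> q"
  shows "\<bar>a + b\<bar> powr q \<le> 2 powr q * (\<bar>a\<bar> powr q + \<bar>b\<bar> powr q)"
proof -
  have "\<bar>a + b\<bar> powr q \<le> (2 * max \<bar>a\<bar> \<bar>b\<bar>) powr q"
    using assms by (intro powr_mono2) auto
  also have "\<dots> \<le> 2 powr q * (\<bar>a\<bar> powr q + \<bar>b\<bar> powr q)"
    by (auto simp: powr_mult max_def)
  finally show ?thesis .
qed

text \<open>Young's inequality is applied to \<open>u / s\<close> and \<open>v / t\<close>,
  normalised by bounds for their norms, so that the right side integrates to at most
  \<open>s * t * (1 / p + 1 / q)\<close>. The normalisation breaks down at \<open>A = 0\<close>,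
  where the product vanishes almost everywhere.\<close>

lemma nn_integral_Hoelder:
  fixes u v :: "'a \<Rightarrow> real"
  assumes [measurable]: "u \<in> borel_measurable M" "v \<in> borel_measurable M"
    and nonneg: "\<And>x. x \<in> space M \<Longrightarrow> 0 \<le> u x" "\<And>x. x \<in> space M \<Longrightarrow> 0 \<le> v x"
    and pq: "1 < p" "1 < q" "1 / p + 1 / q = 1"
    and A: "(\<integral>\<^sup>+x. ennreal (u x powr q) \<partial>M) \<le> ennreal A" "0 \<le> A"
    and B: "(\<integral>\<^sup>+x. ennreal (v x powr p) \<partial>M) \<le> ennreal B" "0 < B"
  shows "(\<integral>\<^sup>+x. ennreal (u x * v x) \<partial>M) \<le> ennreal (A powr (1 / q) * B powr (1 / p))"
proof (cases "A = 0")
  case True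
  then have "AE x in M. ennreal (u x powr q) = 0"
    using A by (subst nn_integral_0_iff_AE[symmetric]) auto
  then have "AE x in M. ennreal (u x * v x) = 0"
    by (rule AE_mp) (use nonneg in \<open>auto intro!: AE_I2\<close>)
  then have "(\<integral>\<^sup>+x. ennreal (u x * v x) \<partial>M) = (\<integral>\<^sup>+x. 0 \<partial>M)" by (rule nn_integral_cong_AE)
  then show ?thesis by simp
next
  case False
  define s where "s = A powr (1 / q)"
  define t where "t = B powr (1 / p)"
  have st: "0 < s" "0 < t" using False A(2) B(2) by (auto simp: s_def t_def)
  have sA: "s powr q = A" and tB: "t powr p = B"
    using False A(2) B(2) pq by (auto simp: s_def t_def powr_powr)
  have "u x * v x \<le> s * t / q / A * u x powr q + s * t / p / B * v x powr p" if "x \<in> space M" for x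
  proof -
    have "u x / s * (v x / t) \<le> (u x / s) powr q / q + (v x / t) powr p / p"
      by (rule Youngs_inequality) (use pq nonneg[OF that] st in \<open>auto simp: add.commute\<close>)
    also have "\<dots> = u x powr q / A / q + v x powr p / B / p"
      using nonneg[OF that] st by (simp add: powr_divide sA tB)
    finally have "s * t * (u x / s * (v x / t)) \<le> s * t * (u x powr q / A / q + v x powr p / B / p)"
      using st by (intro mult_left_mono) auto
    then show ?thesis using st by (simp add: algebra_simps)
  qed
  then have "(\<integral>\<^sup>+x. ennreal (u x * v x) \<partial>M)
      \<le> (\<integral>\<^sup>+x. ennreal (s * t / q / A) * ennreal (u x powr q) + ennreal (s * t / p / B) * ennreal (v x powr p) \<partial>M)"
    using st A(2) B(2) pq False
    by (intro nn_integral_mono) (simp add: ennreal_leI flip: ennreal_mult ennreal_plus)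
  also have "\<dots> = ennreal (s * t / q / A) * (\<integral>\<^sup>+x. ennreal (u x powr q) \<partial>M)
       + ennreal (s * t / p / B) * (\<integral>\<^sup>+x. ennreal (v x powr p) \<partial>M)"
    by (simp add: nn_integral_add nn_integral_cmult)
  also have "\<dots> \<le> ennreal (s * t / q / A) * ennreal A + ennreal (s * t / p / B) * ennreal B"
    by (intro add_mono mult_left_mono A B) auto
  also have "\<dots> = ennreal (s * t / q + s * t / p)"
    using st A(2) B(2) pq False by (simp add: field_simps flip: ennreal_mult ennreal_plus)
  also have "s * t / q + s * t / p = s * t * (1 / p + 1 / q)" by (simp add: field_simps)
  finally show ?thesis using pq by (simp add: s_def t_def)
qed

lemma nn_integral_le_cmult:
  fixes u v :: "'a \<Rightarrow> real"
  assumes "v \<in> borel_measurable M" "0 \<le> C"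
    and "\<And>x. x \<in> space M \<Longrightarrow> 0 \<le> v x" "\<And>x. x \<in> space M \<Longrightarrow> u x \<le> C * v x"
  shows "(\<integral>\<^sup>+x. ennreal (u x) \<partial>M) \<le> ennreal C * (\<integral>\<^sup>+x. ennreal (v x) \<partial>M)"
proof -
  have "(\<integral>\<^sup>+x. ennreal (u x) \<partial>M) \<le> (\<integral>\<^sup>+x. ennreal C * ennreal (v x) \<partial>M)"
    using assms(2-4) by (intro nn_integral_mono) (simp add: ennreal_leI flip: ennreal_mult)
  also have "\<dots> = ennreal C * (\<integral>\<^sup>+x. ennreal (v x) \<partial>M)"
    by (rule nn_integral_cmult) (use assms(1) in measurable)
  finally show ?thesis .
qed

context weighted_domain
begin

section \<open>The distance to the frontier and weighted bounds for integrals\<close>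

lemma conj_exp': "q / p = q - 1" "(q - 1) * p = q"
  using conj_exp p_gt1 q_gt1 by (auto simp: field_simps)

lemma d_bounded: obtains D where "0 < D" "\<And>x. x \<in> \<Omega> \<Longrightarrow> d x \<le> D"
proof -
  obtain z where z: "z \<in> frontier \<Omega>" using frontier_nonempty by blast
  obtain e where e: "0 < e" "\<And>x. x \<in> \<Omega> \<Longrightarrow> norm x \<le> e"
    using bounded_dom unfolding bounded_pos by blast
  have "d x \<le> e + norm z" if "x \<in> \<Omega>" for x
  proof -
    have "d x \<le> dist x z" unfolding bdist_def by (rule infdist_le[OF z])
    also have "\<dots> \<le> norm x + norm z" by (simp add: dist_norm norm_triangle_ineq4)
    finally show ?thesis using e(2)[OF that] by linarith
  qed
  moreover have "0 < e + norm z" using e(1) by (simp add: add_pos_nonneg)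
  ultimately show ?thesis by (rule that[rotated])
qed

text \<open>The segment from \<open>x\<close> to \<open>w\<close> crosses the frontier. Together
  with \<open>d_ge_dist_frontier\<close> this allows \<open>d\<close> to be estimated through points
  outside \<Omega>, without locating frontier points.\<close>

lemma d_le_dist_outside: assumes "x \<in> \<Omega>" "w \<notin> \<Omega>" shows "d x \<le> dist x w"
proof -
  have "closed_segment x w \<inter> frontier \<Omega> \<noteq> {}"
    by (rule connected_Int_frontier) (use assms in auto)
  then obtain z where z: "z \<in> closed_segment x w" "z \<in> frontier \<Omega>" by blast
  have "d x \<le> dist x z" unfolding bdist_def by (rule infdist_le[OF z(2)])
  also have "\<dots> \<le> dist x w" using segment_bound(1)[OF z(1)] by (simp add: dist_norm norm_minus_commute)
  finally show ?thesis .
qed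

lemma d_ge_dist_frontier: assumes "\<And>w. w \<notin> \<Omega> \<Longrightarrow> r \<le> dist x w" shows "r \<le> d x"
proof -
  have "w \<notin> \<Omega>" if "w \<in> frontier \<Omega>" for w
    using that open_dom by (simp add: frontier_def interior_open)
  then show ?thesis
    unfolding bdist_def using frontier_nonempty assms by (auto simp: infdist_notempty intro!: cINF_greatest)
qed

lemma data_space_measurable: "f \<in> data_space \<Longrightarrow> f \<in> borel_measurable \<mu>"
  by (simp add: weighted_Lq_def)

lemma data_space_finite: "f \<in> data_space \<Longrightarrow> data_norm f < \<infinity>"
  by (simp add: weighted_Lq_def data_norm_def)

lemma d_powr_absorb:
  assumes "x \<in> \<Omega>" "d x \<le> D" "0 \<le> s"
  shows "d x powr (r + s) \<le> D powr s * d x powr r"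
  unfolding powr_add using d_pos[OF assms(1)] assms(2,3)
  by (subst mult.commute) (intro mult_right_mono powr_mono2, auto)

text \<open>Hoelder's inequality for the factors
  \<open>\<bar>f x\<bar> * d x powr (- \<gamma>)\<close> and \<open>d x powr \<gamma>\<close>. The
  exponent stays free because it is used with \<gamma> = \<beta> for the total mass and with
  \<gamma> = \<beta> - \<kappa> for the columns of a tree.\<close>

lemma weighted_Hoelder:
  assumes [measurable]: "f \<in> borel_measurable \<mu>" "E \<in> sets \<mu>"
    and X: "(\<integral>\<^sup>+x. ennreal (\<bar>f x\<bar> powr q * d x powr (- \<gamma> * q) * indicator E x) \<partial>\<mu>) = X" "X < \<infinity>"
    and B: "0 < B" "(\<integral>\<^sup>+x. ennreal (d x powr (\<gamma> * p)) * indicator E x \<partial>\<mu>) \<le> ennreal B"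
  shows "integrable \<mu> (\<lambda>x. \<bar>f x\<bar> * indicator E x)"
    and "ennreal ((\<integral>x. \<bar>f x\<bar> * indicator E x \<partial>\<mu>) powr q) \<le> ennreal (B powr (q - 1)) * X"
proof -
  define A where "A = enn2real X"
  have A: "X = ennreal A" "0 \<le> A" using X(2) by (auto simp: A_def)
  have eq: "\<bar>f x\<bar> * indicator E x = (\<bar>f x\<bar> * d x powr (- \<gamma>) * indicator E x) * (d x powr \<gamma> * indicator E x)"
    if "x \<in> space \<mu>" for x
    using that d_pos[of x] by (auto simp: space_\<mu> indicator_def powr_minus divide_simps)
  have "(\<integral>\<^sup>+x. ennreal (\<bar>f x\<bar> * indicator E x) \<partial>\<mu>)
      = (\<integral>\<^sup>+x. ennreal ((\<bar>f x\<bar> * d x powr (- \<gamma>) * indicator E x) * (d x powr \<gamma> * indicator E x)) \<partial>\<mu>)"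
    by (rule nn_integral_cong) (simp only: eq)
  also have "\<dots> \<le> ennreal (A powr (1 / q) * B powr (1 / p))"
  proof (rule nn_integral_Hoelder)
    have "(\<integral>\<^sup>+x. ennreal ((\<bar>f x\<bar> * d x powr (- \<gamma>) * indicator E x) powr q) \<partial>\<mu>) = X"
      unfolding X(1)[symmetric]
      by (intro nn_integral_cong) (auto simp: powr_mult powr_powr indicator_def)
    then show "(\<integral>\<^sup>+x. ennreal ((\<bar>f x\<bar> * d x powr (- \<gamma>) * indicator E x) powr q) \<partial>\<mu>) \<le> ennreal A"
      by (simp add: A)
    have "(\<integral>\<^sup>+x. ennreal ((d x powr \<gamma> * indicator E x) powr p) \<partial>\<mu>)
       = (\<integral>\<^sup>+x. ennreal (d x powr (\<gamma> * p)) * indicator E x \<partial>\<mu>)"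
      by (intro nn_integral_cong) (auto simp: indicator_def powr_powr)
    then show "(\<integral>\<^sup>+x. ennreal ((d x powr \<gamma> * indicator E x) powr p) \<partial>\<mu>) \<le> ennreal B" using B by simp
  qed (use p_gt1 q_gt1 conj_exp A B in auto)
  finally have le: "(\<integral>\<^sup>+x. ennreal (\<bar>f x\<bar> * indicator E x) \<partial>\<mu>) \<le> ennreal (A powr (1 / q) * B powr (1 / p))" .
  then show int: "integrable \<mu> (\<lambda>x. \<bar>f x\<bar> * indicator E x)"
    by (intro integrableI_nonneg) (auto intro: le_less_trans)
  have "(\<integral>x. \<bar>f x\<bar> * indicator E x \<partial>\<mu>) \<le> A powr (1 / q) * B powr (1 / p)"
    using le int by (subst (asm) nn_integral_eq_integral) auto
  then have "(\<integral>x. \<bar>f x\<bar> * indicator E x \<partial>\<mu>) powr q \<le> (A powr (1 / q) * B powr (1 / p)) powr q"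
    using q_gt1 by (intro powr_mono2) auto
  also have "\<dots> = B powr (q - 1) * A"
    using q_gt1 A(2) by (simp add: powr_mult powr_powr conj_exp'(1))
  finally show "ennreal ((\<integral>x. \<bar>f x\<bar> * indicator E x \<partial>\<mu>) powr q) \<le> ennreal (B powr (q - 1)) * X"
    by (simp add: A ennreal_leI flip: ennreal_mult)
qed

lemma integral_bound_on:
  assumes f: "f \<in> data_space" "\<And>x. x \<in> \<Omega> - E \<Longrightarrow> f x = 0" and E: "E \<in> sets \<mu>"
    and B: "0 < B" "(\<integral>\<^sup>+x. ennreal (d x powr (\<beta> * p)) * indicator E x \<partial>\<mu>) \<le> ennreal B"
  shows "integrable \<mu> f" "ennreal (\<bar>integral\<^sup>L \<mu> f\<bar> powr q) \<le> ennreal (B powr (q - 1)) * data_norm f"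
proof -
  have fE: "f x * indicator E x = f x" if "x \<in> space \<mu>" for x
    using that f(2)[of x] by (auto simp: space_\<mu> indicator_def)
  have abs: "\<bar>f x\<bar> * indicator E x = \<bar>f x\<bar>" if "x \<in> space \<mu>" for x
    using fE[OF that] by (auto simp: indicator_def)
  have X: "(\<integral>\<^sup>+x. ennreal (\<bar>f x\<bar> powr q * d x powr (- \<beta> * q) * indicator E x) \<partial>\<mu>) = data_norm f"
    unfolding data_norm_def by (rule nn_integral_cong) (use fE in \<open>auto simp: indicator_def\<close>)
  note H = weighted_Hoelder[OF data_space_measurable[OF f(1)] E X data_space_finite[OF f(1)] B]
  have "integrable \<mu> (\<lambda>x. \<bar>f x\<bar>)"
    using H(1) abs by (subst (asm) Bochner_Integration.integrable_cong[OF refl abs]) auto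
  then show int: "integrable \<mu> f" using data_space_measurable[OF f(1)] by (simp add: integrable_abs_iff)
  have "\<bar>integral\<^sup>L \<mu> f\<bar> \<le> (\<integral>x. \<bar>f x\<bar> * indicator E x \<partial>\<mu>)"
    using integral_abs_bound[of \<mu> f] Bochner_Integration.integral_cong[OF refl abs, of \<mu>] by simp
  then have "\<bar>integral\<^sup>L \<mu> f\<bar> powr q \<le> (\<integral>x. \<bar>f x\<bar> * indicator E x \<partial>\<mu>) powr q"
    using q_gt1 by (intro powr_mono2) auto
  then show "ennreal (\<bar>integral\<^sup>L \<mu> f\<bar> powr q) \<le> ennreal (B powr (q - 1)) * data_norm f"
    using H(2) by (meson ennreal_leI order_trans)
qed

text \<open>If \<open>S\<close> has measure zero, then division by zero makes \<open>bump S\<close> the zero function.\<close>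

definition bump :: "(real^'n) set \<Rightarrow> real^'n \<Rightarrow> real" where
  "bump S x = indicator S x / measure lebesgue S"

lemma measure_\<mu>: "S \<in> sets \<mu> \<Longrightarrow> measure \<mu> S = measure lebesgue S"
  using \<Omega>_sets by (simp add: measure_restrict_space sets_\<mu>)

lemma bump_measurable [measurable]: "S \<in> sets \<mu> \<Longrightarrow> bump S \<in> borel_measurable \<mu>"
  unfolding bump_def by (intro borel_measurable_divide borel_measurable_indicator) auto

lemma bump_integral:
  assumes "S \<in> sets \<mu>" "0 < measure lebesgue S"
  shows "integrable \<mu> (bump S)" "integral\<^sup>L \<mu> (bump S) = 1"
proof -
  interpret finite_measure \<mu> by (rule finite_\<mu>)
  show "integrable \<mu> (bump S)"
    unfolding bump_def using assms(1) by (intro integrable_divide) (simp add: emeasure_eq_measure)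
  show "integral\<^sup>L \<mu> (bump S) = 1"
    unfolding bump_def using assms measure_\<mu>[of S] by (auto simp: sets_\<mu> Int_absorb2 space_\<mu>)
qed

lemma bump_nonneg: "0 \<le> bump S x"
  by (simp add: bump_def)

lemma bump_outside: "x \<notin> S \<Longrightarrow> bump S x = 0"
  by (simp add: bump_def)

lemma bump_le: "bump S x \<le> 1 / measure lebesgue S"
  by (auto simp: bump_def indicator_def)

lemma piece_norm_add_le:
  assumes [measurable]: "f \<in> borel_measurable \<mu>" "g \<in> borel_measurable \<mu>"
  shows "piece_norm (\<lambda>x. f x + g x) \<le> ennreal (2 powr q) * (piece_norm f + piece_norm g)"
proof -
  let ?w = "\<lambda>x. d x powr ((- \<beta> - \<alpha> + 1) * q)"
  have "piece_norm (\<lambda>x. f x + g x) \<le>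
     (\<integral>\<^sup>+x. ennreal (2 powr q) * (ennreal (\<bar>f x\<bar> powr q * ?w x) + ennreal (\<bar>g x\<bar> powr q * ?w x)) \<partial>\<mu>)"
    unfolding piece_norm_def
  proof (rule nn_integral_mono)
    fix x
    have "\<bar>f x + g x\<bar> powr q * ?w x \<le> (2 powr q * (\<bar>f x\<bar> powr q + \<bar>g x\<bar> powr q)) * ?w x"
      using q_gt1 by (intro mult_right_mono abs_add_powr_le) auto
    then show "ennreal (\<bar>f x + g x\<bar> powr q * ?w x)
       \<le> ennreal (2 powr q) * (ennreal (\<bar>f x\<bar> powr q * ?w x) + ennreal (\<bar>g x\<bar> powr q * ?w x))"
      by (simp add: ennreal_leI algebra_simps flip: ennreal_mult ennreal_plus)
  qed
  also have "\<dots> = ennreal (2 powr q) * (piece_norm f + piece_norm g)"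
    unfolding piece_norm_def by (subst nn_integral_cmult; simp add: nn_integral_add)
  finally show ?thesis .
qed

text \<open>The two weights differ by the factor \<open>d x powr ((1 - \<alpha>) * q)\<close>, which
  is bounded because \<alpha> \<le> 1 and \<Omega> is bounded.\<close>

lemma piece_norm_le_data_norm:
  obtains C where "0 < C" "\<And>f. f \<in> borel_measurable \<mu> \<Longrightarrow> piece_norm f \<le> ennreal C * data_norm f"
proof -
  obtain D where D: "0 < D" "\<And>x. x \<in> \<Omega> \<Longrightarrow> d x \<le> D" using d_bounded by blast
  have "piece_norm f \<le> ennreal (D powr ((1 - \<alpha>) * q)) * data_norm f" if "f \<in> borel_measurable \<mu>" for f
    unfolding piece_norm_def data_norm_def
  proof (rule nn_integral_le_cmult)
    have [measurable]: "f \<in> borel_measurable \<mu>" by fact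
    show "(\<lambda>x. \<bar>f x\<bar> powr q * d x powr (- \<beta> * q)) \<in> borel_measurable \<mu>" by measurable
    fix x assume "x \<in> space \<mu>"
    then have x: "x \<in> \<Omega>" by (simp add: space_\<mu>)
    have "0 \<le> (1 - \<alpha>) * q" using \<alpha>_le1 q_gt1 by simp
    then have "d x powr (- \<beta> * q + (1 - \<alpha>) * q) \<le> D powr ((1 - \<alpha>) * q) * d x powr (- \<beta> * q)"
      by (rule d_powr_absorb[OF x D(2)[OF x]])
    also have "- \<beta> * q + (1 - \<alpha>) * q = (- \<beta> - \<alpha> + 1) * q" by (simp add: algebra_simps)
    finally have "\<bar>f x\<bar> powr q * d x powr ((- \<beta> - \<alpha> + 1) * q)
        \<le> \<bar>f x\<bar> powr q * (D powr ((1 - \<alpha>) * q) * d x powr (- \<beta> * q))"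
      by (rule mult_left_mono) simp
    then show "\<bar>f x\<bar> powr q * d x powr ((- \<beta> - \<alpha> + 1) * q)
        \<le> D powr ((1 - \<alpha>) * q) * (\<bar>f x\<bar> powr q * d x powr (- \<beta> * q))"
      by (simp only: mult_ac)
  qed auto
  moreover have "0 < D powr ((1 - \<alpha>) * q)" using D(1) by simp
  ultimately show ?thesis by (rule that[rotated])
qed

text \<open>On the compact set \<open>K\<close> the weight is bounded for either sign of its
  exponent, so the cost is governed by the amplitude alone.\<close>

lemma piece_norm_bounded_function:
  assumes "compact K" "K \<subseteq> \<Omega>" and "\<And>x. x \<in> \<Omega> - K \<Longrightarrow> h x = 0" "\<And>x. x \<in> \<Omega> \<Longrightarrow> \<bar>h x\<bar> \<le> m"
  obtains C where "0 \<le> C" "\<And>a. piece_norm (\<lambda>x. a * h x) \<le> ennreal (C * \<bar>a\<bar> powr q)"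
proof -
  interpret finite_measure \<mu> by (rule finite_\<mu>)
  obtain W where W: "0 < W" "\<And>x. x \<in> K \<Longrightarrow> d x powr ((- \<beta> - \<alpha> + 1) * q) \<le> W"
    using d_powr_bounded[OF assms(1,2)] by blast
  define C where "C = m powr q * W * measure \<mu> \<Omega>"
  have "piece_norm (\<lambda>x. a * h x) \<le> ennreal (C * \<bar>a\<bar> powr q)" for a
  proof -
    have "piece_norm (\<lambda>x. a * h x) \<le> (\<integral>\<^sup>+x. ennreal (\<bar>a\<bar> powr q * m powr q * W) \<partial>\<mu>)"
      unfolding piece_norm_def
    proof (rule nn_integral_mono)
      fix x assume "x \<in> space \<mu>"
      then have x: "x \<in> \<Omega>" by (simp add: space_\<mu>)
      show "ennreal (\<bar>a * h x\<bar> powr q * d x powr ((- \<beta> - \<alpha> + 1) * q)) \<le> ennreal (\<bar>a\<bar> powr q * m powr q * W)"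
      proof (cases "x \<in> K")
        case True
        have "\<bar>h x\<bar> powr q \<le> m powr q" using assms(4)[OF x] q_gt1 by (intro powr_mono2) auto
        then have "\<bar>a\<bar> powr q * \<bar>h x\<bar> powr q * d x powr ((- \<beta> - \<alpha> + 1) * q) \<le> \<bar>a\<bar> powr q * m powr q * W"
          using W(2)[OF True] by (intro mult_mono) auto
        then show ?thesis by (intro ennreal_leI) (simp add: abs_mult powr_mult)
      qed (use assms(3) x in auto)
    qed
    also have "\<dots> = ennreal (C * \<bar>a\<bar> powr q)"
      using W(1) by (simp add: C_def emeasure_eq_measure space_\<mu> mult_ac flip: ennreal_mult)
    finally show ?thesis .
  qed
  moreover have "0 \<le> C" using W(1) by (simp add: C_def)
  ultimately show ?thesis by (rule that[rotated])
qed

section \<open>Linking the bumps of cubes\<close>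

lemma good_family_single:
  "open_cube Q \<Longrightarrow> closure Q \<subseteq> \<Omega> \<Longrightarrow> good_family {0} (\<lambda>_. Q)"
  by (auto simp: good_family_def)

lemma decomposes_single:
  assumes "integrable \<mu> h" "\<And>x. x \<in> \<Omega> - Q \<Longrightarrow> h x = 0" "integral\<^sup>L \<mu> h = 0" "piece_norm h \<le> c"
  shows "decomposes {0} (\<lambda>_. Q) h c"
  unfolding decomposes_def
  by (rule exI[of _ "\<lambda>_. h"]) (use assms has_sum_finite[of "{0::nat}" "\<lambda>_. h _"] in auto)

lemma cube_measure_pos:
  assumes "open S" "S \<noteq> {}" "S \<subseteq> \<Omega>"
  shows "S \<in> sets \<mu>" "0 < measure lebesgue S"
proof -
  have S: "S \<in> lmeasurable"
    using assms bounded_subset[OF bounded_dom assms(3)] by (intro lmeasurable_open)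
  then show "S \<in> sets \<mu>" using assms(3) by (auto simp: sets_\<mu>)
  have "\<not> negligible S" using assms open_not_negligible by blast
  then have "measure lebesgue S \<noteq> 0" using S negligible_iff_measure by blast
  then show "0 < measure lebesgue S" by (simp add: zero_less_measure_iff)
qed

text \<open>A multiple of the difference of the two bumps has mean zero and vanishes outside
  \<open>Q\<close>, so it is one piece on one cube.\<close>

lemma linked_bump:
  assumes Q: "open_cube Q" "closure Q \<subseteq> \<Omega>"
    and S: "S \<in> sets \<mu>" "S \<subseteq> Q" "0 < measure lebesgue S"
    and S': "S' \<in> sets \<mu>" "S' \<subseteq> Q" "0 < measure lebesgue S'"
  shows "linked (bump S) (bump S')"
proof -
  let ?h = "\<lambda>x. bump S x - bump S' x"
  have h: "integrable \<mu> (\<lambda>x. a * ?h x)" "integral\<^sup>L \<mu> (\<lambda>x. a * ?h x) = 0" for a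
    using bump_integral[OF S(1,3)] bump_integral[OF S'(1,3)] by auto
  have "compact (closure Q)" using open_cube_open_bounded(2)[OF Q(1)] by (simp add: compact_closure)
  moreover have "?h x = 0" if "x \<in> \<Omega> - closure Q" for x
    using that S(2) S'(2) closure_subset[of Q] by (auto simp: bump_def indicator_def)
  moreover have "\<bar>?h x\<bar> \<le> 1 / measure lebesgue S + 1 / measure lebesgue S'" for x
    using bump_le[of S x] bump_le[of S' x] bump_nonneg[of S x] bump_nonneg[of S' x] S(3) S'(3)
    by (smt (verit) divide_nonneg_pos)
  ultimately obtain C where C: "0 \<le> C" "\<And>a. piece_norm (\<lambda>x. a * ?h x) \<le> ennreal (C * \<bar>a\<bar> powr q)"
    using piece_norm_bounded_function[of "closure Q" ?h "1 / measure lebesgue S + 1 / measure lebesgue S'"]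
      Q(2) by metis
  have "decomposes {0} (\<lambda>_. Q) (\<lambda>x. a * ?h x) (ennreal (C * \<bar>a\<bar> powr q))" for a
  proof (rule decomposes_single[OF h(1) _ h(2) C(2)])
    fix x assume "x \<in> \<Omega> - Q"
    then have "x \<notin> S" "x \<notin> S'" using S(2) S'(2) by auto
    then show "a * ?h x = 0" by (simp add: bump_outside)
  qed
  then show ?thesis
    unfolding linked_def using good_family_single[OF Q] C(1) by blast
qed

lemma ex_cube:
  assumes "x \<in> \<Omega>"
  obtains Q where "open_cube Q" "x \<in> Q" "closure Q \<subseteq> \<Omega>"
proof -
  obtain r where r: "0 < r" "\<And>y. (\<And>i. \<bar>y $ i - x $ i\<bar> \<le> r) \<Longrightarrow> y \<in> \<Omega>"
    using open_contains_axis_cbox[OF open_dom assms] by blast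
  let ?Q = "box (x - (\<chi> i. r)) (x + (\<chi> i. r))"
  have "cbox (x - (\<chi> i. r)) (x + (\<chi> i. r)) \<subseteq> \<Omega>"
    by (auto simp: mem_box_cart abs_le_iff algebra_simps intro!: r(2))
  moreover have "closure ?Q \<subseteq> cbox (x - (\<chi> i. r)) (x + (\<chi> i. r))"
    by (intro closure_minimal box_subset_cbox closed_cbox)
  ultimately have "closure ?Q \<subseteq> \<Omega>" by blast
  moreover have "x \<in> ?Q" using r(1) by (simp add: mem_box_cart)
  ultimately show ?thesis using open_cube_axis_parallel[OF r(1)] that by blast
qed

text \<open>The mass passes through the bump of the intersection, which is open and nonempty and
  hence of positive measure: one step inside \<open>Q\<close>, one inside \<open>Q'\<close>.\<close>

lemma linked_bump_cubes:
  assumes Q: "open_cube Q" "closure Q \<subseteq> \<Omega>" and Q': "open_cube Q'" "closure Q' \<subseteq> \<Omega>"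
    and ne: "Q \<inter> Q' \<noteq> {}"
  shows "linked (bump Q) (bump Q')"
proof -
  have o: "open Q" "open Q'" using Q Q' open_cube_open_bounded by auto
  have sub: "Q \<subseteq> \<Omega>" "Q' \<subseteq> \<Omega>" using Q Q' closure_subset by blast+
  have Qn: "Q \<noteq> {}" "Q' \<noteq> {}" using ne by auto
  note m = cube_measure_pos[OF o(1) Qn(1) sub(1)] cube_measure_pos[OF o(2) Qn(2) sub(2)]
    cube_measure_pos[of "Q \<inter> Q'"]
  have "linked (bump Q) (bump (Q \<inter> Q'))"
    by (rule linked_bump[OF Q]) (use m o ne sub in auto)
  moreover have "linked (bump (Q \<inter> Q')) (bump Q')"
    by (rule linked_bump[OF Q']) (use m o ne sub in auto)
  ultimately show ?thesis by (rule linked_trans)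
qed

text \<open>Attach a cube \<open>c x\<close> to every point. Linking is an equivalence relation, and
  all points of \<open>c a\<close> have cubes linked to that of \<open>a\<close>; connectedness of
  \<Omega> then leaves a single class, without an explicit chain.\<close>

lemma linked_any_cubes:
  assumes Q: "open_cube Q" "closure Q \<subseteq> \<Omega>" "Q \<noteq> {}" and Q': "open_cube Q'" "closure Q' \<subseteq> \<Omega>" "Q' \<noteq> {}"
  shows "linked (bump Q) (bump Q')"
proof -
  define c where "c x = (SOME Q. open_cube Q \<and> x \<in> Q \<and> closure Q \<subseteq> \<Omega>)" for x
  have c: "open_cube (c x)" "x \<in> c x" "closure (c x) \<subseteq> \<Omega>" if "x \<in> \<Omega>" for x
    using someI_ex[of "\<lambda>Q. open_cube Q \<and> x \<in> Q \<and> closure Q \<subseteq> \<Omega>"] ex_cube[OF that]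
    unfolding c_def by metis+
  obtain x y where xy: "x \<in> Q" "y \<in> Q'" using Q Q' by blast
  have xy': "x \<in> \<Omega>" "y \<in> \<Omega>" using xy Q Q' closure_subset by blast+
  have "linked (bump (c x)) (bump (c y))"
  proof (rule connected_equivalence_relation[OF connected_dom xy'])
    fix a assume a: "a \<in> \<Omega>"
    have "linked (bump (c a)) (bump (c b))" if "b \<in> c a" for b
      using c[OF a] c[of b] that closure_subset[of "c a"] by (intro linked_bump_cubes) auto
    then show "\<exists>T. openin (top_of_set \<Omega>) T \<and> a \<in> T \<and> (\<forall>x\<in>T. linked (bump (c a)) (bump (c x)))"
      using c[OF a] open_cube_open_bounded(1)[OF c(1)[OF a]] closure_subset[of "c a"]
      by (intro exI[of _ "c a"]) (auto intro!: open_subset)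
  qed (blast intro: linked_sym linked_trans)+
  moreover have "linked (bump Q) (bump (c x))" "linked (bump (c y)) (bump Q')"
    using c[OF xy'(1)] c[OF xy'(2)] xy Q Q' by (auto intro!: linked_bump_cubes)
  ultimately show ?thesis by (blast intro: linked_trans)
qed

text \<open>On the compact closure of \<open>Q\<close> the powers of \<open>d\<close> are bounded,
  so the single piece \<open>f - I * bump Q\<close>, with \<open>I\<close> the integral of
  \<open>f\<close>, does the transport.\<close>

lemma transportable_cube:
  assumes Q: "open_cube Q" "closure Q \<subseteq> \<Omega>" "Q \<noteq> {}"
  shows "transportable Q (bump Q)"
proof -
  interpret finite_measure \<mu> by (rule finite_\<mu>)
  have sub: "Q \<subseteq> \<Omega>" using Q closure_subset by blast
  have m: "Q \<in> sets \<mu>" "0 < measure lebesgue Q"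
    using cube_measure_pos[OF open_cube_open_bounded(1)[OF Q(1)] Q(3) sub] by auto
  have K: "compact (closure Q)" using open_cube_open_bounded(2)[OF Q(1)] by (simp add: compact_closure)
  obtain W where W: "0 < W" "\<And>x. x \<in> closure Q \<Longrightarrow> d x powr (\<beta> * p) \<le> W"
    using d_powr_bounded[OF K Q(2)] by blast
  define B where "B = W * measure \<mu> \<Omega>"
  have B: "0 < B"
    using W m measure_\<mu>[of Q] finite_measure_mono[of Q \<Omega>] sets.top[of \<mu>] sub by (auto simp: B_def space_\<mu>)
  have "(\<integral>\<^sup>+x. ennreal (d x powr (\<beta> * p)) * indicator Q x \<partial>\<mu>) \<le> (\<integral>\<^sup>+x. ennreal W \<partial>\<mu>)"
    using W closure_subset[of Q] by (intro nn_integral_mono) (auto simp: indicator_def intro!: ennreal_leI)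
  also have "\<dots> = ennreal B"
    using W(1) by (simp add: B_def emeasure_eq_measure space_\<mu> flip: ennreal_mult)
  finally have BB: "(\<integral>\<^sup>+x. ennreal (d x powr (\<beta> * p)) * indicator Q x \<partial>\<mu>) \<le> ennreal B" .
  obtain C1 where C1: "0 < C1" "\<And>f. f \<in> borel_measurable \<mu> \<Longrightarrow> piece_norm f \<le> ennreal C1 * data_norm f"
    using piece_norm_le_data_norm by blast
  have b0: "bump Q x = 0" if "x \<in> \<Omega> - closure Q" for x
    using that closure_subset[of Q] by (auto simp: bump_def indicator_def)
  have b1: "\<bar>bump Q x\<bar> \<le> 1 / measure lebesgue Q" for x
    using bump_le[of Q x] bump_nonneg[of Q x] by simp
  obtain C2 where C2: "0 \<le> C2" "\<And>a. piece_norm (\<lambda>x. a * bump Q x) \<le> ennreal (C2 * \<bar>a\<bar> powr q)"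
    using piece_norm_bounded_function[where h = "bump Q", OF K Q(2) b0 b1] by blast
  define B1 where "B1 = B powr (q - 1)"
  define C where "C = B1 + 2 powr q * (C1 + C2 * B1)"
  have C: "0 \<le> C" "B1 \<le> C" "2 powr q * (C1 + C2 * B1) \<le> C"
    using C1(1) C2(1) by (auto simp: C_def B1_def)
  have "integrable \<mu> f \<and> ennreal (\<bar>integral\<^sup>L \<mu> f\<bar> powr q) \<le> ennreal C * data_norm f \<and>
        decomposes {0} (\<lambda>_. Q) (\<lambda>x. f x - integral\<^sup>L \<mu> f * bump Q x) (ennreal C * data_norm f)"
    if f: "f \<in> data_space" "\<forall>x\<in>\<Omega> - Q. f x = 0" for f
  proof -
    let ?I = "integral\<^sup>L \<mu> f"
    have int: "integrable \<mu> f" and le: "ennreal (\<bar>?I\<bar> powr q) \<le> ennreal B1 * data_norm f"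
      using integral_bound_on[OF f(1) _ m(1) B BB] f(2) by (auto simp: B1_def)
    note bi = bump_integral[OF m]
    have "piece_norm (\<lambda>x. f x + (- ?I) * bump Q x)
        \<le> ennreal (2 powr q) * (piece_norm f + piece_norm (\<lambda>x. (- ?I) * bump Q x))"
      using int bi by (intro piece_norm_add_le) auto
    also have "\<dots> \<le> ennreal (2 powr q) * (ennreal C1 * data_norm f + ennreal (C2 * \<bar>- ?I\<bar> powr q))"
      by (intro mult_left_mono add_mono C1(2) C2(2)) (use int in auto)
    also have "ennreal (C2 * \<bar>- ?I\<bar> powr q) = ennreal C2 * ennreal (\<bar>?I\<bar> powr q)"
      using C2 by (simp add: ennreal_mult)
    also have "ennreal (2 powr q) * (ennreal C1 * data_norm f + ennreal C2 * ennreal (\<bar>?I\<bar> powr q))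
       \<le> ennreal (2 powr q) * (ennreal C1 * data_norm f + ennreal C2 * (ennreal B1 * data_norm f))"
      by (intro mult_left_mono add_mono le) auto
    also have "\<dots> = ennreal (2 powr q * (C1 + C2 * B1)) * data_norm f"
      using C1 C2 by (simp add: B1_def ennreal_mult distrib_left distrib_right mult.assoc)
    also have "\<dots> \<le> ennreal C * data_norm f"
      using C by (intro mult_right_mono ennreal_leI) auto
    finally have "piece_norm (\<lambda>x. f x - ?I * bump Q x) \<le> ennreal C * data_norm f" by simp
    moreover have "ennreal (\<bar>?I\<bar> powr q) \<le> ennreal C * data_norm f"
      using le C by (meson ennreal_leI mult_right_mono order_trans zero_le)
    ultimately show ?thesis
      using int bi f(2) by (auto intro!: decomposes_single simp: bump_outside)
  qed
  then show ?thesis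
    by (intro transportableI[OF good_family_single[OF Q(1,2)] C(1)]) auto
qed

end

section \<open>Transport along a tree of Whitney cubes\<close>

lemma sum_geometric_le:
  fixes r :: real
  assumes "1 < r"
  shows "(\<Sum>m\<le>M. r ^ m) \<le> r / (r - 1) * r ^ M"
proof (induction M)
  case (Suc M)
  have "(\<Sum>m\<le>Suc M. r ^ m) \<le> r / (r - 1) * r ^ M + r ^ Suc M" using Suc by simp
  also have "\<dots> = r / (r - 1) * r ^ Suc M" using assms by (simp add: field_simps)
  finally show ?case .
qed (use assms in \<open>simp add: field_simps\<close>)

text \<open>Adding the powers of both endpoint constants covers both signs of \<gamma>. In this form
  the comparability of \<open>d\<close> with the side of a cube enters the weights.\<close>

lemma powr_between_le:
  fixes a b x s :: real
  assumes "0 < a" "0 < s" "a * s \<le> x" "x \<le> b * s"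
  shows "x powr \<gamma> \<le> (a powr \<gamma> + b powr \<gamma>) * s powr \<gamma>"
proof -
  have x: "0 < x" using assms by (meson less_le_trans mult_pos_pos)
  then have b: "0 < b" using assms by (smt (verit) mult_nonpos_nonneg)
  show ?thesis
  proof (cases "0 \<le> \<gamma>")
    case True
    then have "x powr \<gamma> \<le> (b * s) powr \<gamma>" using x assms by (intro powr_mono2) auto
    also have "\<dots> = b powr \<gamma> * s powr \<gamma>" using assms b by (simp add: powr_mult)
    also have "\<dots> \<le> (a powr \<gamma> + b powr \<gamma>) * s powr \<gamma>" by (intro mult_right_mono) auto
    finally show ?thesis .
  next
    case False
    then have "x powr \<gamma> \<le> (a * s) powr \<gamma>" using assms by (intro powr_mono2') auto
    also have "\<dots> = a powr \<gamma> * s powr \<gamma>" using assms by (simp add: powr_mult)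
    also have "\<dots> \<le> (a powr \<gamma> + b powr \<gamma>) * s powr \<gamma>" by (intro mult_right_mono) auto
    finally show ?thesis .
  qed
qed

text \<open>
  \<open>lv R\<close> is the dyadic level of \<open>R\<close>, so the side is comparable to \<open>2 powr - lv R\<close>; \<open>ht\<close> only serves
  to make the parent relation well-founded.
\<close>

locale whitney_tree = weighted_domain \<Omega> p q \<alpha> \<beta>
  for \<Omega> :: "(real^'n::finite) set" and p q \<alpha> \<beta> :: real +
  fixes W :: "'i set" and cell U :: "'i \<Rightarrow> (real^'n) set" and par :: "'i \<Rightarrow> 'i" and root :: 'i
    and lv ht :: "'i \<Rightarrow> nat" and c0 cM c1 c2 c3 :: real
  assumes cell_sets: "R \<in> W \<Longrightarrow> cell R \<in> sets \<mu>"
    and cell_disjoint: "R \<in> W \<Longrightarrow> S \<in> W \<Longrightarrow> R \<noteq> S \<Longrightarrow> cell R \<inter> cell S = {}"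
    and cell_U: "R \<in> W \<Longrightarrow> cell R \<subseteq> U R" and cell_par_U: "R \<in> W \<Longrightarrow> cell (par R) \<subseteq> U R"
    and c_pos: "0 < c0" "0 < cM" "0 < c1" "0 < c2" "0 < c3"
    and measure_cell_ge: "R \<in> W \<Longrightarrow> c0 * (2 powr - real (lv R)) powr real CARD('n) \<le> measure lebesgue (cell R)"
    and measure_cell_le: "R \<in> W \<Longrightarrow> measure lebesgue (cell R) \<le> cM * (2 powr - real (lv R)) powr real CARD('n)"
    and U_cube: "R \<in> W \<Longrightarrow> open_cube (U R)" and closure_U: "R \<in> W \<Longrightarrow> closure (U R) \<subseteq> \<Omega>"
    and d_ge: "R \<in> W \<Longrightarrow> x \<in> U R \<Longrightarrow> c1 * 2 powr - real (lv R) \<le> d x"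
    and d_le: "R \<in> W \<Longrightarrow> x \<in> U R \<Longrightarrow> d x \<le> c2 * 2 powr - real (lv R)"
    and root: "root \<in> W" "par root = root" and par_W: "R \<in> W \<Longrightarrow> par R \<in> W"
    and ht_par: "R \<in> W \<Longrightarrow> R \<noteq> root \<Longrightarrow> ht (par R) < ht R"
    and lv_par: "R \<in> W \<Longrightarrow> lv (par R) \<le> lv R"
    and ancestors: "R \<in> W \<Longrightarrow> finite {Q \<in> W. (\<exists>k. (par ^^ k) R = Q) \<and> lv Q = m}"
      "R \<in> W \<Longrightarrow> card {Q \<in> W. (\<exists>k. (par ^^ k) R = Q) \<and> lv Q = m} \<le> c3 * 2 powr (real m * (1 - \<alpha>))"
    and descendants: "Q \<in> W \<Longrightarrow> finite {R \<in> W. (\<exists>k. (par ^^ k) R = Q) \<and> lv R = m}"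
      "Q \<in> W \<Longrightarrow> card {R \<in> W. (\<exists>k. (par ^^ k) R = Q) \<and> lv R = m}
         \<le> c3 * 2 powr ((real m - real (lv Q)) * (real CARD('n) - 1) + real m * (1 - \<alpha>))"
begin

section \<open>Ancestors, children and columns of the tree\<close>

definition sz :: "'i \<Rightarrow> real" where "sz R = 2 powr - real (lv R)"

definition desc :: "'i \<Rightarrow> 'i \<Rightarrow> bool" where "desc Q R \<longleftrightarrow> (\<exists>k. (par ^^ k) R = Q)"

text \<open>The shadow of \<open>Q\<close>: the region whose mass passes through \<open>Q\<close> on
  its way to the root.\<close>

definition col :: "'i \<Rightarrow> (real^'n) set" where "col Q = (\<Union>R\<in>{R\<in>W. desc Q R}. cell R)"

definition children :: "'i \<Rightarrow> 'i set" where "children Q = {R\<in>W. par R = Q \<and> R \<noteq> root}"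

lemma sz_pos [simp]: "0 < sz R" by (simp add: sz_def)

lemma sz_neq [simp]: "sz R \<noteq> 0" using sz_pos[of R] by linarith

lemma cell_\<Omega>: "R \<in> W \<Longrightarrow> cell R \<subseteq> \<Omega>"
  using cell_sets by (simp add: sets_\<mu>)

lemma cell_d: "R \<in> W \<Longrightarrow> x \<in> cell R \<Longrightarrow> c1 * sz R \<le> d x \<and> d x \<le> c2 * sz R"
  using cell_U d_ge d_le unfolding sz_def by blast

lemma measure_cell_pos: "R \<in> W \<Longrightarrow> 0 < measure lebesgue (cell R)"
  by (rule less_le_trans[OF _ measure_cell_ge]) (use c_pos in simp_all)

lemma desc_refl [simp]: "desc Q Q"
  unfolding desc_def by (rule exI[of _ 0]) simp

lemma desc_trans: "desc P Q \<Longrightarrow> desc Q R \<Longrightarrow> desc P R"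
  unfolding desc_def by (metis comp_apply funpow_add)

lemma desc_par: "desc (par R) R"
  unfolding desc_def by (rule exI[of _ 1]) simp

lemma funpow_par: "R \<in> W \<Longrightarrow> (par ^^ k) R \<in> W \<and> lv ((par ^^ k) R) \<le> lv R \<and> ht ((par ^^ k) R) \<le> ht R"
proof (induction k)
  case (Suc k)
  let ?S = "(par ^^ k) R"
  have "ht (par ?S) \<le> ht ?S" using ht_par[of ?S] root Suc by (cases "?S = root") auto
  then show ?case using Suc par_W[of ?S] lv_par[of ?S] by auto
qed simp

lemma desc_W: "R \<in> W \<Longrightarrow> desc Q R \<Longrightarrow> Q \<in> W \<and> lv Q \<le> lv R \<and> ht Q \<le> ht R"
  unfolding desc_def using funpow_par by blast

lemma desc_root: "R \<in> W \<Longrightarrow> desc root R"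
proof (induction "ht R" arbitrary: R rule: less_induct)
  case less
  then show ?case
    using ht_par[of R] par_W[of R] desc_par[of R] desc_trans[of root "par R" R] by (cases "R = root") auto
qed

lemma desc_cases:
  assumes "R \<in> W" "desc Q R"
  shows "R = Q \<or> (\<exists>C\<in>children Q. desc C R)"
proof -
  have "(par ^^ k) R = Q \<longrightarrow> R = Q \<or> (\<exists>C\<in>children Q. desc C R)" for k
  proof (induction k)
    case (Suc k)
    show ?case
    proof
      assume *: "(par ^^ Suc k) R = Q"
      show "R = Q \<or> (\<exists>C\<in>children Q. desc C R)"
      proof (cases "(par ^^ k) R = root")
        case True
        then show ?thesis using Suc root * by simp
      next
        case False
        then have "(par ^^ k) R \<in> children Q" using * funpow_par[OF assms(1)] by (simp add: children_def)
        then show ?thesis unfolding desc_def by blast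
      qed
    qed
  qed simp
  then show ?thesis using assms(2) unfolding desc_def by blast
qed

lemma children_desc: "C \<in> children Q \<Longrightarrow> desc C R \<Longrightarrow> desc Q R"
  using desc_par[of C] desc_trans by (auto simp: children_def)

lemma children_not_desc: assumes "C \<in> children Q" shows "\<not> desc C Q" "C \<noteq> Q"
proof -
  have "ht Q < ht C" using assms ht_par by (auto simp: children_def)
  moreover have "Q \<in> W" using assms par_W by (auto simp: children_def)
  ultimately show "\<not> desc C Q" using desc_W leD by blast
  then show "C \<noteq> Q" by auto
qed

text \<open>Both children lie on the chain of iterated parents of \<open>R\<close>. If
  \<open>C\<close> comes strictly before \<open>D\<close> on it, then \<open>D\<close> is an
  ancestor of \<open>par C = Q\<close>, which \<open>children_not_desc\<close> excludes.\<close>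

lemma children_disjoint:
  assumes "C \<in> children Q" "D \<in> children Q" "desc C R" "desc D R"
  shows "C = D"
proof -
  have *: "j = k" if "(par ^^ j) R = C" "(par ^^ k) R = D" "C \<in> children Q" "D \<in> children Q" and le: "j \<le> k" for j k C D
  proof (rule ccontr)
    assume "j \<noteq> k"
    then obtain i where "k = Suc i + j" using le by (metis add.commute less_iff_Suc_add nat_less_le add_Suc_right)
    then have "(par ^^ i) (par C) = D"
      using that(1,2) by (simp add: funpow_add funpow_swap1)
    then have "desc D Q" using that(3) unfolding desc_def by (auto simp: children_def)
    then show False using children_not_desc[OF that(4)] by blast
  qed
  obtain j k where jk: "(par ^^ j) R = C" "(par ^^ k) R = D" using assms(3,4) unfolding desc_def by blast
  show ?thesis
  proof (cases "j \<le> k")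
    case True
    then show ?thesis using *[OF jk assms(1,2)] jk by simp
  next
    case False
    then show ?thesis using *[OF jk(2,1) assms(2,1)] jk by simp
  qed
qed

text \<open>Everything descends from the root, so the bound on the descendants of the root
  applies.\<close>

lemma finite_level: "finite {R\<in>W. lv R = m}"
proof -
  have "{R\<in>W. lv R = m} = {R \<in> W. (\<exists>k. (par ^^ k) R = root) \<and> lv R = m}"
    using desc_root unfolding desc_def by blast
  then show ?thesis using descendants(1)[OF root(1)] by simp
qed

lemma finite_level_le: "finite {R\<in>W. lv R \<le> M}"
proof -
  have "{R\<in>W. lv R \<le> M} = (\<Union>m\<in>{..M}. {R\<in>W. lv R = m})" by auto
  then show ?thesis using finite_level by simp
qed

lemma finite_large: assumes "0 < e" shows "finite {R\<in>W. e \<le> sz R}"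
proof -
  obtain N where N: "1 / e < 2 ^ N" using real_arch_pow[of 2 "1 / e"] by auto
  have "lv R \<le> N" if "e \<le> sz R" for R
  proof (rule ccontr)
    assume "\<not> lv R \<le> N"
    then have "(2::real) ^ N \<le> 2 ^ lv R" by (intro power_increasing) auto
    then have "1 / e < 2 ^ lv R" using N by linarith
    moreover have "sz R = 1 / 2 ^ lv R" by (simp add: sz_def powr_minus powr_realpow divide_inverse)
    ultimately have "sz R * 2 ^ lv R < e * 2 ^ lv R" using assms by (simp add: field_simps)
    then have "sz R < e" by (simp add: mult_less_cancel_right)
    then show False using that by simp
  qed
  then show ?thesis by (intro finite_subset[OF _ finite_level_le[of N]]) auto
qed

lemma cell_nonempty: "R \<in> W \<Longrightarrow> cell R \<noteq> {}"
  using measure_cell_pos by fastforce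

text \<open>A point of \<open>cell (par R)\<close> also lies in \<open>U R\<close>, so its distance
  \<open>d\<close> is comparable to both sides.\<close>

lemma sz_par_le: assumes "R \<in> W" shows "sz (par R) \<le> c2 / c1 * sz R"
proof -
  obtain x where x: "x \<in> cell (par R)" using cell_nonempty par_W assms by blast
  have "c1 * sz (par R) \<le> d x" using cell_d[OF par_W[OF assms] x] by simp
  also have "\<dots> \<le> c2 * sz R" using d_le[OF assms] cell_par_U[OF assms] x by (auto simp: sz_def)
  finally show ?thesis using c_pos by (simp add: field_simps)
qed

lemma sz_par_ge: "R \<in> W \<Longrightarrow> sz R \<le> sz (par R)"
  using lv_par by (simp add: sz_def)

text \<open>By \<open>sz_par_le\<close> a child is at most a constant factor smaller than
  \<open>Q\<close>, and only finitely many cubes are that large.\<close>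

lemma finite_children: "finite (children Q)"
proof (rule finite_subset)
  show "children Q \<subseteq> {R\<in>W. c1 / c2 * sz Q \<le> sz R}"
    using sz_par_le c_pos by (auto simp: children_def field_simps)
  show "finite {R\<in>W. c1 / c2 * sz Q \<le> sz R}" using c_pos by (intro finite_large) simp
qed

lemma countable_W: "countable W"
proof -
  have "countable (\<Union>m. {R\<in>W. lv R = m})"
    by (rule countable_UN) (auto intro: countable_finite finite_level)
  moreover have "W = (\<Union>m. {R\<in>W. lv R = m})" by auto
  ultimately show ?thesis by simp
qed

lemma col_sets: "col Q \<in> sets \<mu>"
  unfolding col_def
  by (rule sets.countable_UN'[OF countable_subset[OF _ countable_W]]) (use cell_sets in auto)

lemma in_col: "S \<in> W \<Longrightarrow> x \<in> cell S \<Longrightarrow> x \<in> col Q \<longleftrightarrow> desc Q S"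
  unfolding col_def using cell_disjoint by blast

lemma col_cell: "x \<in> col Q \<Longrightarrow> \<exists>S\<in>W. x \<in> cell S"
  unfolding col_def by blast

lemma cell_col: "R \<in> W \<Longrightarrow> cell R \<subseteq> col R"
  unfolding col_def by auto

text \<open>\<open>desc_cases\<close> and \<open>children_disjoint\<close> in terms of indicators;
  integrated against \<open>f\<close> this becomes the balance law \<open>flow_conservation\<close>
  at the vertex \<open>Q\<close>.\<close>

lemma indicator_col:
  assumes "Q \<in> W"
  shows "indicator (col Q) x = (indicator (cell Q) x + (\<Sum>C\<in>children Q. indicator (col C) x) :: real)"
proof (cases "\<exists>S\<in>W. x \<in> cell S")
  case False
  then have "x \<notin> col C" "x \<notin> cell Q" for C using assms col_cell by blast+
  then show ?thesis by simp
next
  case True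
  then obtain S where S: "S \<in> W" "x \<in> cell S" by blast
  have cellQ: "x \<in> cell Q \<longleftrightarrow> S = Q" using S assms cell_disjoint by blast
  have sum: "(\<Sum>C\<in>children Q. indicator (col C) x) = (\<Sum>C\<in>children Q. if desc C S then 1 else 0 :: real)"
    by (intro sum.cong) (auto simp: in_col[OF S] indicator_def)
  consider "S = Q" | C where "S \<noteq> Q" "C \<in> children Q" "desc C S" | "S \<noteq> Q" "\<not> desc Q S"
    using desc_cases[OF S(1), of Q] by blast
  then show ?thesis
  proof cases
    case 1
    then have "(\<Sum>C\<in>children Q. if desc C S then 1 else 0 :: real) = 0"
      using children_not_desc by (intro sum.neutral) auto
    with sum have z: "(\<Sum>C\<in>children Q. indicator (col C) x) = (0 :: real)" by (rule trans)
    have "x \<in> col Q" "x \<in> cell Q" using 1 S in_col[OF S] by auto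
    then have "indicator (col Q) x = (1::real)" "indicator (cell Q) x = (1::real)" by auto
    then show ?thesis by (simp only: z add_0_right)
  next
    case 2
    have "desc D S \<longleftrightarrow> D = C" if "D \<in> children Q" for D
      using children_disjoint[OF that 2(2) _ 2(3)] 2(3) by blast
    then have "(\<Sum>D\<in>children Q. if desc D S then 1 else 0 :: real) = (\<Sum>D\<in>children Q. if D = C then 1 else 0)"
      by (intro sum.cong) simp_all
    also have "\<dots> = 1" using 2(2) finite_children[of Q] by (simp add: sum.delta)
    finally have z: "(\<Sum>C\<in>children Q. indicator (col C) x) = (1 :: real)" using sum by (rule trans[rotated])
    have "x \<in> col Q" "x \<notin> cell Q" using 2(1) cellQ in_col[OF S] children_desc[OF 2(2,3)] by auto
    then have "indicator (col Q) x = (1::real)" "indicator (cell Q) x = (0::real)" by auto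
    then show ?thesis by (simp only: z add_0_left)
  next
    case 3
    then have "(\<Sum>C\<in>children Q. if desc C S then 1 else 0 :: real) = 0"
      using children_desc by (intro sum.neutral) auto
    with sum have z: "(\<Sum>C\<in>children Q. indicator (col C) x) = (0 :: real)" by (rule trans)
    have "x \<notin> col Q" "x \<notin> cell Q" using 3 cellQ in_col[OF S] by auto
    then have "indicator (col Q) x = (0::real)" "indicator (cell Q) x = (0::real)" by auto
    then show ?thesis by (simp only: z add_0_left)
  qed
qed

lemma flow_conservation:
  fixes f :: "real^'n \<Rightarrow> real"
  assumes "Q \<in> W" "integrable \<mu> f"
  shows "(\<integral>x. f x * indicator (col Q) x \<partial>\<mu>)
       = (\<integral>x. f x * indicator (cell Q) x \<partial>\<mu>) + (\<Sum>C\<in>children Q. \<integral>x. f x * indicator (col C) x \<partial>\<mu>)"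
proof -
  have int: "integrable \<mu> (\<lambda>x. f x * indicator A x)" if "A \<in> sets \<mu>" for A
    using that assms(2) by (rule integrable_real_mult_indicator)
  have "(\<integral>x. f x * indicator (col Q) x \<partial>\<mu>)
     = (\<integral>x. f x * indicator (cell Q) x + (\<Sum>C\<in>children Q. f x * indicator (col C) x) \<partial>\<mu>)"
    by (simp add: indicator_col[OF assms(1)] distrib_left sum_distrib_left)
  also have "\<dots> = (\<integral>x. f x * indicator (cell Q) x \<partial>\<mu>) + (\<Sum>C\<in>children Q. \<integral>x. f x * indicator (col C) x \<partial>\<mu>)"
    using int cell_sets[OF assms(1)] col_sets by (subst Bochner_Integration.integral_add) auto
  finally show ?thesis .
qed

text \<open>Since the root is its own parent, the last term vanishes for it.\<close>

definition flow_part :: "(real^'n \<Rightarrow> real) \<Rightarrow> 'i \<Rightarrow> real^'n \<Rightarrow> real" where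
  "flow_part f R x = - (\<integral>x. f x * indicator (cell R) x \<partial>\<mu>) * bump (cell R) x
     + (\<integral>x. f x * indicator (col R) x \<partial>\<mu>) * (bump (cell R) x - bump (cell (par R)) x)"

definition piece :: "(real^'n \<Rightarrow> real) \<Rightarrow> 'i \<Rightarrow> real^'n \<Rightarrow> real" where
  "piece f R x = f x * indicator (cell R) x + flow_part f R x"

text \<open>At a point of \<open>cell S\<close> only the pieces of \<open>S\<close> and of its
  children are nonzero, so the sum is finite. What \<open>S\<close> sends down cancels what it
  collects from its own cell and from its children, by \<open>flow_conservation\<close>; at the root
  nothing is sent down and the total integral stays.\<close>

lemma piece_sum:
  assumes f: "integrable \<mu> f" "\<And>x. x \<in> \<Omega> - col root \<Longrightarrow> f x = 0" and x: "x \<in> \<Omega>"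
  shows "((\<lambda>R. piece f R x) has_sum (f x - integral\<^sup>L \<mu> f * bump (cell root) x)) W"
proof (cases "\<exists>S\<in>W. x \<in> cell S")
  case False
  then have no: "x \<notin> cell R" if "R \<in> W" for R using that by blast
  have "f x = 0" using f(2) x False col_cell by blast
  moreover have "piece f R x = 0" if "R \<in> W" for R
    using that no[OF that] no[OF par_W[OF that]] by (simp add: piece_def flow_part_def bump_outside)
  ultimately show ?thesis using no[OF root(1)] by (simp add: bump_outside has_sum_0)
next
  case True
  then obtain S where S: "S \<in> W" "x \<in> cell S" by blast
  define b where "b = 1 / measure lebesgue (cell S)"
  have bump: "bump (cell R) x = (if R = S then b else 0)" if "R \<in> W" for R
    using S cell_disjoint[OF that S(1)] by (auto simp: bump_def b_def indicator_def)
  have ind: "indicator (cell R) x = (if R = S then 1 else 0 :: real)" if "R \<in> W" for R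
    using that S cell_disjoint[OF that S(1)] by (auto simp: indicator_def)
  define A where "A Q = (\<integral>x. f x * indicator (col Q) x \<partial>\<mu>)" for Q
  define a where "a Q = (\<integral>x. f x * indicator (cell Q) x \<partial>\<mu>)" for Q
  have flow: "A S = a S + (\<Sum>C\<in>children S. A C)"
    unfolding A_def a_def by (rule flow_conservation[OF S(1) f(1)])
  have Aroot: "A root = integral\<^sup>L \<mu> f"
    unfolding A_def by (rule Bochner_Integration.integral_cong) (use f(2) in \<open>auto simp: space_\<mu> indicator_def\<close>)
  have piece: "piece f R x = f x * (if R = S then 1 else 0) - a R * (if R = S then b else 0)
      + A R * ((if R = S then b else 0) - (if par R = S then b else 0))" if "R \<in> W" for R
    using bump[OF that] bump[OF par_W[OF that]] ind[OF that] by (simp add: piece_def flow_part_def A_def a_def)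
  \<comment> \<open>Only at the root do the two bumps in its own piece cancel each other; this
    leaves the term \<open>A root * b\<close>, the multiple of the root bump.\<close>
  have par_self: "par S = S \<longleftrightarrow> S = root" using ht_par[OF S(1)] root by (cases "S = root") auto
  have ch: "R \<in> W \<and> par R = S \<and> R \<noteq> S" if "R \<in> children S" for R
    using that children_not_desc(2)[OF that] by (auto simp: children_def)
  have "sum (\<lambda>R. piece f R x) (insert S (children S))
      = piece f S x + (\<Sum>R\<in>children S. piece f R x)"
    using ch finite_children by (subst sum.insert) auto
  also have "(\<Sum>R\<in>children S. piece f R x) = (\<Sum>R\<in>children S. - b * A R)"
    by (intro sum.cong) (use ch piece in auto)
  also have "\<dots> = - b * (A S - a S)" by (simp add: flow sum_distrib_left)
  also have "piece f S x + \<dots> = f x - (if S = root then A S * b else 0)"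
    by (simp add: piece[OF S(1)] par_self algebra_simps)
  also have "\<dots> = f x - integral\<^sup>L \<mu> f * bump (cell root) x"
    using bump[OF root(1)] Aroot by auto
  finally have sum: "sum (\<lambda>R. piece f R x) (insert S (children S)) = f x - integral\<^sup>L \<mu> f * bump (cell root) x" .
  show ?thesis
  proof (rule has_sum_finite_neutralI[OF _ _ _ sum[symmetric]])
    show "finite (insert S (children S))" using finite_children by simp
    show "insert S (children S) \<subseteq> W" using S by (auto simp: children_def)
    fix R assume R: "R \<in> W - insert S (children S)"
    then have "R \<noteq> S" "par R \<noteq> S" using root S(1) by (auto simp: children_def)
    then show "piece f R x = 0" using R piece[of R] by simp
  qed
qed

lemma piece_props:
  assumes f: "integrable \<mu> f" and R: "R \<in> W"
  shows "integrable \<mu> (piece f R)" "integral\<^sup>L \<mu> (piece f R) = 0" "\<And>x. x \<notin> U R \<Longrightarrow> piece f R x = 0"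
proof -
  have P: "par R \<in> W" using par_W[OF R] .
  note b = bump_integral[OF cell_sets[OF R] measure_cell_pos[OF R]]
    bump_integral[OF cell_sets[OF P] measure_cell_pos[OF P]]
  have int: "integrable \<mu> (\<lambda>x. f x * indicator (cell R) x)"
    using cell_sets[OF R] f by (rule integrable_real_mult_indicator)
  show "integrable \<mu> (piece f R)" unfolding piece_def[abs_def] flow_part_def using b int by auto
  show "integral\<^sup>L \<mu> (piece f R) = 0" unfolding piece_def[abs_def] flow_part_def using b int by auto
  show "piece f R x = 0" if "x \<notin> U R" for x
    using that cell_U[OF R] cell_par_U[OF R] by (auto simp: piece_def flow_part_def bump_def indicator_def)
qed

section \<open>The weighted Hardy inequality on the tree\<close>

definition nn :: real where "nn = real CARD('n)"

text \<open>
  The exponent \<open>\<kappa>\<close> spends half of the slack in \<open>\<beta> p > - \<alpha>\<close>: Hoelder's inequality is applied with the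
  extra weight \<open>d powr \<kappa>\<close>, and both the sum over descendants and the sum over ancestors then
  become geometric.
\<close>

definition \<kappa> :: real where "\<kappa> = (\<alpha> + min \<beta> 0 * p) / (2 * p)"

lemma \<kappa>_pos: "0 < \<kappa>"
  unfolding \<kappa>_def using \<alpha>_pos \<beta>_gt p_gt1 by (auto simp: min_def)

text \<open>After \<kappa> is spent, the weight exponent together with the \<alpha> coming from the
  measure of a level leaves exactly \<open>\<kappa> * p\<close>, the decay rate in
  \<open>column_weight\<close>.\<close>

lemma \<kappa>_eq: "\<alpha> + (min \<beta> 0 - \<kappa>) * p = \<kappa> * p"
  unfolding \<kappa>_def using p_gt1 by (simp add: field_simps)

lemma emeasure_cell: "R \<in> W \<Longrightarrow> emeasure \<mu> (cell R) \<le> ennreal (cM * sz R powr nn)"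
  using finite_measure.emeasure_eq_measure[OF finite_\<mu>] measure_\<mu>[OF cell_sets] measure_cell_le
  by (simp add: nn_def sz_def ennreal_leI)

lemma suminf_geometric_ennreal:
  assumes "0 \<le> C" "0 < r" "r < 1"
  shows "(\<Sum>i. ennreal (C * r ^ i)) = ennreal (C / (1 - r))"
proof -
  have "(\<lambda>i. C * r ^ i) sums (C * (1 / (1 - r)))"
    using assms by (intro sums_mult geometric_sums) auto
  then show ?thesis
    using assms by (subst suminf_ennreal2) (auto simp: sums_iff)
qed

text \<open>The comparability constant of the weight, the constants for number and volume of the
  cells, and the sum of the geometric series over the levels.\<close>

definition c4 :: real where
  "c4 = (c1 powr ((\<beta> - \<kappa>) * p) + c2 powr ((\<beta> - \<kappa>) * p)) * (c3 * cM) / (1 - 2 powr (- \<kappa> * p))"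

lemma geometric_ratio: "0 < 2 powr (- \<kappa> * p)" "2 powr (- \<kappa> * p) < 1"
  using \<kappa>_pos p_gt1 by (auto simp: powr_less_one)

lemma c4_pos: "0 < c4"
proof -
  have "0 < c1 powr ((\<beta> - \<kappa>) * p)" using c_pos by simp
  then have 1: "0 < c1 powr ((\<beta> - \<kappa>) * p) + c2 powr ((\<beta> - \<kappa>) * p)" by (rule add_pos_nonneg) simp
  have 2: "0 < c3 * cM" using c_pos by simp
  have 3: "0 < 1 - 2 powr (- \<kappa> * p)" using geometric_ratio by simp
  show ?thesis unfolding c4_def by (rule divide_pos_pos[OF mult_pos_pos[OF 1 2] 3])
qed

text \<open>The column is sliced by level. With \<open>m = lv R + i\<close>, slice \<open>i\<close>
  has at most \<open>c3 * 2 powr (i * (nn - 1) + m * (1 - \<alpha>))\<close> cells of volume at most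
  \<open>cM * 2 powr (- m * nn)\<close>; times the weight this is geometric in \<open>i\<close> with
  ratio \<open>2 powr (- \<kappa> * p)\<close>.\<close>

lemma column_weight:
  assumes R: "R \<in> W"
  shows "(\<integral>\<^sup>+x. ennreal (d x powr ((\<beta> - \<kappa>) * p)) * indicator (col R) x \<partial>\<mu>)
     \<le> ennreal (c4 * sz R powr (\<beta> * p + \<alpha> + nn - 1 - \<kappa> * p))"
proof -
  define b where "b = min \<beta> 0"
  define c where "c = c1 powr ((\<beta> - \<kappa>) * p) + c2 powr ((\<beta> - \<kappa>) * p)"
  define L where "L i = (\<Union>S\<in>{S\<in>W. desc R S \<and> lv S = lv R + i}. cell S)" for i
  \<comment> \<open>A bound for the weight on the slice \<open>L i\<close>: the factor with the
    nonnegative exponent \<open>(\<beta> - b) * p\<close> is largest at the top and is evaluated at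
    \<open>R\<close>, the other one at the level of the slice.\<close>
  define w where "w i = c * sz R powr ((\<beta> - b) * p) * 2 powr (- real (lv R + i) * ((b - \<kappa>) * p))" for i
  define r where "r = 2 powr (- \<kappa> * p)"
  define e where "e = \<beta> * p + \<alpha> + nn - 1 - \<kappa> * p"
  have "0 < c1 powr ((\<beta> - \<kappa>) * p)" using c_pos by simp
  then have c: "0 < c" unfolding c_def by (rule add_pos_nonneg) simp
  have w: "0 \<le> w i" for i using c by (simp add: w_def)
  have fin: "finite {S\<in>W. desc R S \<and> lv S = m}" for m
    using finite_level[of m] by (rule rev_finite_subset) auto
  have L: "L i \<in> sets \<mu>" for i
    unfolding L_def using fin cell_sets by (intro sets.finite_UN) auto
  have meas: "ennreal (w i) * emeasure \<mu> (L i) \<le> ennreal (c * (c3 * cM) * sz R powr e * r ^ i)" for i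
  proof -
    define m where "m = lv R + i"
    have "emeasure \<mu> (L i) \<le> (\<Sum>S\<in>{S\<in>W. desc R S \<and> lv S = m}. emeasure \<mu> (cell S))"
      unfolding L_def m_def using fin cell_sets by (intro emeasure_subadditive_finite) auto
    also have "\<dots> \<le> (\<Sum>S\<in>{S\<in>W. desc R S \<and> lv S = m}. ennreal (cM * 2 powr (- real m * nn)))"
    proof (rule sum_mono)
      fix S assume "S \<in> {S\<in>W. desc R S \<and> lv S = m}"
      then show "emeasure \<mu> (cell S) \<le> ennreal (cM * 2 powr (- real m * nn))"
        using emeasure_cell[of S] by (auto simp: sz_def powr_powr)
    qed
    also have "\<dots> = ennreal (card {S\<in>W. desc R S \<and> lv S = m} * (cM * 2 powr (- real m * nn)))"
      using c_pos by (simp add: ennreal_mult ennreal_of_nat_eq_real_of_nat)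
    also have "\<dots> \<le> ennreal (c3 * 2 powr (real i * (nn - 1) + real m * (1 - \<alpha>)) * (cM * 2 powr (- real m * nn)))"
      using descendants(2)[OF R, of m] c_pos
      by (intro ennreal_leI mult_right_mono) (auto simp: desc_def nn_def m_def)
    finally have "ennreal (w i) * emeasure \<mu> (L i)
       \<le> ennreal (w i) * ennreal (c3 * 2 powr (real i * (nn - 1) + real m * (1 - \<alpha>)) * (cM * 2 powr (- real m * nn)))"
      by (rule mult_left_mono) simp
    also have "\<dots> = ennreal (w i * (c3 * 2 powr (real i * (nn - 1) + real m * (1 - \<alpha>)) * (cM * 2 powr (- real m * nn))))"
      using w c_pos by (simp add: ennreal_mult)
    also have "w i * (c3 * 2 powr (real i * (nn - 1) + real m * (1 - \<alpha>)) * (cM * 2 powr (- real m * nn)))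
       = c * (c3 * cM) * 2 powr (- real (lv R) * ((\<beta> - b) * p) + (- real m * ((b - \<kappa>) * p))
           + (real i * (nn - 1) + real m * (1 - \<alpha>)) + (- real m * nn))"
      unfolding w_def sz_def m_def powr_powr by (simp only: powr_add mult_ac)
    also have "- real (lv R) * ((\<beta> - b) * p) + (- real m * ((b - \<kappa>) * p))
           + (real i * (nn - 1) + real m * (1 - \<alpha>)) + (- real m * nn) = - real (lv R) * e + (- \<kappa> * p) * real i"
    proof -
      have k: "(b - \<kappa>) * p = \<kappa> * p - \<alpha>" using \<kappa>_eq by (simp add: b_def)
      have bp: "(\<beta> - b) * p = \<beta> * p + \<alpha> - 2 * (\<kappa> * p)" using k by (simp add: algebra_simps)
      show ?thesis unfolding k bp e_def m_def by (simp add: algebra_simps)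
    qed
    also have "2 powr (- real (lv R) * e + (- \<kappa> * p) * real i) = sz R powr e * r ^ i"
    proof -
      have "r ^ i = 2 powr ((- \<kappa> * p) * real i)" unfolding r_def by (simp add: powr_power mult_ac)
      then show ?thesis unfolding sz_def powr_powr by (simp only: powr_add)
    qed
    finally show ?thesis by (simp add: mult.assoc)
  qed
  have "(\<integral>\<^sup>+x. ennreal (d x powr ((\<beta> - \<kappa>) * p)) * indicator (col R) x \<partial>\<mu>)
     \<le> (\<integral>\<^sup>+x. (\<Sum>i. ennreal (w i) * indicator (L i) x) \<partial>\<mu>)"
  proof (rule nn_integral_mono)
    fix x assume "x \<in> space \<mu>"
    show "ennreal (d x powr ((\<beta> - \<kappa>) * p)) * indicator (col R) x \<le> (\<Sum>i. ennreal (w i) * indicator (L i) x)"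
    proof (cases "x \<in> col R")
      case True
      then obtain S where S: "S \<in> W" "desc R S" "x \<in> cell S" unfolding col_def by blast
      define i where "i = lv S - lv R"
      have i: "lv S = lv R + i" using desc_W[OF S(1,2)] by (simp add: i_def)
      have xL: "x \<in> L i" using S i unfolding L_def by blast
      have szle: "sz S \<le> sz R" using i by (simp add: sz_def)
      have b: "0 \<le> (\<beta> - b) * p" using p_gt1 by (simp add: b_def)
      have "d x powr ((\<beta> - \<kappa>) * p) \<le> c * sz S powr ((\<beta> - \<kappa>) * p)"
        unfolding c_def by (rule powr_between_le) (use cell_d[OF S(1,3)] c_pos in auto)
      also have "c * sz S powr ((\<beta> - \<kappa>) * p)
          = c * (sz S powr ((\<beta> - b) * p) * sz S powr ((b - \<kappa>) * p))"
        by (simp add: algebra_simps flip: powr_add)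
      also have "\<dots> \<le> c * (sz R powr ((\<beta> - b) * p) * sz S powr ((b - \<kappa>) * p))"
        using c szle b by (intro mult_left_mono mult_right_mono powr_mono2) (simp_all add: less_imp_le)
      also have "\<dots> = w i" by (simp add: w_def sz_def powr_powr i)
      finally have "ennreal (d x powr ((\<beta> - \<kappa>) * p)) * indicator (col R) x \<le> (\<Sum>i\<in>{i}. ennreal (w i) * indicator (L i) x)"
        using True xL by (simp add: ennreal_leI)
      also have "\<dots> \<le> (\<Sum>i. ennreal (w i) * indicator (L i) x)"
        by (intro sum_le_suminf) auto
      finally show ?thesis .
    qed simp
  qed
  also have "\<dots> = (\<Sum>i. \<integral>\<^sup>+x. ennreal (w i) * indicator (L i) x \<partial>\<mu>)"
  proof (rule nn_integral_suminf)
    fix i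
    have [measurable]: "L i \<in> sets \<mu>" by (rule L)
    show "(\<lambda>x. ennreal (w i) * indicator (L i) x) \<in> borel_measurable \<mu>" by measurable
  qed
  also have "\<dots> = (\<Sum>i. ennreal (w i) * emeasure \<mu> (L i))"
    using L by (simp add: nn_integral_cmult_indicator)
  also have "\<dots> \<le> (\<Sum>i. ennreal (c * (c3 * cM) * sz R powr e * r ^ i))"
    by (intro suminf_le meas) auto
  also have "\<dots> = ennreal (c * (c3 * cM) * sz R powr e / (1 - r))"
    using c c_pos geometric_ratio by (intro suminf_geometric_ennreal) (auto simp: r_def)
  also have "c * (c3 * cM) * sz R powr e / (1 - r) = c4 * sz R powr e"
    by (simp add: c4_def c_def r_def)
  finally show ?thesis by (simp add: e_def)
qed

definition c5 :: real where "c5 = c3 * (2 powr (\<kappa> * q) / (2 powr (\<kappa> * q) - 1))"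

lemma c5_pos: "0 < c5"
  unfolding c5_def using c_pos \<kappa>_pos q_gt1 by (intro mult_pos_pos divide_pos_pos) auto

text \<open>The number of ancestors of level \<open>m\<close> cancels
  \<open>sz R powr (1 - \<alpha>)\<close>. What remains grows like
  \<open>(2 powr (\<kappa> * q)) ^ m\<close>, and such a sum is dominated by its last term, at the
  level of \<open>S\<close>.\<close>

lemma ancestor_sum:
  assumes S: "S \<in> W" and F: "finite F" "F \<subseteq> W"
  shows "(\<Sum>R\<in>{R\<in>F. desc R S}. sz R powr (1 - \<alpha> - \<kappa> * q)) \<le> c5 * sz S powr (- \<kappa> * q)"
proof -
  define A where "A = {R\<in>W. desc R S}"
  define r where "r = 2 powr (\<kappa> * q)"
  have r: "1 < r" using \<kappa>_pos q_gt1 by (simp add: r_def)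
  have lvA: "lv ` A \<subseteq> {..lv S}" using desc_W[OF S] by (auto simp: A_def)
  have finA: "finite A"
    by (rule finite_subset[OF _ finite_level_le[of "lv S"]]) (use lvA in \<open>auto simp: A_def\<close>)
  have "(\<Sum>R\<in>{R\<in>F. desc R S}. sz R powr (1 - \<alpha> - \<kappa> * q)) \<le> (\<Sum>R\<in>A. sz R powr (1 - \<alpha> - \<kappa> * q))"
    using F finA by (intro sum_mono2) (auto simp: A_def)
  also have "\<dots> = (\<Sum>m\<le>lv S. \<Sum>R\<in>{R\<in>A. lv R = m}. sz R powr (1 - \<alpha> - \<kappa> * q))"
    by (rule sum.group[symmetric]) (use finA lvA in auto)
  also have "\<dots> = (\<Sum>m\<le>lv S. card {R\<in>A. lv R = m} * 2 powr (- real m * (1 - \<alpha> - \<kappa> * q)))"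
    by (intro sum.cong) (auto simp: sz_def powr_powr)
  also have "\<dots> \<le> (\<Sum>m\<le>lv S. c3 * 2 powr (real m * (1 - \<alpha>)) * 2 powr (- real m * (1 - \<alpha> - \<kappa> * q)))"
  proof (intro sum_mono mult_right_mono)
    fix m
    have "{R\<in>A. lv R = m} = {Q \<in> W. (\<exists>k. (par ^^ k) S = Q) \<and> lv Q = m}" by (auto simp: A_def desc_def)
    then show "real (card {R\<in>A. lv R = m}) \<le> c3 * 2 powr (real m * (1 - \<alpha>))"
      using ancestors(2)[OF S] by simp
  qed auto
  also have "\<dots> = (\<Sum>m\<le>lv S. c3 * r ^ m)"
  proof (intro sum.cong refl)
    fix m
    have "2 powr (real m * (1 - \<alpha>)) * 2 powr (- real m * (1 - \<alpha> - \<kappa> * q)) = 2 powr (\<kappa> * q * real m)"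
      by (simp add: algebra_simps flip: powr_add)
    then show "c3 * 2 powr (real m * (1 - \<alpha>)) * 2 powr (- real m * (1 - \<alpha> - \<kappa> * q)) = c3 * r ^ m"
      by (simp add: r_def powr_power mult_ac)
  qed
  also have "\<dots> = c3 * (\<Sum>m\<le>lv S. r ^ m)" by (simp add: sum_distrib_left)
  also have "\<dots> \<le> c3 * (r / (r - 1) * r ^ lv S)"
    using c_pos sum_geometric_le[OF r] by (intro mult_left_mono) auto
  also have "r ^ lv S = sz S powr (- \<kappa> * q)"
    by (simp add: r_def sz_def powr_powr powr_power mult_ac)
  finally show ?thesis by (simp add: c5_def r_def)
qed

text \<open>The data density times \<open>d x powr (\<kappa> * q)\<close>. The sum over ancestors
  costs the inverse of this factor and so restores the data density.\<close>

definition flow_weight :: "(real^'n \<Rightarrow> real) \<Rightarrow> real^'n \<Rightarrow> real" where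
  "flow_weight f x = \<bar>f x\<bar> powr q * d x powr (- (\<beta> - \<kappa>) * q)"

lemma flow_weight_nonneg [simp]: "0 \<le> flow_weight f x" by (simp add: flow_weight_def)

lemma flow_weight_eq: "flow_weight f x = \<bar>f x\<bar> powr q * d x powr (- \<beta> * q + \<kappa> * q)"
  by (simp add: flow_weight_def algebra_simps)

lemma flow_weight_measurable [measurable]:
  assumes [measurable]: "f \<in> borel_measurable \<mu>"
  shows "flow_weight f \<in> borel_measurable \<mu>"
  unfolding flow_weight_def[abs_def] by measurable

lemma flow_weight_finite:
  assumes "f \<in> data_space"
  shows "(\<integral>\<^sup>+x. ennreal (flow_weight f x) \<partial>\<mu>) < \<infinity>"
proof -
  obtain D where D: "0 < D" "\<And>x. x \<in> \<Omega> \<Longrightarrow> d x \<le> D" using d_bounded by blast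
  have "(\<integral>\<^sup>+x. ennreal (flow_weight f x) \<partial>\<mu>) \<le> ennreal (D powr (\<kappa> * q)) * data_norm f"
    unfolding data_norm_def
  proof (rule nn_integral_le_cmult)
    have [measurable]: "f \<in> borel_measurable \<mu>" using assms by (rule data_space_measurable)
    show "(\<lambda>x. \<bar>f x\<bar> powr q * d x powr (- \<beta> * q)) \<in> borel_measurable \<mu>" by measurable
    fix x assume "x \<in> space \<mu>"
    then have x: "x \<in> \<Omega>" by (simp add: space_\<mu>)
    have "flow_weight f x \<le> \<bar>f x\<bar> powr q * (D powr (\<kappa> * q) * d x powr (- \<beta> * q))"
      unfolding flow_weight_eq using \<kappa>_pos q_gt1
      by (intro mult_left_mono d_powr_absorb x D) auto
    then show "flow_weight f x \<le> D powr (\<kappa> * q) * (\<bar>f x\<bar> powr q * d x powr (- \<beta> * q))"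
      by (simp only: mult_ac)
  qed auto
  also have "\<dots> < \<infinity>"
    using data_space_finite[OF assms] by (simp add: ennreal_mult_less_top)
  finally show ?thesis .
qed

text \<open>Hoelder's inequality with \<gamma> = \<beta> - \<kappa>, the dual weight being
  controlled by \<open>column_weight\<close>; \<open>(q - 1) * p = q\<close> simplifies the
  exponent.\<close>

lemma column_mass:
  assumes f: "f \<in> data_space" and R: "R \<in> W"
  shows "ennreal ((\<integral>x. \<bar>f x\<bar> * indicator (col R) x \<partial>\<mu>) powr q)
     \<le> ennreal (c4 powr (q - 1) * sz R powr ((\<beta> - \<kappa>) * q + (\<alpha> + nn - 1) * (q - 1)))
        * (\<integral>\<^sup>+x. ennreal (flow_weight f x * indicator (col R) x) \<partial>\<mu>)" (is "_ \<le> _ * ?X")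
proof -
  define B where "B = c4 * sz R powr (\<beta> * p + \<alpha> + nn - 1 - \<kappa> * p)"
  have B: "0 < B" using c4_pos by (simp add: B_def)
  have "?X \<le> (\<integral>\<^sup>+x. ennreal (flow_weight f x) \<partial>\<mu>)"
    by (intro nn_integral_mono ennreal_leI) (auto simp: indicator_def)
  then have X: "?X < \<infinity>" using flow_weight_finite[OF f] by (rule le_less_trans)
  have "ennreal ((\<integral>x. \<bar>f x\<bar> * indicator (col R) x \<partial>\<mu>) powr q) \<le> ennreal (B powr (q - 1)) * ?X"
    by (rule weighted_Hoelder(2)[OF data_space_measurable[OF f] col_sets _ X B, where \<gamma> = "\<beta> - \<kappa>"])
       (use column_weight[OF R] in \<open>simp_all add: flow_weight_def B_def\<close>)
  also have "B powr (q - 1) = c4 powr (q - 1) * sz R powr ((\<beta> * p + \<alpha> + nn - 1 - \<kappa> * p) * (q - 1))"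
    using c4_pos by (simp add: B_def powr_mult powr_powr)
  also have "(\<beta> * p + \<alpha> + nn - 1 - \<kappa> * p) * (q - 1) = (\<beta> - \<kappa>) * ((q - 1) * p) + (\<alpha> + nn - 1) * (q - 1)"
    by (simp add: algebra_simps)
  finally show ?thesis by (simp only: conj_exp'(2))
qed

text \<open>Three factors: the height of \<open>flow_part\<close>, the weight on \<open>U R\<close>,
  and the volume of the cells of \<open>R\<close> and its parent.\<close>

definition c6 :: real where
  "c6 = (4 / c0) powr q * (c1 powr ((- \<beta> - \<alpha> + 1) * q) + c2 powr ((- \<beta> - \<alpha> + 1) * q))
        * (cM + cM * (c2 / c1) powr nn)"

lemma c6_nonneg: "0 \<le> c6"
  unfolding c6_def using c_pos by (intro mult_nonneg_nonneg add_nonneg_nonneg) auto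

text \<open>On the two cells that carry it, \<open>flow_part\<close> is at most a multiple of the
  column mass divided by the volume of a cell, and \<open>d\<close> is comparable to
  \<open>sz R\<close>. This reduces the claim to \<open>column_mass\<close> and a count of
  exponents.\<close>

lemma flow_part_norm:
  assumes f: "f \<in> data_space" "integrable \<mu> f" and R: "R \<in> W"
  shows "piece_norm (flow_part f R)
     \<le> ennreal (c6 * c4 powr (q - 1)) * (ennreal (sz R powr (1 - \<alpha> - \<kappa> * q))
        * (\<integral>\<^sup>+x. ennreal (flow_weight f x * indicator (col R) x) \<partial>\<mu>))"
proof -
  let ?k = "\<integral>x. \<bar>f x\<bar> * indicator (col R) x \<partial>\<mu>"
  let ?X = "\<integral>\<^sup>+x. ennreal (flow_weight f x * indicator (col R) x) \<partial>\<mu>"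
  let ?\<gamma> = "(- \<beta> - \<alpha> + 1) * q"
  define cc where "cc = c1 powr ?\<gamma> + c2 powr ?\<gamma>"
  have cc: "0 \<le> cc" by (simp add: cc_def)
  have P: "par R \<in> W" using par_W[OF R] .
  have int: "integrable \<mu> (\<lambda>x. \<bar>f x\<bar> * indicator (col R) x)"
    using col_sets integrable_abs[OF f(2)] by (rule integrable_real_mult_indicator)
  have le: "\<bar>\<integral>x. f x * indicator A x \<partial>\<mu>\<bar> \<le> ?k" if "A \<in> sets \<mu>" "A \<subseteq> col R" for A
  proof -
    have "integrable \<mu> (\<lambda>x. f x * indicator A x)"
      using that(1) f(2) by (rule integrable_real_mult_indicator)
    then have "norm (\<integral>x. f x * indicator A x \<partial>\<mu>) \<le> ?k"
      using int that(2) by (intro Bochner_Integration.integral_norm_bound_integral)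
        (auto simp: indicator_def)
    then show ?thesis by simp
  qed
  note le1 = le[OF cell_sets[OF R] cell_col[OF R]] and le2 = le[OF col_sets order_refl]
  have k0: "0 \<le> ?k" using le1 by linarith
  define m where "m = 1 / (c0 * sz R powr nn)"
  have m0: "0 \<le> m" using c_pos by (simp add: m_def)
  have bR: "bump (cell R) x \<le> m" for x
  proof -
    have "1 / measure lebesgue (cell R) \<le> m"
      unfolding m_def using measure_cell_ge[OF R] c_pos measure_cell_pos[OF R]
      by (intro divide_left_mono mult_pos_pos) (auto simp: nn_def sz_def)
    then show ?thesis using bump_le[of "cell R" x] by linarith
  qed
  have bP: "bump (cell (par R)) x \<le> m" for x
  proof -
    \<comment> \<open>The parent is at least as large, so its bump obeys the height bound of
      \<open>R\<close>.\<close>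
    have "sz R powr nn \<le> sz (par R) powr nn"
      using sz_par_ge[OF R] by (intro powr_mono2) (simp_all add: nn_def less_imp_le)
    then have "1 / (c0 * sz (par R) powr nn) \<le> m"
      unfolding m_def using c_pos by (intro divide_left_mono mult_left_mono) auto
    moreover have "1 / measure lebesgue (cell (par R)) \<le> 1 / (c0 * sz (par R) powr nn)"
      using measure_cell_ge[OF P] c_pos measure_cell_pos[OF P]
      by (intro divide_left_mono mult_pos_pos) (auto simp: nn_def sz_def)
    ultimately show ?thesis using bump_le[of "cell (par R)" x] by linarith
  qed
  have bound: "\<bar>flow_part f R x\<bar> \<le> ?k * (4 * m)" for x
  proof -
    have 1: "\<bar>- (\<integral>x. f x * indicator (cell R) x \<partial>\<mu>) * bump (cell R) x\<bar> \<le> ?k * m"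
      unfolding abs_mult abs_minus_cancel using le1 bR[of x] bump_nonneg[of "cell R" x] k0
      by (intro mult_mono) auto
    have "\<bar>bump (cell R) x - bump (cell (par R)) x\<bar> \<le> 2 * m"
      using bR[of x] bP[of x] bump_nonneg[of "cell R" x] bump_nonneg[of "cell (par R)" x] by linarith
    then have 2: "\<bar>(\<integral>x. f x * indicator (col R) x \<partial>\<mu>) * (bump (cell R) x - bump (cell (par R)) x)\<bar> \<le> ?k * (2 * m)"
      unfolding abs_mult using le2 k0 by (intro mult_mono) auto
    have "\<bar>flow_part f R x\<bar> \<le> ?k * m + ?k * (2 * m)"
      unfolding flow_part_def using 1 2 by linarith
    also have "\<dots> \<le> ?k * (4 * m)" using k0 m0 mult_nonneg_nonneg[OF k0 m0] by linarith
    finally show ?thesis .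
  qed
  let ?A = "cell R \<union> cell (par R)"
  have "piece_norm (flow_part f R)
     \<le> (\<integral>\<^sup>+x. ennreal ((?k * (4 * m)) powr q * (cc * sz R powr ?\<gamma>)) * indicator ?A x \<partial>\<mu>)"
    unfolding piece_norm_def
  proof (rule nn_integral_mono)
    fix x
    show "ennreal (\<bar>flow_part f R x\<bar> powr q * d x powr ?\<gamma>)
       \<le> ennreal ((?k * (4 * m)) powr q * (cc * sz R powr ?\<gamma>)) * indicator ?A x"
    proof (cases "x \<in> ?A")
      case False
      then show ?thesis by (simp add: flow_part_def bump_outside)
    next
      case True
      then have x: "x \<in> U R" using cell_U[OF R] cell_par_U[OF R] by auto
      have "d x powr ?\<gamma> \<le> cc * sz R powr ?\<gamma>"
        unfolding cc_def
        by (rule powr_between_le) (use d_ge[OF R x] d_le[OF R x] c_pos in \<open>auto simp: sz_def\<close>)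
      moreover have "\<bar>flow_part f R x\<bar> powr q \<le> (?k * (4 * m)) powr q"
        using q_gt1 bound by (intro powr_mono2) auto
      ultimately have "\<bar>flow_part f R x\<bar> powr q * d x powr ?\<gamma> \<le> (?k * (4 * m)) powr q * (cc * sz R powr ?\<gamma>)"
        by (intro mult_mono) auto
      then show ?thesis using True by (simp add: ennreal_leI)
    qed
  qed
  also have "\<dots> = ennreal ((?k * (4 * m)) powr q * (cc * sz R powr ?\<gamma>)) * emeasure \<mu> ?A"
    using cell_sets[OF R] cell_sets[OF P] by (intro nn_integral_cmult_indicator) auto
  also have "\<dots> \<le> ennreal ((?k * (4 * m)) powr q * (cc * sz R powr ?\<gamma>))
      * ennreal ((cM + cM * (c2 / c1) powr nn) * sz R powr nn)"
  proof (rule mult_left_mono)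
    have "emeasure \<mu> ?A \<le> emeasure \<mu> (cell R) + emeasure \<mu> (cell (par R))"
      using cell_sets[OF R] cell_sets[OF P] by (rule emeasure_subadditive)
    also have "\<dots> \<le> ennreal (cM * sz R powr nn + cM * sz (par R) powr nn)"
      using c_pos add_mono[OF emeasure_cell[OF R] emeasure_cell[OF P]] by simp
    also have "\<dots> \<le> ennreal (cM * sz R powr nn + cM * ((c2 / c1) powr nn * sz R powr nn))"
    proof -
      have "sz (par R) powr nn \<le> (c2 / c1 * sz R) powr nn"
        using sz_par_le[OF R] by (intro powr_mono2) (simp_all add: nn_def less_imp_le)
      also have "\<dots> = (c2 / c1) powr nn * sz R powr nn" using c_pos by (subst powr_mult) auto
      finally show ?thesis using c_pos by (intro ennreal_leI add_left_mono mult_left_mono) auto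
    qed
    finally show "emeasure \<mu> ?A \<le> ennreal ((cM + cM * (c2 / c1) powr nn) * sz R powr nn)"
      by (simp add: algebra_simps)
  qed simp
  also have "ennreal ((?k * (4 * m)) powr q * (cc * sz R powr ?\<gamma>)) * ennreal ((cM + cM * (c2 / c1) powr nn) * sz R powr nn)
     = ennreal (c6 * sz R powr (- nn * q + ?\<gamma> + nn)) * ennreal (?k powr q)"
  proof -
    have "(?k * (4 * m)) powr q = ?k powr q * ((4 / c0) powr q * sz R powr (- nn * q))"
    proof -
      have "4 * m = (4 / c0) * sz R powr (- nn)"
        using c_pos by (simp add: m_def powr_minus field_simps)
      then have "(?k * (4 * m)) powr q = (?k * ((4 / c0) * sz R powr (- nn))) powr q" by (simp only:)
      also have "\<dots> = ?k powr q * ((4 / c0) powr q * (sz R powr (- nn)) powr q)"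
        by (simp only: powr_mult)
      finally show ?thesis by (simp only: powr_powr)
    qed
    then have "(?k * (4 * m)) powr q * (cc * sz R powr ?\<gamma>) * ((cM + cM * (c2 / c1) powr nn) * sz R powr nn)
      = c6 * (sz R powr (- nn * q) * sz R powr ?\<gamma> * sz R powr nn) * ?k powr q"
      by (simp add: c6_def cc_def)
    also have "sz R powr (- nn * q) * sz R powr ?\<gamma> * sz R powr nn = sz R powr (- nn * q + ?\<gamma> + nn)"
      by (simp only: powr_add)
    finally show ?thesis
      using cc c_pos c6_nonneg by (simp flip: ennreal_mult)
  qed
  also have "\<dots> \<le> ennreal (c6 * sz R powr (- nn * q + ?\<gamma> + nn)) *
      (ennreal (c4 powr (q - 1) * sz R powr ((\<beta> - \<kappa>) * q + (\<alpha> + nn - 1) * (q - 1))) * ?X)"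
    by (intro mult_left_mono column_mass[OF f(1) R]) auto
  also have "\<dots> = ennreal (c6 * sz R powr (- nn * q + ?\<gamma> + nn) *
      (c4 powr (q - 1) * sz R powr ((\<beta> - \<kappa>) * q + (\<alpha> + nn - 1) * (q - 1)))) * ?X"
    using c6_nonneg by (simp add: ennreal_mult mult.assoc)
  also have "c6 * sz R powr (- nn * q + ?\<gamma> + nn) *
      (c4 powr (q - 1) * sz R powr ((\<beta> - \<kappa>) * q + (\<alpha> + nn - 1) * (q - 1)))
     = c6 * c4 powr (q - 1) * sz R powr ((- nn * q + ?\<gamma> + nn) + ((\<beta> - \<kappa>) * q + (\<alpha> + nn - 1) * (q - 1)))"
    by (simp only: powr_add mult_ac)
  \<comment> \<open>The powers of the volume cancel, and of the gain
    \<open>(1 - \<alpha>) * q\<close> exactly \<open>1 - \<alpha>\<close> survives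
    \<open>column_mass\<close>, reduced by the spent \<open>\<kappa> * q\<close>.\<close>
  also have "(- nn * q + ?\<gamma> + nn) + ((\<beta> - \<kappa>) * q + (\<alpha> + nn - 1) * (q - 1)) = 1 - \<alpha> - \<kappa> * q"
    by (simp add: algebra_simps)
  finally show ?thesis using c6_nonneg by (simp add: ennreal_mult mult.assoc)
qed

text \<open>Finite partial sums control the infinite sum of nonnegative terms. The data parts live
  on disjoint cells and add up to at most \<open>data_norm f\<close>; for the flow parts the sum
  over cubes is moved under the integral.\<close>

lemma finite_piece_sum:
  assumes f: "f \<in> data_space" "integrable \<mu> f" "\<And>x. x \<in> \<Omega> - col root \<Longrightarrow> f x = 0" 
    and C1: "0 < C1" "\<And>f. f \<in> borel_measurable \<mu> \<Longrightarrow> piece_norm f \<le> ennreal C1 * data_norm f"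
    and F: "finite F" "F \<subseteq> W"
  shows "(\<Sum>R\<in>F. piece_norm (piece f R))
     \<le> ennreal (2 powr q * (C1 + c6 * c4 powr (q - 1) * (c5 * c2 powr (\<kappa> * q)))) * data_norm f"
proof -
  have fm [measurable]: "f \<in> borel_measurable \<mu>" using f(1) by (rule data_space_measurable)
  have cs [measurable]: "cell R \<in> sets \<mu>" if "R \<in> F" for R using that F cell_sets by auto
  define C6 where "C6 = c6 * c4 powr (q - 1)"
  have C6: "0 \<le> C6" using c6_nonneg by (simp add: C6_def)
  let ?X = "\<lambda>R. \<integral>\<^sup>+x. ennreal (flow_weight f x * indicator (col R) x) \<partial>\<mu>"
  have each: "piece_norm (piece f R) \<le> ennreal (2 powr q) *
      (ennreal C1 * data_norm (\<lambda>x. f x * indicator (cell R) x) + ennreal C6 * (ennreal (sz R powr (1 - \<alpha> - \<kappa> * q)) * ?X R))"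
    if "R \<in> F" for R
  proof -
    have R: "R \<in> W" using that F by auto
    have m: "flow_part f R \<in> borel_measurable \<mu>" 
      unfolding flow_part_def[abs_def]
      by (intro borel_measurable_add borel_measurable_times borel_measurable_diff bump_measurable cell_sets par_W R) auto
    have "piece_norm (piece f R) \<le> ennreal (2 powr q) * (piece_norm (\<lambda>x. f x * indicator (cell R) x) + piece_norm (flow_part f R))"
      unfolding piece_def[abs_def]
      using piece_norm_add_le[of "\<lambda>x. f x * indicator (cell R) x" "flow_part f R"] m cs[OF that] fm
      by simp
    also have "\<dots> \<le> ennreal (2 powr q) * (ennreal C1 * data_norm (\<lambda>x. f x * indicator (cell R) x)
        + ennreal C6 * (ennreal (sz R powr (1 - \<alpha> - \<kappa> * q)) * ?X R))"
      using flow_part_norm[OF f(1,2) R] cs[OF that] fm C6_def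
      by (intro mult_left_mono add_mono C1(2)) auto
    finally show ?thesis .
  qed
  have s1: "(\<Sum>R\<in>F. data_norm (\<lambda>x. f x * indicator (cell R) x)) \<le> data_norm f"
  proof -
    let ?w = "\<lambda>x. \<bar>f x\<bar> powr q * d x powr (- \<beta> * q)"
    have "(\<Sum>R\<in>F. data_norm (\<lambda>x. f x * indicator (cell R) x)) = (\<Sum>R\<in>F. \<integral>\<^sup>+x. ennreal (?w x) * indicator (cell R) x \<partial>\<mu>)"
      unfolding data_norm_def by (intro sum.cong nn_integral_cong refl) (auto simp: indicator_def)
    also have "\<dots> = (\<integral>\<^sup>+x. (\<Sum>R\<in>F. ennreal (?w x) * indicator (cell R) x) \<partial>\<mu>)"
      by (rule nn_integral_sum[symmetric]) measurable
    also have "\<dots> \<le> (\<integral>\<^sup>+x. ennreal (?w x) \<partial>\<mu>)"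
    proof (rule nn_integral_mono)
      fix x
      show "(\<Sum>R\<in>F. ennreal (?w x) * indicator (cell R) x) \<le> ennreal (?w x)"
      proof (cases "\<exists>S\<in>F. x \<in> cell S")
        case True
        then obtain S where S: "S \<in> F" "x \<in> cell S" by blast
        have "(\<Sum>R\<in>F. ennreal (?w x) * indicator (cell R) x) = (\<Sum>R\<in>F. if R = S then ennreal (?w x) else 0)"
          using S F cell_disjoint[of _ S] by (intro sum.cong) (auto simp: indicator_def)
        then show ?thesis using S F by simp
      qed (auto simp: indicator_def intro!: sum.neutral)
    qed
    finally show ?thesis by (simp add: data_norm_def)
  qed
  have s2: "(\<Sum>R\<in>F. ennreal (sz R powr (1 - \<alpha> - \<kappa> * q)) * ?X R) \<le> ennreal (c5 * c2 powr (\<kappa> * q)) * data_norm f"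
  proof -
    have [measurable]: "col R \<in> sets \<mu>" for R by (rule col_sets)
    have "(\<Sum>R\<in>F. ennreal (sz R powr (1 - \<alpha> - \<kappa> * q)) * ?X R)
      = (\<Sum>R\<in>F. \<integral>\<^sup>+x. ennreal (sz R powr (1 - \<alpha> - \<kappa> * q)) * ennreal (flow_weight f x * indicator (col R) x) \<partial>\<mu>)"
      by (intro sum.cong refl nn_integral_cmult[symmetric]) measurable
    also have "\<dots> = (\<integral>\<^sup>+x. (\<Sum>R\<in>F. ennreal (sz R powr (1 - \<alpha> - \<kappa> * q)) * ennreal (flow_weight f x * indicator (col R) x)) \<partial>\<mu>)"
      by (rule nn_integral_sum[symmetric]) measurable
    also have "\<dots> \<le> (\<integral>\<^sup>+x. ennreal (c5 * c2 powr (\<kappa> * q)) * ennreal (\<bar>f x\<bar> powr q * d x powr (- \<beta> * q)) \<partial>\<mu>)"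
    proof (rule nn_integral_mono)
      fix x assume "x \<in> space \<mu>"
      then have x: "x \<in> \<Omega>" by (simp add: space_\<mu>)
      let ?e = "1 - \<alpha> - \<kappa> * q"
      have eq: "(\<Sum>R\<in>F. ennreal (sz R powr ?e) * ennreal (flow_weight f x * indicator (col R) x))
         = ennreal (\<Sum>R\<in>F. sz R powr ?e * (flow_weight f x * indicator (col R) x))"
        by (subst sum_ennreal[symmetric]) (auto simp: ennreal_mult)
      have "(\<Sum>R\<in>F. sz R powr ?e * (flow_weight f x * indicator (col R) x))
          \<le> c5 * c2 powr (\<kappa> * q) * (\<bar>f x\<bar> powr q * d x powr (- \<beta> * q))"
      proof (cases "\<exists>S\<in>W. x \<in> cell S")
        case False
        then have "indicator (col R) x = (0::real)" for R using col_cell by (auto simp: indicator_def)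
        then show ?thesis using c5_pos by simp
      next
        case True
        then obtain S where S: "S \<in> W" "x \<in> cell S" by blast
        \<comment> \<open>A point of \<open>cell S\<close> lies in the columns of the ancestors of
          \<open>S\<close> and in no others, so \<open>ancestor_sum\<close> applies
          pointwise.\<close>
        have "(\<Sum>R\<in>F. sz R powr ?e * (flow_weight f x * indicator (col R) x))
           = flow_weight f x * (\<Sum>R\<in>F. if desc R S then sz R powr ?e else 0)"
          unfolding sum_distrib_left
          by (intro sum.cong) (auto simp: in_col[OF S] indicator_def)
        also have "(\<Sum>R\<in>F. if desc R S then sz R powr ?e else 0) = (\<Sum>R\<in>{R\<in>F. desc R S}. sz R powr ?e)"
          using F by (simp add: sum.inter_filter)
        also have "flow_weight f x * \<dots> \<le> flow_weight f x * (c5 * sz S powr (- \<kappa> * q))"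
          using ancestor_sum[OF S(1) F] by (intro mult_left_mono) auto
        also have "\<dots> = c5 * (\<bar>f x\<bar> powr q * d x powr (- \<beta> * q)) * (d x powr (\<kappa> * q) * sz S powr (- \<kappa> * q))"
          unfolding flow_weight_eq powr_add by (simp only: mult_ac)
        also have "\<dots> \<le> c5 * (\<bar>f x\<bar> powr q * d x powr (- \<beta> * q)) * c2 powr (\<kappa> * q)"
        proof (rule mult_left_mono)
          have "d x powr (\<kappa> * q) \<le> (c2 * sz S) powr (\<kappa> * q)"
            using cell_d[OF S] d_pos[OF x] \<kappa>_pos q_gt1 by (intro powr_mono2) auto
          also have "\<dots> = c2 powr (\<kappa> * q) * sz S powr (\<kappa> * q)"
            using c_pos by (subst powr_mult) auto
          finally have "d x powr (\<kappa> * q) * sz S powr (- \<kappa> * q) \<le> c2 powr (\<kappa> * q) * sz S powr (\<kappa> * q) * sz S powr (- \<kappa> * q)"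
            by (rule mult_right_mono) simp
          also have "\<dots> = c2 powr (\<kappa> * q)" by (simp add: powr_minus)
          finally show "d x powr (\<kappa> * q) * sz S powr (- \<kappa> * q) \<le> c2 powr (\<kappa> * q)" .
        qed (use c5_pos in auto)
        finally show ?thesis by (simp add: mult_ac)
      qed
      then show "(\<Sum>R\<in>F. ennreal (sz R powr ?e) * ennreal (flow_weight f x * indicator (col R) x))
         \<le> ennreal (c5 * c2 powr (\<kappa> * q)) * ennreal (\<bar>f x\<bar> powr q * d x powr (- \<beta> * q))"
        unfolding eq using c5_pos by (simp add: ennreal_leI flip: ennreal_mult)
    qed
    also have "\<dots> = ennreal (c5 * c2 powr (\<kappa> * q)) * data_norm f"
      unfolding data_norm_def by (rule nn_integral_cmult) measurable
    finally show ?thesis .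
  qed
  have "(\<Sum>R\<in>F. piece_norm (piece f R)) \<le> (\<Sum>R\<in>F. ennreal (2 powr q) *
      (ennreal C1 * data_norm (\<lambda>x. f x * indicator (cell R) x) + ennreal C6 * (ennreal (sz R powr (1 - \<alpha> - \<kappa> * q)) * ?X R)))"
    by (rule sum_mono) (rule each)
  also have "\<dots> = ennreal (2 powr q) * (ennreal C1 * (\<Sum>R\<in>F. data_norm (\<lambda>x. f x * indicator (cell R) x))
      + ennreal C6 * (\<Sum>R\<in>F. ennreal (sz R powr (1 - \<alpha> - \<kappa> * q)) * ?X R))"
    by (simp only: sum.distrib sum_distrib_left distrib_left)
  also have "\<dots> \<le> ennreal (2 powr q) * (ennreal C1 * data_norm f + ennreal C6 * (ennreal (c5 * c2 powr (\<kappa> * q)) * data_norm f))"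
    by (intro mult_left_mono add_mono s1 s2) auto
  also have "\<dots> = ennreal (2 powr q * (C1 + C6 * (c5 * c2 powr (\<kappa> * q)))) * data_norm f"
    using C1(1) C6 c5_pos by (simp add: ennreal_mult distrib_left distrib_right mult.assoc)
  finally show ?thesis by (simp add: C6_def)
qed

text \<open>On a compact subset \<open>d\<close> is bounded away from zero, so the cubes that meet
  it are large, and there are finitely many of those.\<close>

lemma good_family_tree:
  assumes e: "inj_on e W"
  shows "good_family (e ` W) (\<lambda>t. U (inv_into W e t))"
proof -
  have "finite {t \<in> e ` W. U (inv_into W e t) \<inter> K \<noteq> {}}" if K: "compact K" "K \<subseteq> \<Omega>" for K
  proof -
    \<comment> \<open>An upper bound for the power \<open>-1\<close> of \<open>d\<close> is a
      positive lower bound for \<open>d\<close> on \<open>K\<close>.\<close>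
    obtain C where C: "0 < C" "\<And>x. x \<in> K \<Longrightarrow> d x powr (-1) \<le> C"
      using d_powr_bounded[OF K] by blast
    have "1 / (C * c2) \<le> sz R" if "R \<in> W" "x \<in> U R" "x \<in> K" for R x
    proof -
      have "0 < d x" using d_pos K that by blast
      then have "1 / C \<le> d x" using C(2)[OF that(3)] C(1) by (simp add: powr_minus field_simps)
      also have "\<dots> \<le> c2 * sz R" using d_le[OF that(1,2)] by (simp add: sz_def)
      finally show ?thesis using C(1) c_pos by (simp add: field_simps)
    qed
    then have "{t \<in> e ` W. U (inv_into W e t) \<inter> K \<noteq> {}} \<subseteq> e ` {R\<in>W. 1 / (C * c2) \<le> sz R}"
      using e by auto
    moreover have "finite {R\<in>W. 1 / (C * c2) \<le> sz R}" using C(1) c_pos by (intro finite_large) simp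
    ultimately show ?thesis using finite_subset finite_imageI by blast
  qed
  then show ?thesis
    unfolding good_family_def using U_cube closure_U e by auto
qed

theorem transportable_tree: "transportable (col root) (bump (cell root))"
proof -
  define e where "e = to_nat_on W"
  have e: "inj_on e W" using inj_on_to_nat_on[OF countable_W] by (simp add: e_def)
  let ?i = "inv_into W e"
  obtain C1 where C1: "0 < C1" "\<And>f. f \<in> borel_measurable \<mu> \<Longrightarrow> piece_norm f \<le> ennreal C1 * data_norm f"
    using piece_norm_le_data_norm by blast
  obtain D where D: "0 < D" "\<And>x. x \<in> \<Omega> \<Longrightarrow> d x \<le> D" using d_bounded by blast
  \<comment> \<open>\<open>column_weight\<close> controls the exponent
    \<open>(\<beta> - \<kappa>) * p\<close>; the missing factor
    \<open>d x powr (\<kappa> * p)\<close> is bounded on \<Omega> by the first factor.\<close>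
  define B where "B = D powr (\<kappa> * p) * (c4 * sz root powr (\<beta> * p + \<alpha> + nn - 1 - \<kappa> * p))"
  have B: "0 < B" using D c4_pos by (simp add: B_def)
  have BB: "(\<integral>\<^sup>+x. ennreal (d x powr (\<beta> * p)) * indicator (col root) x \<partial>\<mu>) \<le> ennreal B"
  proof -
    have [measurable]: "col root \<in> sets \<mu>" by (rule col_sets)
    have "(\<integral>\<^sup>+x. ennreal (d x powr (\<beta> * p)) * indicator (col root) x \<partial>\<mu>)
      \<le> (\<integral>\<^sup>+x. ennreal (D powr (\<kappa> * p)) * (ennreal (d x powr ((\<beta> - \<kappa>) * p)) * indicator (col root) x) \<partial>\<mu>)"
    proof (rule nn_integral_mono)
      fix x assume "x \<in> space \<mu>"
      then have x: "x \<in> \<Omega>" by (simp add: space_\<mu>)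
      have "d x powr ((\<beta> - \<kappa>) * p + \<kappa> * p) \<le> D powr (\<kappa> * p) * d x powr ((\<beta> - \<kappa>) * p)"
        using \<kappa>_pos p_gt1 by (intro d_powr_absorb x D) auto
      also have "(\<beta> - \<kappa>) * p + \<kappa> * p = \<beta> * p" by (simp add: algebra_simps)
      finally show "ennreal (d x powr (\<beta> * p)) * indicator (col root) x
        \<le> ennreal (D powr (\<kappa> * p)) * (ennreal (d x powr ((\<beta> - \<kappa>) * p)) * indicator (col root) x)"
        by (auto simp: indicator_def ennreal_leI simp flip: ennreal_mult)
    qed
    also have "\<dots> = ennreal (D powr (\<kappa> * p)) * (\<integral>\<^sup>+x. ennreal (d x powr ((\<beta> - \<kappa>) * p)) * indicator (col root) x \<partial>\<mu>)"
      by (rule nn_integral_cmult) measurable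
    also have "\<dots> \<le> ennreal (D powr (\<kappa> * p)) * ennreal (c4 * sz root powr (\<beta> * p + \<alpha> + nn - 1 - \<kappa> * p))"
      by (intro mult_left_mono column_weight root) simp
    also have "\<dots> = ennreal B" using c4_pos by (simp add: B_def ennreal_mult)
    finally show ?thesis .
  qed
  define C2 where "C2 = 2 powr q * (C1 + c6 * c4 powr (q - 1) * (c5 * c2 powr (\<kappa> * q)))"
  have C2: "0 \<le> C2" unfolding C2_def using C1(1) c6_nonneg c5_pos by (intro mult_nonneg_nonneg add_nonneg_nonneg) auto
  define C where "C = B powr (q - 1) + C2"
  have C: "0 \<le> C" "B powr (q - 1) \<le> C" "C2 \<le> C" using C2 by (auto simp: C_def)
  have "integrable \<mu> f \<and> ennreal (\<bar>integral\<^sup>L \<mu> f\<bar> powr q) \<le> ennreal C * data_norm f \<and>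
        decomposes (e ` W) (\<lambda>t. U (?i t)) (\<lambda>x. f x - integral\<^sup>L \<mu> f * bump (cell root) x) (ennreal C * data_norm f)"
    if f: "f \<in> data_space" "\<forall>x\<in>\<Omega> - col root. f x = 0" for f
  proof -
    have f0: "f x = 0" if "x \<in> \<Omega> - col root" for x using f(2) that by blast
    note ib = integral_bound_on[OF f(1) f0 col_sets B BB]
    have CD: "ennreal (B powr (q - 1)) * data_norm f \<le> ennreal C * data_norm f"
      "ennreal C2 * data_norm f \<le> ennreal C * data_norm f"
      using C by (auto intro!: mult_right_mono ennreal_leI)
    have "(\<Sum>\<^sub>\<infinity>t\<in>e ` W. piece_norm (piece f (?i t))) = (\<Sum>\<^sub>\<infinity>R\<in>W. piece_norm (piece f R))"
      using e by (subst infsum_reindex[OF e]) (auto intro!: infsum_cong)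
    also have "\<dots> \<le> ennreal C2 * data_norm f"
      unfolding C2_def
      by (intro infsum_le_finite_sums nonneg_summable_on_complete finite_piece_sum f ib(1) f0 C1) auto
    finally have "(\<Sum>\<^sub>\<infinity>t\<in>e ` W. piece_norm (piece f (?i t))) \<le> ennreal C * data_norm f"
      using CD by (meson order_trans)
    moreover have "((\<lambda>t. piece f (?i t) x) has_sum (f x - integral\<^sup>L \<mu> f * bump (cell root) x)) (e ` W)" if "x \<in> \<Omega>" for x
    proof (subst has_sum_reindex[OF e])
      show "((\<lambda>t. piece f (?i t) x) \<circ> e has_sum (f x - integral\<^sup>L \<mu> f * bump (cell root) x)) W"
        using piece_sum[OF ib(1) f0 that] e by (subst has_sum_cong[where g = "\<lambda>R. piece f R x"]) auto
    qed
    ultimately have "decomposes (e ` W) (\<lambda>t. U (?i t)) (\<lambda>x. f x - integral\<^sup>L \<mu> f * bump (cell root) x) (ennreal C * data_norm f)"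
      unfolding decomposes_def
      using piece_props[OF ib(1)] e by (intro exI[of _ "\<lambda>t. piece f (?i t)"]) (auto simp: space_\<mu> intro!: AE_I2)
    then show ?thesis using ib order_trans[OF ib(2) CD(1)] by blast
  qed
  moreover have "col root - (\<Union>t\<in>e ` W. U (?i t)) = {}"
    using e cell_U unfolding col_def by fastforce
  ultimately show ?thesis
    by (intro transportableI[OF good_family_tree[OF e] C(1)]) auto
qed

end

section \<open>Dyadic cubes below a Hoelder graph\<close>

text \<open>A half-open interval of length \<open>b - a\<close> has fewer than
  \<open>b - a + 1\<close> integers when it is nonempty; \<open>a \<le> b + 1\<close> keeps the
  bound nonnegative when it is empty.\<close>

lemma card_int_interval:
  fixes a b :: real
  assumes "A \<subseteq> {t::int. a \<le> real_of_int t \<and> real_of_int t < b}" "a \<le> b + 1"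
  shows "finite A" "card A \<le> b - a + 1"
proof -
  have sub: "A \<subseteq> {\<lceil>a\<rceil>..<\<lceil>b\<rceil>}"
  proof
    fix t assume "t \<in> A"
    then have "a \<le> of_int t" "of_int t < b" using assms(1) by auto
    then show "t \<in> {\<lceil>a\<rceil>..<\<lceil>b\<rceil>}" by (simp add: ceiling_le_iff less_ceiling_iff)
  qed
  then show "finite A" by (rule finite_subset) simp
  have "card A \<le> card {\<lceil>a\<rceil>..<\<lceil>b\<rceil>}" using sub by (intro card_mono) auto
  then have "real (card A) \<le> real (nat (\<lceil>b\<rceil> - \<lceil>a\<rceil>))" by simp
  also have "\<dots> \<le> b - a + 1"
    using assms(2) by (cases "\<lceil>a\<rceil> \<le> \<lceil>b\<rceil>") (simp_all, linarith+)
  finally show "card A \<le> b - a + 1" .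
qed

text \<open>Fixing \<open>j k = 0\<close> gives every base cube one representative among the
  functions on all coordinates.\<close>

lemma card_lateral:
  fixes B :: "'n::finite \<Rightarrow> int set"
  assumes "\<And>i. i \<noteq> k \<Longrightarrow> finite (B i) \<and> card (B i) \<le> N"
  shows "finite {j::'n \<Rightarrow> int. j k = 0 \<and> (\<forall>i. i \<noteq> k \<longrightarrow> j i \<in> B i)}"
    and "card {j::'n \<Rightarrow> int. j k = 0 \<and> (\<forall>i. i \<noteq> k \<longrightarrow> j i \<in> B i)} \<le> N ^ (CARD('n) - 1)"
proof -
  let ?J = "{j::'n \<Rightarrow> int. j k = 0 \<and> (\<forall>i. i \<noteq> k \<longrightarrow> j i \<in> B i)}"
  let ?P = "PiE (UNIV - {k}) B"
  let ?h = "\<lambda>f i. if i = k then 0 else f i"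
  have fin: "finite ?P" using assms by (intro finite_PiE) auto
  have sub: "?J \<subseteq> ?h ` ?P"
  proof
    fix j assume j: "j \<in> ?J"
    have "j = ?h (restrict j (UNIV - {k}))" using j by auto
    moreover have "restrict j (UNIV - {k}) \<in> ?P" using j by auto
    ultimately show "j \<in> ?h ` ?P" by blast
  qed
  then show "finite ?J" using fin finite_subset by blast
  have "card ?J \<le> card (?h ` ?P)" using sub fin by (intro card_mono) auto
  also have "\<dots> \<le> card ?P" using fin by (rule card_image_le)
  also have "\<dots> = (\<Prod>i\<in>UNIV - {k}. card (B i))" by (simp add: card_PiE)
  also have "\<dots> \<le> (\<Prod>i\<in>UNIV - {k}. N)" using assms by (intro prod_mono) auto
  also have "\<dots> = N ^ (CARD('n) - 1)" by (simp add: card_Diff_singleton)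
  finally show "card ?J \<le> N ^ (CARD('n) - 1)" .
qed

lemma div_interval:
  fixes t c a :: int
  assumes "0 < a" "t div a = c"
  shows "t \<in> {a * c..<a * c + a}"
  using assms by (metis (no_types, lifting) add_less_cancel_left atLeastLessThan_iff
      mult_div_mod_eq pos_mod_bound pos_mod_sign le_add_same_cancel1)

text \<open>
  The graph function is extended to all of \<open>R^n\<close> so as to be constant in direction \<open>k\<close>; this is the
  case \<open>e = 0\<close> of \<open>osc\<close>.  The grid has its origin at the point \<open>cr\<close> below the graph and \<open>L\<close> is the
  side of its largest cubes.
\<close>

locale holder_chart = weighted_domain \<Omega> p q \<alpha> \<beta>
  for \<Omega> :: "(real^'n::finite) set" and p q \<alpha> \<beta> :: real +
  fixes T S :: "real^'n \<Rightarrow> real^'n" and k :: 'n and cr :: "real^'n" and L H K :: real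
    and \<psi> :: "real^'n \<Rightarrow> real"
  assumes T: "rigid_motion T" and S: "rigid_motion S" and ST: "\<And>x. S (T x) = x" and TS: "\<And>x. T (S x) = x"
    and L: "0 < L" and H: "0 < H" and K: "0 \<le> K"
    and osc: "\<And>y z e. (\<And>i. i \<noteq> k \<Longrightarrow> cr $ i - 2 * L \<le> y $ i \<and> y $ i \<le> cr $ i + 3 * L) \<Longrightarrow>
        (\<And>i. i \<noteq> k \<Longrightarrow> cr $ i - 2 * L \<le> z $ i \<and> z $ i \<le> cr $ i + 3 * L) \<Longrightarrow> 0 \<le> e \<Longrightarrow>
        (\<And>i. i \<noteq> k \<Longrightarrow> \<bar>y $ i - z $ i\<bar> \<le> e) \<Longrightarrow> \<bar>\<psi> y - \<psi> z\<bar> \<le> K * e powr \<alpha>"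
    and \<psi>_bounds: "\<And>y. (\<And>i. i \<noteq> k \<Longrightarrow> cr $ i - 2 * L \<le> y $ i \<and> y $ i \<le> cr $ i + 3 * L) \<Longrightarrow>
        cr $ k + 4 * L < \<psi> y \<and> \<psi> y < cr $ k + H"
    and graph: "\<And>y. (\<And>i. i \<noteq> k \<Longrightarrow> cr $ i - 2 * L \<le> y $ i \<and> y $ i \<le> cr $ i + 3 * L) \<Longrightarrow>
        cr $ k - 2 * L \<le> y $ k \<Longrightarrow> y $ k \<le> cr $ k + H + 4 * L \<Longrightarrow> y \<in> T ` \<Omega> \<longleftrightarrow> y $ k < \<psi> y"
begin

definition lat :: "real^'n \<Rightarrow> bool" where
  "lat y \<longleftrightarrow> (\<forall>i. i \<noteq> k \<longrightarrow> cr $ i - 2 * L \<le> y $ i \<and> y $ i \<le> cr $ i + 3 * L)"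

lemma osc': "lat y \<Longrightarrow> lat z \<Longrightarrow> 0 \<le> e \<Longrightarrow> (\<And>i. i \<noteq> k \<Longrightarrow> \<bar>y $ i - z $ i\<bar> \<le> e) \<Longrightarrow> \<bar>\<psi> y - \<psi> z\<bar> \<le> K * e powr \<alpha>"
  using osc[of y z e] unfolding lat_def by blast

lemma \<psi>_lat_eq: "lat y \<Longrightarrow> lat z \<Longrightarrow> (\<And>i. i \<noteq> k \<Longrightarrow> y $ i = z $ i) \<Longrightarrow> \<psi> y = \<psi> z"
  using osc'[of y z 0] \<alpha>_pos by simp

lemma \<psi>_low: "lat y \<Longrightarrow> cr $ k + 4 * L < \<psi> y" and \<psi>_high: "lat y \<Longrightarrow> \<psi> y < cr $ k + H"
  using \<psi>_bounds[of y] unfolding lat_def by blast+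

lemma graph': "lat y \<Longrightarrow> cr $ k - 2 * L \<le> y $ k \<Longrightarrow> y $ k \<le> cr $ k + H + 4 * L \<Longrightarrow> y \<in> T ` \<Omega> \<longleftrightarrow> y $ k < \<psi> y"
  using graph[of y] unfolding lat_def by blast

section \<open>The dyadic grid and admissible cubes\<close>

definition len :: "nat \<Rightarrow> real" where "len m = L / 2 ^ m"

lemma len_pos [simp]: "0 < len m" using L by (simp add: len_def)

lemma len_le_L: "len m \<le> L"
  using L by (simp add: len_def divide_le_eq)

lemma len_Suc: "len m = 2 * len (Suc m)" by (simp add: len_def)

lemma len_mono: "m' \<le> m \<Longrightarrow> len m \<le> len m'"
  unfolding len_def using L by (intro divide_left_mono power_increasing) auto

lemma len_diff: "m' \<le> m \<Longrightarrow> len m' = 2 ^ (m - m') * len m"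
  by (simp add: len_def power_diff)

definition ix :: "nat \<Rightarrow> real^'n \<Rightarrow> 'n \<Rightarrow> int" where
  "ix m y i = \<lfloor>(y $ i - cr $ i) / len m\<rfloor>"

lemma ix_iff: "ix m y i = t \<longleftrightarrow> cr $ i + len m * t \<le> y $ i \<and> y $ i < cr $ i + len m * (t + 1)"
proof -
  have "ix m y i = t \<longleftrightarrow> of_int t \<le> (y $ i - cr $ i) / len m \<and> (y $ i - cr $ i) / len m < of_int t + 1"
    unfolding ix_def by (rule floor_eq_iff)
  also have "\<dots> \<longleftrightarrow> cr $ i + len m * t \<le> y $ i \<and> y $ i < cr $ i + len m * (t + 1)"
    by (simp add: pos_le_divide_eq pos_divide_less_eq algebra_simps)
  finally show ?thesis .
qed

lemma ix_div: assumes "m' \<le> m" shows "ix m' y i = ix m y i div 2 ^ (m - m')"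
proof -
  have "(y $ i - cr $ i) / len m' = (y $ i - cr $ i) / len m / of_int (2 ^ (m - m'))"
    using len_diff[OF assms] by (simp add: field_simps)
  then show ?thesis unfolding ix_def by (simp only:) (rule floor_divide_real_eq_div, simp)
qed

lemma ix_nested: "ix m y = ix m z \<Longrightarrow> m' \<le> m \<Longrightarrow> ix m' y = ix m' z"
  by (rule ext) (simp add: ix_div)

text \<open>The concentric dilate by the factor 5. The triple of a cell lies in it with margin
  \<open>len m\<close>, the source of the lower bound for \<open>d\<close> in
  \<open>d_lower\<close>.\<close>

definition dil :: "nat \<Rightarrow> ('n \<Rightarrow> int) \<Rightarrow> (real^'n) set" where
  "dil m j = {y. \<forall>i. cr $ i + len m * (j i - 2) \<le> y $ i \<and> y $ i \<le> cr $ i + len m * (j i + 3)}"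

definition adm :: "nat \<Rightarrow> ('n \<Rightarrow> int) \<Rightarrow> bool" where
  "adm m j \<longleftrightarrow> (\<forall>y\<in>dil m j. y $ k < \<psi> y)"

definition E0 :: "(real^'n) set" where
  "E0 = {y. (\<forall>i. i \<noteq> k \<longrightarrow> cr $ i \<le> y $ i \<and> y $ i < cr $ i + L) \<and> cr $ k \<le> y $ k \<and> y $ k < \<psi> y}"

lemma len0 [simp]: "len 0 = L" by (simp add: len_def)

lemma E0_iff: "y \<in> E0 \<longleftrightarrow> (\<forall>i. i \<noteq> k \<longrightarrow> ix 0 y i = 0) \<and> cr $ k \<le> y $ k \<and> y $ k < \<psi> y"
  unfolding E0_def by (auto simp: ix_iff)

lemma ix_k_nonneg: "0 \<le> ix m y k \<longleftrightarrow> cr $ k \<le> y $ k"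
  unfolding ix_def using len_pos[of m] by (auto simp: zero_le_divide_iff simp del: len_pos)

lemma dil_near: assumes "z \<in> dil m (ix m y)" shows "\<bar>z $ i - y $ i\<bar> \<le> 3 * len m"
proof -
  have "cr $ i + len m * ix m y i \<le> y $ i" "y $ i < cr $ i + len m * (ix m y i + 1)"
    using ix_iff[of m y i "ix m y i"] by simp_all
  moreover have "cr $ i + len m * (ix m y i - 2) \<le> z $ i" "z $ i \<le> cr $ i + len m * (ix m y i + 3)"
    using assms unfolding dil_def by auto
  ultimately show ?thesis by (simp add: algebra_simps abs_le_iff)
qed

lemma lat_dil_index:
  assumes "z \<in> dil m j" "\<And>i. i \<noteq> k \<Longrightarrow> 0 \<le> j i \<and> j i < 2 ^ m" shows "lat z"
  unfolding lat_def
proof (intro allI impI)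
  fix i assume i: "i \<noteq> k"
  have z: "cr $ i + len m * (j i - 2) \<le> z $ i" "z $ i \<le> cr $ i + len m * (j i + 3)"
    using assms(1) unfolding dil_def by auto
  have "real_of_int (j i + 1) \<le> real_of_int (2 ^ m)" using assms(2)[OF i] by (subst of_int_le_iff) simp
  then have "len m * (j i + 1) \<le> len m * 2 ^ m" by (intro mult_left_mono) (auto simp: less_imp_le)
  also have "\<dots> = L" by (simp add: len_def)
  finally have 1: "len m * (j i + 1) \<le> L" .
  have 2: "0 \<le> len m * j i" using assms(2)[OF i] by (intro mult_nonneg_nonneg) (simp_all add: less_imp_le)
  show "cr $ i - 2 * L \<le> z $ i \<and> z $ i \<le> cr $ i + 3 * L"
    using z 1 2 len_le_L[of m] by (simp add: algebra_simps)
qed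

lemma E0_index:
  assumes "y \<in> E0" "i \<noteq> k" shows "0 \<le> ix m y i" "ix m y i < 2 ^ m"
proof -
  have "ix m y i div 2 ^ m = 0" using assms ix_div[of 0 m y i] by (simp add: E0_iff)
  then show "0 \<le> ix m y i" "ix m y i < 2 ^ m"
    using div_interval[of "2 ^ m" "ix m y i" 0] by auto
qed

lemma lat_dil: "y \<in> E0 \<Longrightarrow> z \<in> dil m (ix m y) \<Longrightarrow> lat z"
  by (rule lat_dil_index[of z m "ix m y"]) (simp_all add: E0_index)

lemma self_dil: "y \<in> dil m (ix m y)"
  unfolding dil_def
proof (intro CollectI allI conjI)
  fix i
  define t where "t = len m * ix m y i"
  have e: "len m * (ix m y i - 2) = t - 2 * len m" "len m * (ix m y i + 3) = t + 3 * len m"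
    "len m * (ix m y i + 1) = t + len m" by (simp_all add: t_def algebra_simps)
  have *: "cr $ i + t \<le> y $ i" "y $ i < cr $ i + (t + len m)"
    using ix_iff[of m y i "ix m y i"] unfolding e by (simp_all add: t_def)
  have l: "0 < len m" by simp
  show "cr $ i + len m * (ix m y i - 2) \<le> y $ i"
    unfolding e using * l by linarith
  show "y $ i \<le> cr $ i + len m * (ix m y i + 3)"
    unfolding e using * l by linarith
qed

lemma lat_E0: "y \<in> E0 \<Longrightarrow> lat y"
  using lat_dil self_dil by blast

lemma ex_adm: assumes y: "y \<in> E0" shows "\<exists>m. adm m (ix m y)"
proof -
  define g where "g = \<psi> y - y $ k"
  have g: "0 < g" using y by (simp add: g_def E0_def)
  \<comment> \<open>\<open>g\<close> is the vertical gap to the graph. The second entry makes the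
    oscillation \<open>K * e powr \<alpha>\<close> at most \<open>g / 2\<close>, the first keeps
    heights within \<open>g / 3\<close>, and the two together stay below \<open>g\<close>. The
    summand 1 prevents division by zero at \<open>K = 0\<close>.\<close>
  define e where "e = min (g / 3) ((g / (2 * (K + 1))) powr (1 / \<alpha>))"
  have e: "0 < e" using g K by (simp add: e_def)
  obtain m where "3 * L / e < 2 ^ m" using real_arch_pow[of 2 "3 * L / e"] by auto
  then have m: "3 * len m < e" using e L by (simp add: len_def field_simps)
  have "z $ k < \<psi> z" if z: "z \<in> dil m (ix m y)" for z
  proof -
    have n: "\<bar>z $ i - y $ i\<bar> \<le> e" for i using dil_near[OF z, of i] m by linarith
    have "\<bar>\<psi> z - \<psi> y\<bar> \<le> K * e powr \<alpha>"
      by (rule osc'[OF lat_dil[OF y z] lat_E0[OF y]]) (use e n in auto)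
    also have "\<dots> \<le> K * ((g / (2 * (K + 1))) powr (1 / \<alpha>)) powr \<alpha>"
      using e \<alpha>_pos K by (intro mult_left_mono powr_mono2) (auto simp: e_def)
    also have "\<dots> = K * (g / (2 * (K + 1)))" using \<alpha>_pos g K by (simp add: powr_powr)
    also have "\<dots> \<le> g / 2" using g K by (simp add: field_simps)
    finally have "\<psi> y - g / 2 \<le> \<psi> z" by linarith
    moreover have "\<bar>z $ k - y $ k\<bar> \<le> g / 3" using n[of k] unfolding e_def by (rule min.boundedE)
    then have "z $ k \<le> y $ k + g / 3" by linarith
    ultimately show ?thesis using g by (simp add: g_def field_simps)
  qed
  then show ?thesis unfolding adm_def by blast
qed

section \<open>Maximal admissible cubes and their cells\<close>

definition lev :: "real^'n \<Rightarrow> nat" where "lev y = (LEAST m. adm m (ix m y))"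

definition idx :: "real^'n \<Rightarrow> nat \<times> ('n \<Rightarrow> int)" where "idx y = (lev y, ix (lev y) y)"

definition dcell :: "nat \<times> ('n \<Rightarrow> int) \<Rightarrow> (real^'n) set" where
  "dcell R = {y. ix (fst R) y = snd R}"

definition W :: "(nat \<times> ('n \<Rightarrow> int)) set" where "W = idx ` E0"

lemma adm_lev: "y \<in> E0 \<Longrightarrow> adm (lev y) (ix (lev y) y)"
  unfolding lev_def by (rule LeastI_ex[OF ex_adm])

lemma lev_le: "adm m (ix m y) \<Longrightarrow> lev y \<le> m"
  unfolding lev_def by (rule Least_le)

lemma in_dcell_idx: "y \<in> dcell (idx y)"
  by (simp add: dcell_def idx_def)

text \<open>If \<open>z\<close> lies in the maximal cube of \<open>y\<close>, all coarser grid cubes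
  of the two points agree, so the search for the least admissible level ends at the same cube. Hence
  distinct maximal cells are disjoint.\<close>

lemma dcell_E0:
  assumes y: "y \<in> E0" and z: "z \<in> dcell (idx y)" shows "z \<in> E0" "idx z = idx y"
proof -
  have eq: "ix (lev y) z = ix (lev y) y" using z by (simp add: dcell_def idx_def)
  have nest: "ix m z = ix m y" if "m \<le> lev y" for m by (rule ix_nested[OF eq that])
  have "z $ k < \<psi> z"
    using adm_lev[OF y] self_dil[of z "lev y"] unfolding adm_def eq by blast
  then show zE: "z \<in> E0"
    using y nest[of 0] ix_k_nonneg[of "lev y" y] ix_k_nonneg[of "lev y" z] by (simp add: E0_iff eq)
  have "lev z \<le> lev y" using adm_lev[OF y] eq by (intro lev_le) simp
  moreover have "lev y \<le> lev z" using adm_lev[OF zE] nest[of "lev z"] calculation by (intro lev_le) simp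
  ultimately show "idx z = idx y" using eq by (simp add: idx_def)
qed

lemma W_cell: "R \<in> W \<Longrightarrow> y \<in> dcell R \<Longrightarrow> y \<in> E0 \<and> idx y = R"
  unfolding W_def using dcell_E0 by blast

lemma idx_W: "y \<in> E0 \<Longrightarrow> idx y \<in> W" by (simp add: W_def)

definition corner :: "nat \<times> ('n \<Rightarrow> int) \<Rightarrow> real^'n" where
  "corner R = (\<chi> i. cr $ i + len (fst R) * snd R i)"

lemma ix_corner: "ix m (corner (m, j)) = j"
  by (rule ext) (simp add: ix_iff corner_def algebra_simps)

lemma corner_dcell: "corner R \<in> dcell R"
  using ix_corner[of "fst R" "snd R"] by (simp add: dcell_def)

lemma corner_W: "R \<in> W \<Longrightarrow> corner R \<in> E0 \<and> idx (corner R) = R"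
  using W_cell corner_dcell by blast

lemma W_adm: "R \<in> W \<Longrightarrow> adm (fst R) (snd R)"
  unfolding W_def using adm_lev by (auto simp: idx_def)

lemma W_index: "R \<in> W \<Longrightarrow> i \<noteq> k \<Longrightarrow> 0 \<le> snd R i \<and> snd R i < 2 ^ fst R"
  unfolding W_def using E0_index by (auto simp: idx_def)

lemma W_index_k: "R \<in> W \<Longrightarrow> 0 \<le> snd R k"
  unfolding W_def using ix_k_nonneg by (auto simp: idx_def E0_iff)

definition root :: "nat \<times> ('n \<Rightarrow> int)" where "root = (0, \<lambda>i. 0)"

text \<open>The dilate of the root reaches \<open>3 * L\<close> above the floor and the graph stays
  more than \<open>4 * L\<close> above it.\<close>

lemma adm0: "adm 0 (\<lambda>i. 0)"
  unfolding adm_def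
proof
  fix y assume y: "y \<in> dil 0 (\<lambda>i. 0)"
  have "lat y" by (rule lat_dil_index[OF y]) auto
  then have "cr $ k + 4 * L < \<psi> y" by (rule \<psi>_low)
  moreover have "y $ k \<le> cr $ k + L * 3" using y by (auto simp: dil_def)
  ultimately show "y $ k < \<psi> y" using L by simp
qed

lemma root_W: "root \<in> W"
proof -
  have i: "ix 0 cr = (\<lambda>i. 0)" by (rule ext) (simp add: ix_def)
  have "cr $ k < \<psi> cr" using self_dil[of cr 0] adm0 unfolding adm_def i by blast
  then have "cr \<in> E0" by (simp add: E0_iff i)
  moreover have "lev cr = 0" using lev_le[of 0 cr] adm0 by (simp add: i)
  then have "idx cr = root" by (simp add: idx_def i root_def)
  ultimately show ?thesis using idx_W by force
qed

text \<open>The level 0 cube on the floor covers the whole base and is admissible, so it is the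
  maximal cube of every point at the floor. This makes the root unique.\<close>

lemma W_bottom: assumes R: "R \<in> W" "snd R k = 0" shows "R = root"
proof -
  define y where "y = corner R"
  have y: "y \<in> E0" "idx y = R" using corner_W[OF R(1)] by (auto simp: y_def)
  have "y $ k = cr $ k" using R(2) by (simp add: y_def corner_def)
  then have "ix 0 y k = 0" by (simp add: ix_def)
  then have i: "ix 0 y = (\<lambda>i. 0)" using y(1) by (auto simp: E0_iff)
  then have "lev y = 0" using lev_le[of 0 y] adm0 by simp
  then show ?thesis using y(2) i by (simp add: idx_def root_def)
qed

section \<open>The parent of a maximal cube\<close>

definition below :: "nat \<times> ('n \<Rightarrow> int) \<Rightarrow> real^'n" where
  "below R = corner (fst R, (snd R)(k := snd R k - 1))"

definition par :: "nat \<times> ('n \<Rightarrow> int) \<Rightarrow> nat \<times> ('n \<Rightarrow> int)" where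
  "par R = (if R = root then R else idx (below R))"

text \<open>The neighbour of equal size below \<open>R\<close> is admissible, so its maximal cube is
  at least as large and sits over the dyadic ancestor of the base. The last equation says that the
  top face of the parent is at the height of the bottom face of \<open>R\<close>.\<close>

lemma par_facts:
  assumes R: "R \<in> W" "R \<noteq> root"
  shows "par R \<in> W" "fst (par R) \<le> fst R"
    "i \<noteq> k \<Longrightarrow> snd (par R) i = snd R i div 2 ^ (fst R - fst (par R))"
    "snd R k = 2 ^ (fst R - fst (par R)) * (snd (par R) k + 1)"
proof -
  obtain m j where Rmj: "R = (m, j)" by (cases R)
  define c where "c = corner R"
  define y where "y = below R"
  have jk: "0 < j k" using W_index_k[OF R(1)] W_bottom[OF R(1)] R(2) by (force simp: Rmj)
  have c: "c \<in> E0" "idx c = R" using corner_W[OF R(1)] by (auto simp: c_def)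
  have levc: "lev c = m" "ix m c = j" using c(2) by (auto simp: idx_def Rmj)
  have yi: "ix m y = j(k := j k - 1)" by (simp add: y_def below_def Rmj ix_corner)
  have ylat: "y $ i = c $ i" if "i \<noteq> k" for i using that by (simp add: y_def below_def c_def corner_def Rmj)
  have yk: "y $ k = c $ k - len m" by (simp add: y_def below_def c_def corner_def Rmj algebra_simps)
  have "lat y" using lat_E0[OF c(1)] ylat by (simp add: lat_def)
  then have "\<psi> y = \<psi> c" using lat_E0[OF c(1)] ylat by (intro \<psi>_lat_eq) auto
  moreover have "ix 0 y i = ix 0 c i" if "i \<noteq> k" for i using ylat[OF that] by (simp add: ix_def)
  moreover have "cr $ k \<le> y $ k" using jk ix_k_nonneg[of m y] by (simp add: yi)
  ultimately have yE: "y \<in> E0"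
    using c(1) yk len_pos[of m] by (auto simp: E0_iff simp del: len_pos)
  have "adm m (ix m y)"
    unfolding adm_def
  proof
    fix z assume z: "z \<in> dil m (ix m y)"
    \<comment> \<open>Raising \<open>z\<close> by one side length leads into the dilate of
      \<open>R\<close>, over the same value of the graph function.\<close>
    define z' where "z' = (\<chi> i. if i = k then z $ k + len m else z $ i)"
    have z': "z' \<in> dil m j"
      using z unfolding dil_def yi z'_def by (auto simp: algebra_simps split: if_splits)
    have "lat z" using lat_dil[OF yE z] .
    moreover have "lat z'" using lat_dil[OF c(1), of z' m] z' by (simp add: levc)
    ultimately have "\<psi> z' = \<psi> z" by (intro \<psi>_lat_eq) (auto simp: z'_def)
    moreover have "z' $ k < \<psi> z'" using W_adm[OF R(1)] z' by (auto simp: adm_def Rmj)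
    ultimately show "z $ k < \<psi> z" using len_pos[of m] by (simp add: z'_def del: len_pos)
  qed
  then have lev: "lev y \<le> m" by (rule lev_le)
  have par: "par R = (lev y, ix (lev y) y)" using R(2) by (simp add: par_def idx_def y_def)
  show "par R \<in> W" using idx_W[OF yE] unfolding par idx_def .
  show "fst (par R) \<le> fst R" unfolding par using lev by (simp add: Rmj)
  define a where "a = m - lev y"
  have pi: "ix (lev y) y i = (j(k := j k - 1)) i div 2 ^ a" for i
    using ix_div[OF lev, of y i] by (simp add: yi a_def)
  show "snd (par R) i = snd R i div 2 ^ (fst R - fst (par R))" if "i \<noteq> k" for i
    unfolding par using pi[of i] that by (simp add: Rmj a_def)
  \<comment> \<open>Otherwise the bottom of \<open>R\<close> is not a face of the grid at the
    coarser level, so the coarse admissible cube around \<open>y\<close> contains \<open>R\<close>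
    as well. Maximality of \<open>R\<close> then forces \<open>a = 0\<close>, where divisibility is
    trivial.\<close>
  have dvd: "(2::int) ^ a dvd j k"
  proof (rule ccontr)
    assume nd: "\<not> 2 ^ a dvd j k"
    have "(j k - 1) div 2 ^ a = j k div 2 ^ a"
    proof -
      have "0 < j k mod 2 ^ a" using nd by (metis dvd_eq_mod_eq_0 le_less pos_mod_sign zero_less_numeral zero_less_power)
      moreover have "j k mod 2 ^ a < 2 ^ a" by simp
      moreover have "j k - 1 = 2 ^ a * (j k div 2 ^ a) + (j k mod 2 ^ a - 1)"
        using mult_div_mod_eq[of "2 ^ a" "j k"] by linarith
      ultimately show ?thesis
        by (intro int_div_pos_eq[where r = "j k mod 2 ^ a - 1"]; linarith)
    qed
    then have "ix (lev y) y i = ix (lev y) c i" for i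
      using pi[of i] ix_div[OF lev, of c i] by (auto simp: levc a_def)
    then have "ix (lev y) y = ix (lev y) c" by (rule ext)
    then have "lev c \<le> lev y" using adm_lev[OF yE] by (intro lev_le) simp
    then have "a = 0" by (simp add: levc a_def)
    then show False using nd by simp
  qed
  then obtain t where t: "j k = 2 ^ a * t" by (auto simp: dvd_def)
  have "(j k - 1) div 2 ^ a = t - 1"
    unfolding t by (intro int_div_pos_eq[where r = "2 ^ a - 1"]) (auto simp: algebra_simps)
  then show "snd R k = 2 ^ (fst R - fst (par R)) * (snd (par R) k + 1)"
    unfolding par using pi[of k] t by (simp add: Rmj a_def)
qed

section \<open>Counting maximal cubes in vertical columns\<close>

lemma len_powr: "len m = L * 2 powr - real m"
  by (simp add: len_def powr_minus powr_realpow divide_inverse)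

text \<open>By maximality the next larger grid cube is not admissible, so its dilate reaches the
  graph. The factor 6 is three side lengths of that larger cube.\<close>

lemma W_not_adm:
  assumes "(Suc m, j) \<in> W"
  obtains z where "z \<in> dil m (ix m (corner (Suc m, j)))" "\<psi> z \<le> z $ k" "lat z"
    "\<And>i. \<bar>z $ i - corner (Suc m, j) $ i\<bar> \<le> 6 * len (Suc m)"
proof -
  let ?c = "corner (Suc m, j)"
  have c: "?c \<in> E0" "idx ?c = (Suc m, j)" using corner_W[OF assms] by auto
  have "lev ?c = Suc m" using c(2) by (simp add: idx_def)
  then have "\<not> adm m (ix m ?c)" using lev_le[of m ?c] by auto
  then obtain z where z: "z \<in> dil m (ix m ?c)" "\<psi> z \<le> z $ k" by (auto simp: adm_def not_less)
  moreover have "lat z" using lat_dil[OF c(1) z(1)] .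
  moreover have "\<bar>z $ i - ?c $ i\<bar> \<le> 6 * len (Suc m)" for i
    using dil_near[OF z(1), of i] len_Suc[of m] by linarith
  ultimately show ?thesis by (rule that)
qed

text \<open>\<open>8 + H / L\<close> covers level 0 and the rounding to integers; the last term is
  the oscillation over the distance \<open>6 * len m\<close> in units of \<open>len m\<close>, with
  \<open>2 powr (real m * (1 - \<alpha>))\<close> taken out.\<close>

definition cn :: real where "cn = 8 + H / L + K * 6 powr \<alpha> * L powr (\<alpha> - 1)"

lemma cn_pos: "0 < cn"
  unfolding cn_def using H L K by (intro add_pos_nonneg) auto

text \<open>Cells over one base share the value of the graph function. Their corners lie below it,
  but by \<open>W_not_adm\<close> at most \<open>6 * len m + K * (6 * len m) powr \<alpha>\<close>
  below, which in units of \<open>len m\<close> is an interval of length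
  \<open>6 + e\<close>.\<close>

lemma column_count:
  shows "finite {t. (m, j(k := t)) \<in> W}" (is "finite ?A")
    and "card {t. (m, j(k := t)) \<in> W} \<le> cn * 2 powr (real m * (1 - \<alpha>))"
proof -
  have "finite ?A \<and> card ?A \<le> cn * 2 powr (real m * (1 - \<alpha>))"
  proof (cases "?A = {}")
    case True
    then show ?thesis using cn_pos by simp
  next
    case False
    then obtain t0 where t0: "t0 \<in> ?A" by blast
    define c where "c t = corner (m, j(k := t))" for t
    define b where "b = (\<psi> (c t0) - cr $ k) / len m"
    have cE: "c t \<in> E0" if "t \<in> ?A" for t using corner_W that by (simp add: c_def)
    have \<psi>: "\<psi> (c t) = \<psi> (c t0)" if "t \<in> ?A" for t
      using lat_E0[OF cE[OF that]] lat_E0[OF cE[OF t0]] by (intro \<psi>_lat_eq) (auto simp: c_def corner_def)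
    have ck: "c t $ k = cr $ k + len m * t" for t by (simp add: c_def corner_def)
    have up: "real_of_int t < b" if "t \<in> ?A" for t
    proof -
      have "c t $ k < \<psi> (c t0)" using cE[OF that] \<psi>[OF that] by (simp add: E0_def)
      then show ?thesis unfolding b_def ck by (simp add: pos_less_divide_eq mult.commute algebra_simps)
    qed
    have one: "1 \<le> 2 powr (real m * (1 - \<alpha>))" using \<alpha>_le1 by (simp add: ge_one_powr_ge_zero)
    show ?thesis
    proof (cases m)
      \<comment> \<open>At level 0 there is no larger cube, and the height of the chart bounds the
        count.\<close>
      case 0
      have "b \<le> H / L"
        unfolding b_def using \<psi>_high[OF lat_E0[OF cE[OF t0]]] L 0 by (simp add: divide_right_mono)
      then have sub: "?A \<subseteq> {t::int. 0 \<le> real_of_int t \<and> real_of_int t < H / L}"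
        using up W_index_k[of "(m, j(k := _))"] by force
      have "card ?A \<le> H / L - 0 + 1" "finite ?A"
        using card_int_interval[OF sub] H L by (auto simp: add_nonneg_nonneg)
      moreover have "0 \<le> K * 6 powr \<alpha> * L powr (\<alpha> - 1)" using K by simp
      ultimately show ?thesis by (simp add: cn_def 0)
    next
      case (Suc m')
      define e where "e = K * (6 * len m) powr \<alpha> / len m"
      have e0: "0 \<le> e" using K by (simp add: e_def less_imp_le)
      have lo: "b - 6 - e \<le> real_of_int t" if t: "t \<in> ?A" for t
      proof -
        have tW: "(Suc m', j(k := t)) \<in> W" using t Suc by simp
        obtain z where z: "\<psi> z \<le> z $ k" "lat z" "\<And>i. \<bar>z $ i - c t $ i\<bar> \<le> 6 * len m"
          using W_not_adm[OF tW] unfolding c_def Suc by blast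
        have "\<bar>\<psi> z - \<psi> (c t)\<bar> \<le> K * (6 * len m) powr \<alpha>"
          using z(2,3) lat_E0[OF cE[OF t]] by (intro osc') (auto simp: less_imp_le)
        then have "\<psi> (c t0) \<le> z $ k + K * (6 * len m) powr \<alpha>" using z(1) \<psi>[OF t] by linarith
        moreover have "z $ k \<le> c t $ k + 6 * len m" using z(3)[of k] by linarith
        ultimately have "\<psi> (c t0) - cr $ k \<le> len m * t + 6 * len m + K * (6 * len m) powr \<alpha>"
          by (simp add: ck)
        then have "b \<le> (len m * t + 6 * len m + K * (6 * len m) powr \<alpha>) / len m"
          unfolding b_def by (intro divide_right_mono) (auto simp: less_imp_le)
        also have "\<dots> = t + 6 + e"
          using len_pos[of m] by (simp add: e_def add_divide_distrib del: len_pos)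
        finally show ?thesis by linarith
      qed
      have sub: "?A \<subseteq> {t::int. b - 6 - e \<le> real_of_int t \<and> real_of_int t < b}"
        using lo up by auto
      have "(len m) powr \<alpha> / len m = len m powr (\<alpha> - 1)"
        by (simp add: powr_diff less_imp_le)
      also have "\<dots> = L powr (\<alpha> - 1) * 2 powr (real m * (1 - \<alpha>))"
        by (simp add: len_powr powr_mult powr_powr algebra_simps)
      finally have "e = K * 6 powr \<alpha> * L powr (\<alpha> - 1) * 2 powr (real m * (1 - \<alpha>))"
        unfolding e_def powr_mult by (metis mult.assoc times_divide_eq_right)
      moreover have "card ?A \<le> b - (b - 6 - e) + 1" "finite ?A"
        using card_int_interval[OF sub] e0 by auto
      moreover have "7 \<le> (8 + H / L) * 2 powr (real m * (1 - \<alpha>))"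
      proof -
        have "7 * 1 \<le> (8 + H / L) * 2 powr (real m * (1 - \<alpha>))"
          using H L one by (intro mult_mono) auto
        then show ?thesis by simp
      qed
      ultimately show ?thesis by (simp add: cn_def distrib_right)
    qed
  qed
  then show "finite ?A" "card ?A \<le> cn * 2 powr (real m * (1 - \<alpha>))" by auto
qed

lemma par_root: "par root = root" by (simp add: par_def)

lemma par_in_W: "R \<in> W \<Longrightarrow> par R \<in> W"
  using par_facts(1) par_root by (cases "R = root") auto

lemma par_level: "R \<in> W \<Longrightarrow> fst (par R) \<le> fst R"
  using par_facts(2) par_root by (cases "R = root") auto

lemma ancestor_W: "R \<in> W \<Longrightarrow> (par ^^ n) R \<in> W \<and> fst ((par ^^ n) R) \<le> fst R"
proof (induction n)
  case (Suc n)
  then show ?case using par_in_W[of "(par ^^ n) R"] par_level[of "(par ^^ n) R"] by simp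
qed simp

text \<open>The lateral indices of an ancestor are determined by \<open>R\<close> and the level of
  the ancestor. So all ancestors of one level lie in one vertical column, and
  \<open>column_count\<close> bounds their number.\<close>

lemma ancestor_index:
  assumes R: "R \<in> W" and i: "i \<noteq> k"
  shows "(par ^^ n) R \<in> W \<and> fst ((par ^^ n) R) \<le> fst R
     \<and> snd ((par ^^ n) R) i = snd R i div 2 ^ (fst R - fst ((par ^^ n) R))"
proof (induction n)
  case (Suc n)
  let ?Q = "(par ^^ n) R"
  show ?case
  proof (cases "?Q = root")
    case True
    then show ?thesis using Suc par_root by simp
  next
    case False
    note P = par_facts[OF conjunct1[OF Suc] False]
    have "snd (par ?Q) i = snd R i div 2 ^ (fst R - fst ?Q) div 2 ^ (fst ?Q - fst (par ?Q))"
      using P(3)[OF i] Suc by simp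
    also have "\<dots> = snd R i div (2 ^ (fst R - fst ?Q) * 2 ^ (fst ?Q - fst (par ?Q)))"
      by (rule zdiv_zmult2_eq[symmetric]) simp
    also have "(2::int) ^ (fst R - fst ?Q) * 2 ^ (fst ?Q - fst (par ?Q)) = 2 ^ (fst R - fst (par ?Q))"
      using Suc P(2) by (simp flip: power_add)
    finally show ?thesis using Suc P by simp
  qed
qed (use R in simp)

lemma ancestors_count:
  assumes R: "R \<in> W"
  shows "finite {Q \<in> W. (\<exists>n. (par ^^ n) R = Q) \<and> fst Q = m}" (is "finite ?A")
    and "card {Q \<in> W. (\<exists>n. (par ^^ n) R = Q) \<and> fst Q = m} \<le> cn * 2 powr (real m * (1 - \<alpha>))"
proof -
  define j where "j i = snd R i div 2 ^ (fst R - m)" for i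
  let ?B = "{t. (m, j(k := t)) \<in> W}"
  have sub: "?A \<subseteq> (\<lambda>t. (m, j(k := t))) ` ?B"
  proof
    fix Q assume "Q \<in> ?A"
    then obtain n where n: "Q \<in> W" "(par ^^ n) R = Q" "fst Q = m" by blast
    have "snd Q i = j i" if "i \<noteq> k" for i
      using ancestor_index[OF R that, of n] n by (simp add: j_def)
    then have eq: "Q = (m, j(k := snd Q k))" using n(3) by (intro prod_eqI ext) auto
    have "(m, j(k := snd Q k)) \<in> W" using n(1) by (subst eq[symmetric])
    then show "Q \<in> (\<lambda>t. (m, j(k := t))) ` ?B" by (intro image_eqI[where x = "snd Q k"]) (rule eq, simp)
  qed
  then show "finite ?A" using column_count(1) finite_subset by blast
  have "card ?A \<le> card ((\<lambda>t. (m, j(k := t))) ` ?B)" using sub column_count(1) by (intro card_mono) auto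
  also have "\<dots> \<le> card ?B" using column_count(1) by (rule card_image_le)
  finally have "real (card ?A) \<le> real (card ?B)" by simp
  also have "\<dots> \<le> cn * 2 powr (real m * (1 - \<alpha>))" by (rule column_count(2))
  finally show "card ?A \<le> cn * 2 powr (real m * (1 - \<alpha>))" .
qed

text \<open>The base of \<open>Q\<close> splits into \<open>2 ^ a\<close> parts in each lateral
  direction at level \<open>m\<close>, and every part carries one column counted by
  \<open>column_count\<close>.\<close>

lemma descendants_count:
  assumes Q: "Q \<in> W"
  shows "finite {R \<in> W. (\<exists>n. (par ^^ n) R = Q) \<and> fst R = m}" (is "finite ?A")
    and "card {R \<in> W. (\<exists>n. (par ^^ n) R = Q) \<and> fst R = m}
      \<le> cn * 2 powr ((real m - real (fst Q)) * (real CARD('n) - 1) + real m * (1 - \<alpha>))"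
proof -
  have "finite ?A \<and> card ?A \<le> cn * 2 powr ((real m - real (fst Q)) * (real CARD('n) - 1) + real m * (1 - \<alpha>))"
  proof (cases "fst Q \<le> m")
    case False
    then have e: "?A = {}" using ancestor_W by blast
    show ?thesis unfolding e using cn_pos by simp
  next
    case True
    define a where "a = m - fst Q"
    define B where "B i = {2 ^ a * snd Q i ..< 2 ^ a * snd Q i + 2 ^ a}" for i
    define J where "J = {j::'n \<Rightarrow> int. j k = 0 \<and> (\<forall>i. i \<noteq> k \<longrightarrow> j i \<in> B i)}"
    let ?B = "\<lambda>j. {t. (m, j(k := t)) \<in> W}"
    have B: "finite (B i) \<and> card (B i) \<le> 2 ^ a" for i by (simp add: B_def nat_power_eq)
    have J: "finite J" "card J \<le> (2 ^ a) ^ (CARD('n) - 1)"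
      unfolding J_def using card_lateral[of k B "2 ^ a"] B by auto
    have sub: "?A \<subseteq> (\<Union>j\<in>J. (\<lambda>t. (m, j(k := t))) ` ?B j)"
    proof
      fix R assume "R \<in> ?A"
      then obtain n where n: "R \<in> W" "(par ^^ n) R = Q" "fst R = m" by blast
      have "snd R i \<in> B i" if "i \<noteq> k" for i
        using div_interval[of "2 ^ a" "snd R i" "snd Q i"] ancestor_index[OF n(1) that, of n] n
        by (simp add: B_def a_def)
      then have J': "(snd R)(k := 0) \<in> J" by (simp add: J_def)
      have eq: "R = (m, ((snd R)(k := 0))(k := snd R k))" using n(3) by (intro prod_eqI) auto
      have "(m, ((snd R)(k := 0))(k := snd R k)) \<in> W" using n(1) by (subst eq[symmetric])
      then show "R \<in> (\<Union>j\<in>J. (\<lambda>t. (m, j(k := t))) ` ?B j)"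
        by (intro UN_I[OF J'] image_eqI[where x = "snd R k"]) (rule eq, simp)
    qed
    have fin: "finite (\<Union>j\<in>J. (\<lambda>t. (m, j(k := t))) ` ?B j)"
      using J(1) column_count(1) by blast
    have "card ?A \<le> card (\<Union>j\<in>J. (\<lambda>t. (m, j(k := t))) ` ?B j)" by (rule card_mono[OF fin sub])
    also have "\<dots> \<le> (\<Sum>j\<in>J. card ((\<lambda>t. (m, j(k := t))) ` ?B j))" by (rule card_UN_le[OF J(1)])
    also have "\<dots> \<le> (\<Sum>j\<in>J. card (?B j))" by (intro sum_mono card_image_le column_count)
    finally have "real (card ?A) \<le> (\<Sum>j\<in>J. real (card (?B j)))" by (simp flip: of_nat_sum)
    also have "\<dots> \<le> (\<Sum>j\<in>J. cn * 2 powr (real m * (1 - \<alpha>)))" by (intro sum_mono column_count)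
    also have "\<dots> = real (card J) * (cn * 2 powr (real m * (1 - \<alpha>)))" by simp
    also have "\<dots> \<le> real ((2 ^ a) ^ (CARD('n) - 1)) * (cn * 2 powr (real m * (1 - \<alpha>)))"
      using J(2) cn_pos by (intro mult_right_mono) (simp_all only: of_nat_le_iff, simp)
    also have "real ((2 ^ a) ^ (CARD('n) - 1)) = 2 powr ((real m - real (fst Q)) * (real CARD('n) - 1))"
    proof -
      have "real a = real m - real (fst Q)" using True by (simp add: a_def of_nat_diff)
      moreover have "real (CARD('n) - 1) = real CARD('n) - 1" by (simp add: of_nat_diff Suc_leI)
      moreover have "real ((2 ^ a) ^ N) = 2 powr (real a * real N)" for N
        by (simp add: powr_realpow flip: power_mult of_nat_mult)
      ultimately show ?thesis by metis
    qed
    finally show ?thesis using finite_subset[OF sub fin] by (simp add: powr_add mult_ac)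
  qed
  then show "finite ?A" "card ?A \<le> cn * 2 powr ((real m - real (fst Q)) * (real CARD('n) - 1) + real m * (1 - \<alpha>))"
    by auto
qed

section \<open>Side of a cube against distance to the frontier\<close>

lemma dil_subset: assumes "R \<in> W" shows "dil (fst R) (snd R) \<subseteq> T ` \<Omega>"
proof
  fix z assume z: "z \<in> dil (fst R) (snd R)"
  have lat: "lat z" by (rule lat_dil_index[OF z]) (rule W_index[OF assms])
  have zk: "z $ k < \<psi> z" using W_adm[OF assms] z by (simp add: adm_def)
  have "0 \<le> len (fst R) * snd R k"
    using W_index_k[OF assms] by (intro mult_nonneg_nonneg) (auto simp: less_imp_le)
  moreover have "cr $ k + len (fst R) * (snd R k - 2) \<le> z $ k" using z by (auto simp: dil_def)
  ultimately have "cr $ k - 2 * L \<le> z $ k" using len_le_L[of "fst R"] by (simp add: algebra_simps)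
  moreover have "z $ k \<le> cr $ k + H + 4 * L" using zk \<psi>_high[OF lat] L by linarith
  ultimately show "z \<in> T ` \<Omega>" using graph'[OF lat] zk by blast
qed

text \<open>The opposite corners of the concentric triple of \<open>P\<close>.\<close>

definition lo :: "nat \<times> ('n \<Rightarrow> int) \<Rightarrow> real^'n" where "lo P = (\<chi> i. cr $ i + len (fst P) * (snd P i - 1))"
definition hi :: "nat \<times> ('n \<Rightarrow> int) \<Rightarrow> real^'n" where "hi P = (\<chi> i. cr $ i + len (fst P) * (snd P i + 2))"

lemma in_cbox_lohi:
  assumes "y \<in> cbox (lo P) (hi P)"
  shows "corner P $ i - len (fst P) \<le> y $ i" "y $ i \<le> corner P $ i + 2 * len (fst P)"
  using assms by (auto simp: mem_box_cart lo_def hi_def corner_def algebra_simps)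

lemma dil_corner:
  "y \<in> dil (fst P) (snd P) \<longleftrightarrow> (\<forall>i. corner P $ i - 2 * len (fst P) \<le> y $ i \<and> y $ i \<le> corner P $ i + 3 * len (fst P))"
  by (auto simp: dil_def corner_def algebra_simps)

lemma cbox_dil: "cbox (lo P) (hi P) \<subseteq> dil (fst P) (snd P)"
proof
  fix y assume y: "y \<in> cbox (lo P) (hi P)"
  have "0 < len (fst P)" by simp
  then show "y \<in> dil (fst P) (snd P)"
    unfolding dil_corner using in_cbox_lohi[OF y] by (smt (verit))
qed

lemma T_image: "x \<in> \<Omega> \<longleftrightarrow> T x \<in> T ` \<Omega>"
  using ST by (metis image_eqI imageE)

text \<open>A point outside \<Omega> is mapped outside the dilate, so in some coordinate it differs
  from a point of the triple by the margin.\<close>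

lemma d_lower:
  assumes P: "P \<in> W" and y: "T x \<in> cbox (lo P) (hi P)" shows "len (fst P) \<le> d x"
proof (rule d_ge_dist_frontier)
  fix w assume "w \<notin> \<Omega>"
  then have "T w \<notin> dil (fst P) (snd P)" using dil_subset[OF P] T_image by blast
  then obtain i where "\<not> (corner P $ i - 2 * len (fst P) \<le> T w $ i \<and> T w $ i \<le> corner P $ i + 3 * len (fst P))"
    unfolding dil_corner by blast
  then have "len (fst P) \<le> \<bar>(T x - T w) $ i\<bar>" using in_cbox_lohi[OF y, of i] by auto
  also have "\<dots> \<le> norm (T x - T w)" by (rule component_le_norm_cart)
  finally show "len (fst P) \<le> dist x w" using rigid_motion_dist[OF T, of x w] by (simp add: dist_norm)
qed

text \<open>\<open>W_not_adm\<close> supplies a point at or above the graph, at most 6 sides from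
  the corner in each coordinate, and points of the triple are at most 2 sides from it; this explains
  the 8. At level 0 the bound on \<open>d\<close> over \<Omega> takes over.\<close>

lemma ex_d_upper:
  "\<exists>C>0. \<forall>P\<in>W. \<forall>x\<in>\<Omega>. T x \<in> cbox (lo P) (hi P) \<longrightarrow> d x \<le> C * len (fst P)"
proof -
  obtain D where D: "0 < D" "\<And>x. x \<in> \<Omega> \<Longrightarrow> d x \<le> D" using d_bounded by blast
  define C where "C = D / L + real CARD('n) * 8"
  have C: "0 < C" unfolding C_def using D(1) L by (intro add_pos_nonneg) auto
  have "d x \<le> C * len (fst P)" if P: "P \<in> W" and x: "x \<in> \<Omega>" and y: "T x \<in> cbox (lo P) (hi P)" for P x
  proof (cases P)
    case (Pair m j)
    show ?thesis
    proof (cases m)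
      case 0
      have "d x \<le> D / L * L" using D(2)[OF x] L by simp
      also have "\<dots> \<le> C * L" using L by (intro mult_right_mono) (auto simp: C_def)
      finally show ?thesis by (simp add: Pair 0)
    next
      case (Suc m')
      have PW: "(Suc m', j) \<in> W" using P Pair Suc by simp
      obtain z where z: "\<psi> z \<le> z $ k" "lat z" "\<And>i. \<bar>z $ i - corner P $ i\<bar> \<le> 6 * len m"
        using W_not_adm[OF PW] unfolding Pair Suc by blast
      have c: "corner P \<in> E0" using corner_W P by blast
      \<comment> \<open>Lying above the graph means lying outside the domain only within the
        vertical range of the chart, so the height of \<open>z\<close> is checked first.\<close>
      have "cr $ k - 2 * L \<le> z $ k" using z(1) \<psi>_low[OF z(2)] L by linarith
      moreover have "z $ k \<le> cr $ k + H + 4 * L"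
      proof -
        have "6 * len m \<le> 3 * L" using len_le_L[of m'] len_Suc[of m'] unfolding Suc by linarith
        moreover have "corner P $ k < cr $ k + H" using c \<psi>_high[OF lat_E0[OF c]] by (simp add: E0_def)
        ultimately show ?thesis using z(3)[of k] L by linarith
      qed
      ultimately have "z \<notin> T ` \<Omega>" using graph'[OF z(2)] z(1) by simp
      then have "S z \<notin> \<Omega>" using T_image[of "S z"] TS by simp
      then have "d x \<le> dist x (S z)" by (rule d_le_dist_outside[OF x])
      also have "\<dots> = norm (T x - z)" using rigid_motion_dist[OF T, of x "S z"] by (simp add: TS dist_norm)
      also have "\<dots> \<le> (\<Sum>i\<in>UNIV. \<bar>(T x - z) $ i\<bar>)" by (rule norm_le_l1_cart)
      also have "\<dots> \<le> (\<Sum>i\<in>(UNIV::'n set). 8 * len m)"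
      proof (rule sum_mono)
        fix i
        have "0 < len m" by simp
        then show "\<bar>(T x - z) $ i\<bar> \<le> 8 * len m"
          using z(3)[of i] in_cbox_lohi[OF y, of i] by (simp add: Pair)
      qed
      also have "\<dots> = real CARD('n) * 8 * len m" by simp
      also have "\<dots> \<le> C * len m" using D(1) L by (intro mult_right_mono) (auto simp: C_def less_imp_le)
      finally show ?thesis by (simp add: Pair)
    qed
  qed
  then show ?thesis using C by blast
qed

section \<open>Cells and cubes in the original coordinates\<close>

definition cell :: "nat \<times> ('n \<Rightarrow> int) \<Rightarrow> (real^'n) set" where "cell R = T -` dcell R"

text \<open>The triple of the parent, not of \<open>R\<close>: it has to contain both cells on which
  the piece of \<open>R\<close> lives.\<close>

definition cube :: "nat \<times> ('n \<Rightarrow> int) \<Rightarrow> (real^'n) set" where "cube R = T -` box (lo (par R)) (hi (par R))"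

lemma dcell_bounds:
  "y \<in> dcell R \<longleftrightarrow> (\<forall>i. corner R $ i \<le> y $ i \<and> y $ i < corner R $ i + len (fst R))"
  unfolding dcell_def fun_eq_iff mem_Collect_eq ix_iff by (auto simp: corner_def algebra_simps)

lemma E0_subset: "E0 \<subseteq> T ` \<Omega>"
proof
  fix y assume y: "y \<in> E0"
  have "y \<in> dil (fst (idx y)) (snd (idx y))" using self_dil by (simp add: idx_def)
  then show "y \<in> T ` \<Omega>" using dil_subset[OF idx_W[OF y]] by blast
qed

lemma cell_\<Omega>: "R \<in> W \<Longrightarrow> cell R \<subseteq> \<Omega>"
  using W_cell E0_subset T_image unfolding cell_def by blast

lemma cell_sets: assumes "R \<in> W" shows "cell R \<in> sets \<mu>"
proof -
  have eq: "cell R = (\<Inter>i. {x. corner R $ i \<le> T x $ i} \<inter> {x. T x $ i < corner R $ i + len (fst R)})"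
    unfolding cell_def by (auto simp: dcell_bounds)
  have c: "continuous_on UNIV (\<lambda>x. T x $ i)" for i
    by (intro continuous_intros rigid_motion_continuous[OF T])
  have "cell R \<in> sets borel"
    unfolding eq
    by (intro sets.finite_INT sets.Int borel_closed borel_open closed_Collect_le open_Collect_less
        continuous_on_const c) auto
  then show ?thesis using cell_\<Omega>[OF assms] by (simp add: sets_\<mu>)
qed

lemma cell_lmeasurable: "R \<in> W \<Longrightarrow> cell R \<in> lmeasurable"
  using cell_sets bounded_subset[OF bounded_dom cell_\<Omega>]
  by (intro bounded_set_imp_lmeasurable) (auto simp: sets_\<mu>)

text \<open>Comparison with an inscribed ball, and in \<open>measure_cell_le\<close> with a
  circumscribed one: rigid motions carry balls to balls, and only the order of magnitude
  matters.\<close>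

lemma measure_cell_ge:
  assumes "R \<in> W" shows "unit_ball_vol CARD('n) * (len (fst R) / 2) ^ CARD('n) \<le> measure lebesgue (cell R)"
proof -
  define z where "z = corner R + (\<chi> i. len (fst R) / 2)"
  have "ball (S z) (len (fst R) / 2) \<subseteq> cell R"
  proof
    fix x assume "x \<in> ball (S z) (len (fst R) / 2)"
    then have "dist z (T x) < len (fst R) / 2" using rigid_motion_dist[OF T, of "S z" x] by (simp add: TS)
    then have "\<bar>(z - T x) $ i\<bar> < len (fst R) / 2" for i
      using component_le_norm_cart[of "z - T x" i] by (simp add: dist_norm)
    then have "corner R $ i \<le> T x $ i \<and> T x $ i < corner R $ i + len (fst R)" for i
      by (simp add: z_def) (smt (verit) field_sum_of_halves)
    then show "x \<in> cell R" unfolding cell_def by (simp add: dcell_bounds)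
  qed
  then have "measure lebesgue (ball (S z) (len (fst R) / 2)) \<le> measure lebesgue (cell R)"
    using cell_lmeasurable[OF assms] by (intro measure_mono_fmeasurable) auto
  then show ?thesis by (simp add: content_ball less_imp_le)
qed

lemma measure_cell_le:
  assumes "R \<in> W" shows "measure lebesgue (cell R) \<le> unit_ball_vol CARD('n) * (real CARD('n) * len (fst R)) ^ CARD('n)"
proof -
  have "cell R \<subseteq> cball (S (corner R)) (real CARD('n) * len (fst R))"
  proof
    fix x assume "x \<in> cell R"
    then have *: "corner R $ i \<le> T x $ i \<and> T x $ i < corner R $ i + len (fst R)" for i
      unfolding cell_def by (simp add: dcell_bounds)
    have "dist (S (corner R)) x = norm (corner R - T x)"
      using rigid_motion_dist[OF T, of "S (corner R)" x] by (simp add: TS dist_norm)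
    also have "\<dots> \<le> (\<Sum>i\<in>UNIV. \<bar>(corner R - T x) $ i\<bar>)" by (rule norm_le_l1_cart)
    also have "\<dots> \<le> (\<Sum>i\<in>(UNIV::'n set). len (fst R))"
      using * by (intro sum_mono) (simp add: abs_le_iff, smt (verit))
    finally show "x \<in> cball (S (corner R)) (real CARD('n) * len (fst R))" by simp
  qed
  then have "measure lebesgue (cell R) \<le> measure lebesgue (cball (S (corner R)) (real CARD('n) * len (fst R)))"
    using cell_lmeasurable[OF assms] by (intro measure_mono_fmeasurable) auto
  then show ?thesis by (simp add: content_cball less_imp_le)
qed

lemma cube_open_cube: "open_cube (cube R)"
  unfolding open_cube_def
proof (intro exI conjI)
  show "rigid_motion S" by (rule S)
  show "0 < 3 * len (fst (par R))" by simp
  show "\<forall>i. hi (par R) $ i - lo (par R) $ i = 3 * len (fst (par R))"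
    by (simp add: lo_def hi_def algebra_simps)
  show "cube R = S ` box (lo (par R)) (hi (par R))"
    unfolding cube_def using rigid_motion_image_vimage[OF TS ST] by simp
qed

lemma closure_cube: assumes "R \<in> W" shows "closure (cube R) \<subseteq> T -` cbox (lo (par R)) (hi (par R))" "closure (cube R) \<subseteq> \<Omega>"
proof -
  have "closed (T -` cbox (lo (par R)) (hi (par R)))"
    by (intro closed_vimage closed_cbox rigid_motion_continuous T)
  moreover have "cube R \<subseteq> T -` cbox (lo (par R)) (hi (par R))"
    unfolding cube_def using box_subset_cbox by blast
  ultimately show *: "closure (cube R) \<subseteq> T -` cbox (lo (par R)) (hi (par R))" by (intro closure_minimal)
  then show "closure (cube R) \<subseteq> \<Omega>"
    using cbox_dil dil_subset[OF par_in_W[OF assms]] T_image by blast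
qed

lemma dcell_box: "dcell R \<subseteq> box (lo R) (hi R)"
proof
  fix y assume y: "y \<in> dcell R"
  show "y \<in> box (lo R) (hi R)"
    unfolding mem_box_cart
  proof
    fix i
    have "0 < len (fst R)" by simp
    moreover have "lo R $ i = corner R $ i - len (fst R)" "hi R $ i = corner R $ i + 2 * len (fst R)"
      by (auto simp: lo_def hi_def corner_def algebra_simps)
    moreover have "corner R $ i \<le> y $ i" "y $ i < corner R $ i + len (fst R)" using y by (auto simp: dcell_bounds)
    ultimately show "lo R $ i < y $ i \<and> y $ i < hi R $ i" by linarith
  qed
qed

lemma cell_par_cube: "cell (par R) \<subseteq> cube R"
  unfolding cell_def cube_def using dcell_box by blast

text \<open>\<open>R\<close> stands on top of its parent, within the base of the parent, and is no
  larger, so it stays within one side of the parent.\<close>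

lemma cell_cube: assumes R: "R \<in> W" shows "cell R \<subseteq> cube R"
proof (cases "R = root")
  case True
  then show ?thesis using cell_par_cube[of R] by (simp add: par_root)
next
  case False
  note P = par_facts[OF R False]
  define a where "a = fst R - fst (par R)"
  define l where "l = len (fst R)"
  define l' where "l' = len (fst (par R))"
  have ll: "0 < l" "0 < l'" "l \<le> l'" "l' = 2 ^ a * l"
    using len_mono[OF P(2)] len_diff[OF P(2)] by (auto simp: l_def l'_def a_def)
  have "dcell R \<subseteq> box (lo (par R)) (hi (par R))"
  proof
    fix y assume y: "y \<in> dcell R"
    show "y \<in> box (lo (par R)) (hi (par R))"
      unfolding mem_box_cart
    proof
      fix i
      have yi: "corner R $ i \<le> y $ i" "y $ i < corner R $ i + l" using y by (auto simp: dcell_bounds l_def)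
      have lohi: "lo (par R) $ i = corner (par R) $ i - l'" "hi (par R) $ i = corner (par R) $ i + 2 * l'"
        by (auto simp: lo_def hi_def corner_def l'_def algebra_simps)
      have "corner (par R) $ i \<le> corner R $ i \<and> corner R $ i \<le> corner (par R) $ i + l'"
      proof (cases "i = k")
        case True
        have "l * snd R k = l' * (snd (par R) k + 1)"
          using P(4) ll(4) by (simp add: a_def)
        then have "corner R $ k = corner (par R) $ k + l'"
          by (simp add: corner_def l_def[symmetric] l'_def[symmetric] distrib_left)
        then show ?thesis using True ll by simp
      next
        case False
        have "snd R i \<in> {2 ^ a * snd (par R) i ..< 2 ^ a * snd (par R) i + 2 ^ a}"
          by (rule div_interval) (use P(3)[OF False] in \<open>auto simp: a_def\<close>)
        then have "2 ^ a * snd (par R) i \<le> snd R i" "snd R i \<le> 2 ^ a * snd (par R) i + 2 ^ a" by auto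
        then have "real_of_int (2 ^ a * snd (par R) i) \<le> real_of_int (snd R i)"
          "real_of_int (snd R i) \<le> real_of_int (2 ^ a * snd (par R) i + 2 ^ a)" by (simp_all only: of_int_le_iff)
        then have "l * (2 ^ a * snd (par R) i) \<le> l * snd R i" "l * snd R i \<le> l * (2 ^ a * snd (par R) i + 2 ^ a)"
          using ll(1) by (auto intro!: mult_left_mono)
        then show ?thesis
          by (simp add: corner_def l_def[symmetric] l'_def[symmetric] ll(4) algebra_simps)
      qed
      then show "lo (par R) $ i < y $ i \<and> y $ i < hi (par R) $ i"
        using yi lohi ll by linarith
    qed
  qed
  then show ?thesis unfolding cell_def cube_def by blast
qed

theorem transportable_chart:
  "\<exists>Q. open_cube Q \<and> closure Q \<subseteq> \<Omega> \<and> Q \<noteq> {} \<and> transportable (T -` E0) (bump Q)"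
proof -
  obtain C where C: "0 < C" "\<And>P x. P \<in> W \<Longrightarrow> x \<in> \<Omega> \<Longrightarrow> T x \<in> cbox (lo P) (hi P) \<Longrightarrow> d x \<le> C * len (fst P)"
    using ex_d_upper by blast
  have Tcube: "T x \<in> cbox (lo (par R)) (hi (par R)) \<and> x \<in> \<Omega>" if "R \<in> W" "x \<in> cube R" for R x
    using closure_cube[OF that(1)] that(2) closure_subset by blast
  \<comment> \<open>The height function is the vertical index of a cube in units of its own side; by
    the last part of \<open>par_facts\<close> it drops strictly towards the parent, also when the
    size changes.\<close>
  interpret tree: whitney_tree \<Omega> p q \<alpha> \<beta> W cell cube par root fst "\<lambda>R. nat (snd R k)"
    "unit_ball_vol CARD('n) * (L / 2) ^ CARD('n)" "unit_ball_vol CARD('n) * (real CARD('n) * L) ^ CARD('n)"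
    L "C * C * L" cn
  proof
    fix R assume R: "R \<in> W"
    show "cell R \<in> sets \<mu>" by (rule cell_sets[OF R])
    show "cell R \<subseteq> cube R" by (rule cell_cube[OF R])
    show "cell (par R) \<subseteq> cube R" by (rule cell_par_cube)
    have pw: "(2 powr - real (fst R)) powr real CARD('n) = (2 powr - real (fst R)) ^ CARD('n)"
      by (simp add: powr_realpow)
    show "unit_ball_vol CARD('n) * (L / 2) ^ CARD('n) * (2 powr - real (fst R)) powr real CARD('n) \<le> measure lebesgue (cell R)"
      using measure_cell_ge[OF R] unfolding pw len_powr
      by (simp add: power_mult_distrib power_divide mult_ac)
    show "measure lebesgue (cell R) \<le> unit_ball_vol CARD('n) * (real CARD('n) * L) ^ CARD('n) * (2 powr - real (fst R)) powr real CARD('n)"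
      using measure_cell_le[OF R] unfolding pw len_powr
      by (simp add: power_mult_distrib mult_ac)
    show "open_cube (cube R)" by (rule cube_open_cube)
    show "closure (cube R) \<subseteq> \<Omega>" by (rule closure_cube(2)[OF R])
    show "par R \<in> W" by (rule par_in_W[OF R])
    show lev: "fst (par R) \<le> fst R" by (rule par_level[OF R])
    show "L * 2 powr - real (fst R) \<le> d x" if "x \<in> cube R" for x
    proof -
      have "len (fst R) \<le> len (fst (par R))" using lev by (rule len_mono)
      also have "\<dots> \<le> d x" using d_lower[OF par_in_W[OF R]] Tcube[OF R that] by blast
      finally show ?thesis by (simp add: len_powr)
    qed
    \<comment> \<open>\<open>d\<close> on the cube is at most \<open>C\<close> times the side of the
      parent. That side is at most \<open>d\<close> at the corner of \<open>R\<close>, which also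
      lies in the cube, and so at most \<open>C\<close> times the side of \<open>R\<close>.\<close>
    show "d x \<le> C * C * L * 2 powr - real (fst R)" if "x \<in> cube R" for x
    proof -
      have c: "S (corner R) \<in> cell R" unfolding cell_def using corner_dcell by (simp add: TS)
      then have "len (fst (par R)) \<le> d (S (corner R))"
        using d_lower[OF par_in_W[OF R]] Tcube[OF R] cell_cube[OF R] by blast
      also have "\<dots> \<le> C * len (fst R)"
        using c cell_\<Omega>[OF R] dcell_box[of R] box_subset_cbox[of "lo R" "hi R"] corner_dcell[of R]
        by (intro C(2)[OF R]) (auto simp: TS)
      finally have "C * len (fst (par R)) \<le> C * (C * len (fst R))" using C(1) by (intro mult_left_mono) auto
      moreover have "d x \<le> C * len (fst (par R))" using C(2)[OF par_in_W[OF R]] Tcube[OF R that] by blast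
      ultimately show ?thesis by (simp add: len_powr mult.assoc)
    qed
    show "nat (snd (par R) k) < nat (snd R k)" if "R \<noteq> root"
    proof -
      note P = par_facts[OF R that]
      have 0: "0 \<le> snd (par R) k" by (rule W_index_k[OF P(1)])
      have "1 * (snd (par R) k + 1) \<le> 2 ^ (fst R - fst (par R)) * (snd (par R) k + 1)"
        using 0 by (intro mult_right_mono) auto
      then have "snd (par R) k + 1 \<le> snd R k" unfolding P(4) by simp
      then show ?thesis using 0 by linarith
    qed
    show "finite {Q \<in> W. (\<exists>n. (par ^^ n) R = Q) \<and> fst Q = m}" for m
      by (rule ancestors_count[OF R])
    show "card {Q \<in> W. (\<exists>n. (par ^^ n) R = Q) \<and> fst Q = m} \<le> cn * 2 powr (real m * (1 - \<alpha>))" for m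
      by (rule ancestors_count[OF R])
    show "finite {Q \<in> W. (\<exists>n. (par ^^ n) Q = R) \<and> fst Q = m}" for m
      by (rule descendants_count[OF R])
    show "card {Q \<in> W. (\<exists>n. (par ^^ n) Q = R) \<and> fst Q = m}
      \<le> cn * 2 powr ((real m - real (fst R)) * (real CARD('n) - 1) + real m * (1 - \<alpha>))" for m
      by (rule descendants_count[OF R])
    show "cell R \<inter> cell Q = {}" if "Q \<in> W" "R \<noteq> Q" for Q
      using W_cell[OF R] W_cell[OF that(1)] that(2) unfolding cell_def by blast
  qed (use L C(1) cn_pos root_W par_root in auto)
  have "tree.col root = T -` E0"
  proof -
    have "tree.col root = (\<Union>R\<in>W. cell R)" unfolding tree.col_def using tree.desc_root by blast
    also have "\<dots> = T -` E0"
      unfolding cell_def using W_cell idx_W in_dcell_idx by blast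
    finally show ?thesis .
  qed
  then have tr: "transportable (T -` E0) (bump (cell root))" using tree.transportable_tree by simp
  have sub: "cube root \<subseteq> \<Omega>" using closure_cube(2)[OF root_W] closure_subset by blast
  have ne: "cube root \<noteq> {}" using cell_cube[OF root_W] corner_dcell[of root] TS unfolding cell_def by blast
  note m = cube_measure_pos[OF open_cube_open_bounded(1)[OF cube_open_cube] ne sub]
  \<comment> \<open>The root cell is half-open; handing the mass to an open cube prepares it for
    \<open>linked_any_cubes\<close>.\<close>
  have "linked (bump (cell root)) (bump (cube root))"
    by (rule linked_bump[OF cube_open_cube closure_cube(2)[OF root_W]])
       (use m cell_sets[OF root_W] cell_cube[OF root_W] tree.measure_cell_pos[OF root_W] in auto)
  then have "transportable (T -` E0) (bump (cube root))" using transportable_linked[OF tr] by blast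
  then show ?thesis using cube_open_cube closure_cube(2)[OF root_W] ne by blast
qed

end

section \<open>Balls are smooth domains\<close>

lemma frechet_derivative_cong_open:
  assumes "open S" "x \<in> S" "\<And>y. y \<in> S \<Longrightarrow> f y = g y" "f differentiable (at x)"
  shows "g differentiable (at x)" "frechet_derivative g (at x) = frechet_derivative f (at x)"
proof -
  have "(f has_derivative frechet_derivative f (at x)) (at x)"
    using assms(4) frechet_derivative_works by blast
  then have g: "(g has_derivative frechet_derivative f (at x)) (at x)"
    by (rule has_derivative_transform_within_open[OF _ assms(1,2)]) (use assms(3) in auto)
  then show "g differentiable (at x)" by (auto simp: differentiable_def)
  show "frechet_derivative g (at x) = frechet_derivative f (at x)"
    using frechet_derivative_at[OF g] by simp
qed

lemma Ck_on_cong: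
  assumes S: "open S" and "Ck_on m S f" "\<And>y. y \<in> S \<Longrightarrow> f y = g y"
  shows "Ck_on m S g"
  using assms(2,3)
proof (induction m arbitrary: f g)
  case 0
  then show ?case using continuous_on_cong[of S S f g] by simp
next
  case (Suc m)
  have d: "f differentiable (at x)" if "x \<in> S" for x using Suc.prems(1) that by simp
  have "g differentiable (at x)" if "x \<in> S" for x
    by (rule frechet_derivative_cong_open(1)[OF S that Suc.prems(2) d[OF that]])
  moreover have "Ck_on m S (\<lambda>x. frechet_derivative g (at x) (axis i 1))" for i
  proof (rule Suc.IH)
    show "Ck_on m S (\<lambda>x. frechet_derivative f (at x) (axis i 1))" using Suc.prems(1) by simp
    show "frechet_derivative f (at y) (axis i 1) = frechet_derivative g (at y) (axis i 1)" if "y \<in> S" for y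
      using frechet_derivative_cong_open(2)[OF S that Suc.prems(2) d[OF that]] by simp
  qed
  ultimately show ?case by simp
qed

text \<open>Replaces \<open>frechet_derivative\<close> by any explicit formula that is valid on
  \<open>S\<close>, so that the closure properties follow from the usual differentiation
  rules.\<close>

lemma Ck_on_SucI:
  assumes S: "open S" and D: "\<And>x. x \<in> S \<Longrightarrow> (f has_derivative D x) (at x)"
    and "\<And>i. Ck_on m S (\<lambda>x. D x (axis i 1))"
  shows "Ck_on (Suc m) S f"
proof -
  have "Ck_on m S (\<lambda>x. frechet_derivative f (at x) (axis i 1))" for i
    by (rule Ck_on_cong[OF S assms(3)]) (simp add: frechet_derivative_at[OF D])
  then show ?thesis using D by (auto simp: differentiable_def)
qed

lemma Ck_on_Suc_derivative:
  "Ck_on (Suc m) S f \<Longrightarrow> x \<in> S \<Longrightarrow> (f has_derivative frechet_derivative f (at x)) (at x)"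
  using frechet_derivative_works by auto

lemma Ck_on_Suc_imp: "Ck_on (Suc m) S f \<Longrightarrow> Ck_on m S f"
proof (induction m arbitrary: f)
  case 0
  then have "f differentiable_on S" by (auto simp: differentiable_on_def intro: differentiable_at_withinI)
  then show ?case by (simp add: differentiable_imp_continuous_on)
next
  case (Suc m)
  then show ?case by (metis Ck_on.simps(2))
qed

lemma Ck_on_const: "Ck_on m S (\<lambda>x. c)"
  by (induction m arbitrary: c) auto

lemma Ck_on_add:
  assumes S: "open S" shows "Ck_on m S f \<Longrightarrow> Ck_on m S g \<Longrightarrow> Ck_on m S (\<lambda>x. f x + g x)"
proof (induction m arbitrary: f g)
  case 0
  then show ?case by (auto intro: continuous_intros)
next
  case (Suc m)
  show ?case
    by (rule Ck_on_SucI[OF S has_derivative_add[OF Ck_on_Suc_derivative[OF Suc.prems(1)]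
            Ck_on_Suc_derivative[OF Suc.prems(2)]]])
       (use Suc.IH Suc.prems in auto)
qed

lemma Ck_on_mult:
  assumes S: "open S" shows "Ck_on m S f \<Longrightarrow> Ck_on m S g \<Longrightarrow> Ck_on m S (\<lambda>x. f x * g x)"
proof (induction m arbitrary: f g)
  case 0
  then show ?case by (auto intro: continuous_intros)
next
  case (Suc m)
  note fg = Ck_on_Suc_imp[OF Suc.prems(1)] Ck_on_Suc_imp[OF Suc.prems(2)]
  show ?case
    by (rule Ck_on_SucI[OF S has_derivative_mult[OF Ck_on_Suc_derivative[OF Suc.prems(1)]
            Ck_on_Suc_derivative[OF Suc.prems(2)]]])
       (use Suc.IH Suc.prems fg in \<open>auto intro!: Ck_on_add[OF S]\<close>)
qed

lemma Ck_on_coord: "open S \<Longrightarrow> Ck_on m S (\<lambda>x. x $ i)"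
proof (induction m)
  case 0
  then show ?case by (auto intro: continuous_intros)
next
  case (Suc m)
  show ?case
    by (rule Ck_on_SucI[OF Suc.prems, where D = "\<lambda>x h. h $ i"])
       (auto intro!: bounded_linear_imp_has_derivative bounded_linear_vec_nth Ck_on_const)
qed

lemma Ck_on_sum:
  assumes "open S" "finite A" "\<And>i. i \<in> A \<Longrightarrow> Ck_on m S (f i)" shows "Ck_on m S (\<lambda>x. \<Sum>i\<in>A. f i x)"
  using assms(2,3)
  by (induction A rule: finite_induct) (auto intro: Ck_on_const Ck_on_add[OF assms(1)])

text \<open>Differentiation lowers the exponent by one, so the induction runs over all exponents at
  once; the square root is the case \<open>a = 1 / 2\<close>.\<close>

lemma Ck_on_powr:
  assumes S: "open S" and u: "\<And>m. Ck_on m S u" and pos: "\<And>x. x \<in> S \<Longrightarrow> 0 < u x"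
  shows "Ck_on m S (\<lambda>x. u x powr a)"
proof (induction m arbitrary: a)
  case 0
  have "continuous_on S u" using u[of 0] by simp
  then show ?case using pos by (force intro!: continuous_on_powr continuous_on_const)
next
  case (Suc m)
  let ?D = "\<lambda>x h. a * u x powr (a - 1) * frechet_derivative u (at x) h"
  show ?case
  proof (rule Ck_on_SucI[OF S, where D = ?D])
    fix x assume x: "x \<in> S"
    have "((\<lambda>x. u x powr a) has_derivative (\<lambda>h. u x powr a * (0 * ln (u x) + frechet_derivative u (at x) h * a / u x))) (at x)"
      using has_derivative_powr[OF Ck_on_Suc_derivative[OF u x] has_derivative_const[of a] pos[OF x]] by simp
    moreover have "(\<lambda>h. u x powr a * (0 * ln (u x) + frechet_derivative u (at x) h * a / u x)) = ?D x"
      using pos[OF x] by (auto simp: powr_diff)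
    ultimately show "((\<lambda>x. u x powr a) has_derivative ?D x) (at x)" by simp
  next
    fix i
    have "Ck_on m S (\<lambda>x. frechet_derivative u (at x) (axis i 1))" using u[of "Suc m"] by simp
    then show "Ck_on m S (\<lambda>x. ?D x (axis i 1))"
      by (intro Ck_on_mult[OF S] Ck_on_const Suc.IH)
  qed
qed

section \<open>The sphere as a smooth graph\<close>

lemma norm_base_point_sq: "(norm x)\<^sup>2 = (norm (base_point k x))\<^sup>2 + (x $ k)\<^sup>2" for x :: "real^'n::finite"
proof -
  have "(norm x)\<^sup>2 = (\<Sum>i\<in>UNIV. (x $ i)\<^sup>2)"
    by (simp add: norm_vec_def L2_set_def sum_nonneg)
  also have "\<dots> = (\<Sum>i\<in>UNIV - {k}. (x $ i)\<^sup>2) + (x $ k)\<^sup>2"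
    by (subst sum.remove[of UNIV k]) auto
  also have "(\<Sum>i\<in>UNIV - {k}. (x $ i)\<^sup>2) = (\<Sum>i\<in>UNIV. (base_point k x $ i)\<^sup>2)"
    by (subst sum.remove[of UNIV k "\<lambda>i. (base_point k x $ i)\<^sup>2"]) (auto simp: base_point_def intro!: sum.cong)
  also have "\<dots> = (norm (base_point k x))\<^sup>2"
    by (simp add: norm_vec_def L2_set_def sum_nonneg)
  finally show ?thesis .
qed

text \<open>Under the root stands a polynomial in the lateral coordinates which is positive on
  \<open>B\<close>.\<close>

lemma smooth_graph_hemisphere:
  fixes B :: "(real^'n::finite) set"
  assumes "open B" "\<And>x. x \<in> B \<Longrightarrow> norm (base_point k x) < r"
  shows "smooth_graph k B (\<lambda>x. sqrt (r\<^sup>2 - (norm x)\<^sup>2))"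
  unfolding smooth_graph_def
proof
  fix m
  define u where "u x = r\<^sup>2 + (-1) * (\<Sum>i\<in>UNIV - {k}. x $ i * x $ i)" for x :: "real^'n"
  have u: "u x = r\<^sup>2 - (norm (base_point k x))\<^sup>2" for x
  proof -
    have "(norm x)\<^sup>2 = (\<Sum>i\<in>UNIV. (x $ i)\<^sup>2)"
      by (simp add: norm_vec_def L2_set_def sum_nonneg)
    also have "\<dots> = (\<Sum>i\<in>UNIV - {k}. x $ i * x $ i) + (x $ k)\<^sup>2"
      by (subst sum.remove[of UNIV k]) (auto simp: power2_eq_square)
    finally show ?thesis using norm_base_point_sq[of x k] by (simp add: u_def)
  qed
  have pos: "0 < u x" if "x \<in> B" for x
    using assms(2)[OF that] by (simp add: u power_strict_mono)
  have "Ck_on m B u" for m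
    unfolding u_def[abs_def]
    by (intro Ck_on_add Ck_on_mult Ck_on_const Ck_on_sum Ck_on_coord assms(1) finite)
  then have "Ck_on m B (\<lambda>x. u x powr (1 / 2))"
    by (rule Ck_on_powr[OF assms(1) _ pos])
  then show "Ck_on m B (\<lambda>x. sqrt (r\<^sup>2 - (norm (base_point k x))\<^sup>2))"
    by (rule Ck_on_cong[OF assms(1)]) (use pos in \<open>auto simp: powr_half_sqrt less_imp_le simp flip: u\<close>)
qed

text \<open>Some coordinate \<open>k\<close> of \<open>z - c\<close> is nonzero; centring at
  \<open>c\<close> and multiplying by its sign puts the boundary point on the open upper hemisphere.
  Near it \<open>x $ k\<close> is positive, so squares can be compared instead of roots.\<close>

lemma smooth_domain_ball:
  fixes c :: "real^'n::finite"
  assumes r: "0 < r" shows "smooth_domain (ball c r)"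
proof -
  have "\<exists>T k a b \<phi>. rigid_motion T \<and> T z \<in> box a b \<and> smooth_graph k (box a b) \<phi> \<and>
        T ` ball c r \<inter> box a b = {x \<in> box a b. x $ k < \<phi> (base_point k x)}"
    if z: "z \<in> frontier (ball c r)" for z
  proof -
    have zr: "norm (z - c) = r" using z r by (simp add: dist_norm norm_minus_commute)
    then have "z - c \<noteq> 0" using r by auto
    then obtain k where k: "(z - c) $ k \<noteq> 0" by (auto simp: vec_eq_iff)
    define s where "s = sgn ((z - c) $ k)"
    have s: "\<bar>s\<bar> = 1" "s * s = 1" using k by (auto simp: s_def sgn_if)
    define T where "T = (\<lambda>x. - s *\<^sub>R c + s *\<^sub>R x)"
    have "orthogonal_transformation (\<lambda>x. s *\<^sub>R x)" 
      unfolding orthogonal_transformation using s(1) by (auto intro!: linear_scaleR)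
    then have T: "rigid_motion T" unfolding rigid_motion_def T_def by blast
    have TT: "T x = s *\<^sub>R (x - c)" for x by (simp add: T_def algebra_simps)
    define y where "y = T z"
    have "y $ k = (z - c) $ k * sgn ((z - c) $ k)" by (simp add: y_def TT s_def mult.commute)
    also have "\<dots> = \<bar>(z - c) $ k\<bar>" by (rule abs_sgn[symmetric])
    finally have yk: "0 < y $ k" using k by linarith
    have yr: "norm y = r" using zr s(1) by (simp add: y_def TT)
    have "(norm (base_point k y))\<^sup>2 < r\<^sup>2" using norm_base_point_sq[of y k] yk by (simp add: yr)
    then have yb: "norm (base_point k y) < r" using r by (simp add: power2_less_imp_less)
    define A where "A = {x :: real^'n. 0 < x $ k \<and> norm (base_point k x) < r}"
    have "continuous_on UNIV (\<lambda>x::real^'n. if i = k then 0 else x $ i)" for i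
      by (cases "i = k") (auto intro!: continuous_intros)
    then have cb: "continuous_on UNIV (base_point k :: real^'n \<Rightarrow> real^'n)"
      unfolding base_point_def[abs_def]
      by (rule continuous_on_vec_lambda)
    have "open A"
      unfolding A_def Collect_conj_eq
      by (intro open_Int open_Collect_less continuous_intros cb)
    moreover have "y \<in> A" using yk yb by (simp add: A_def)
    ultimately obtain e where e: "0 < e" "\<And>x. (\<And>i. \<bar>x $ i - y $ i\<bar> \<le> e) \<Longrightarrow> x \<in> A"
      using open_contains_axis_cbox by blast
    define B where "B = box (y - (\<chi> i. e)) (y + (\<chi> i. e))"
    have BA: "B \<subseteq> A"
    proof
      fix x assume "x \<in> B"
      then have "\<bar>x $ i - y $ i\<bar> \<le> e" for i
        unfolding B_def mem_box_cart by (simp add: abs_le_iff) (smt (verit))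
      then show "x \<in> A" by (rule e(2))
    qed
    have img: "x \<in> T ` ball c r \<longleftrightarrow> norm x < r" for x
    proof
      assume "x \<in> T ` ball c r"
      then show "norm x < r" using s(1) by (auto simp: TT dist_norm norm_minus_commute)
    next
      assume "norm x < r"
      then have "c + s *\<^sub>R x \<in> ball c r" using s(1) by (simp add: dist_norm)
      moreover have "T (c + s *\<^sub>R x) = x" using s(2) by (simp add: TT)
      ultimately show "x \<in> T ` ball c r" by (metis imageI)
    qed
    have graph: "norm x < r \<longleftrightarrow> x $ k < sqrt (r\<^sup>2 - (norm (base_point k x))\<^sup>2)" if "x \<in> B" for x
    proof -
      have xk: "0 < x $ k" using that BA by (auto simp: A_def)
      have "norm x < r \<longleftrightarrow> (norm x)\<^sup>2 < r\<^sup>2" using r by (auto intro: power_strict_mono power2_less_imp_less)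
      also have "\<dots> \<longleftrightarrow> (x $ k)\<^sup>2 < r\<^sup>2 - (norm (base_point k x))\<^sup>2"
        using norm_base_point_sq[of x k] by linarith
      also have "\<dots> \<longleftrightarrow> x $ k < sqrt (r\<^sup>2 - (norm (base_point k x))\<^sup>2)"
        using xk by (metis less_imp_le real_less_rsqrt real_sqrt_less_iff real_sqrt_abs abs_of_pos)
      finally show ?thesis .
    qed
    have "smooth_graph k B (\<lambda>x. sqrt (r\<^sup>2 - (norm x)\<^sup>2))"
      using BA by (intro smooth_graph_hemisphere) (auto simp: B_def A_def)
    moreover have "T z \<in> B" using e(1) by (simp add: B_def mem_box_cart y_def)
    moreover have "T ` ball c r \<inter> B = {x \<in> B. x $ k < sqrt (r\<^sup>2 - (norm (base_point k x))\<^sup>2)}"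
      using img graph by auto
    ultimately show ?thesis using T unfolding B_def by blast
  qed
  then show ?thesis
    using r by (simp add: smooth_domain_def euclidean_domain_def locally_subgraph_def convex_connected)
qed

section \<open>Transport in a Hoelder domain\<close>

context weighted_domain
begin

lemma transportable_boundary:
  assumes sub: "locally_subgraph (holder_graph \<alpha>) \<Omega>" and z: "z \<in> frontier \<Omega>"
  shows "\<exists>r>0. \<exists>Q. open_cube Q \<and> closure Q \<subseteq> \<Omega> \<and> Q \<noteq> {} \<and> transportable (ball z r \<inter> \<Omega>) (bump Q)"
proof -
  obtain T k a b \<phi> where T: "rigid_motion T" and Tz: "T z \<in> box a b"
    and hg: "holder_graph \<alpha> k (box a b) \<phi>"
    and img: "T ` \<Omega> \<inter> box a b = {x \<in> box a b. x $ k < \<phi> (base_point k x)}"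
    using sub z unfolding locally_subgraph_def by blast
  obtain K0 where K0: "\<And>x y. x \<in> box a b \<Longrightarrow> y \<in> box a b \<Longrightarrow>
      \<bar>\<phi> (base_point k x) - \<phi> (base_point k y)\<bar> \<le> K0 * norm (base_point k x - base_point k y) powr \<alpha>"
    using hg unfolding holder_graph_def by blast
  obtain S where S: "rigid_motion S" and ST: "\<And>x. S (T x) = x" and TS: "\<And>x. T (S x) = x"
    using rigid_motion_inverse[OF T] by blast
  define y0 where "y0 = T z"
  define \<psi> where "\<psi> x = \<phi> (base_point k x)" for x
  define K where "K = \<bar>K0\<bar> * real CARD('n) powr \<alpha>"
  have K: "0 \<le> K" by (simp add: K_def)
  obtain h where h: "0 < h" "\<And>x. (\<And>i. \<bar>x $ i - y0 $ i\<bar> \<le> h) \<Longrightarrow> x \<in> box a b"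
    using open_contains_axis_cbox[OF open_box Tz] unfolding y0_def by blast
  have osc: "\<bar>\<psi> x - \<psi> y\<bar> \<le> K * e powr \<alpha>"
    if "x \<in> box a b" "y \<in> box a b" "0 \<le> e" "\<And>i. i \<noteq> k \<Longrightarrow> \<bar>x $ i - y $ i\<bar> \<le> e" for x y e
  proof -
    have "norm (base_point k x - base_point k y) \<le> (\<Sum>i\<in>UNIV. \<bar>(base_point k x - base_point k y) $ i\<bar>)"
      by (rule norm_le_l1_cart)
    also have "\<dots> \<le> (\<Sum>i\<in>(UNIV::'n set). e)"
      by (intro sum_mono) (use that(3,4) in \<open>simp add: base_point_def\<close>)
    also have "\<dots> = real CARD('n) * e" by simp
    finally have n: "norm (base_point k x - base_point k y) powr \<alpha> \<le> (real CARD('n) * e) powr \<alpha>"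
      using \<alpha>_pos by (intro powr_mono2) auto
    have "\<bar>\<psi> x - \<psi> y\<bar> \<le> K0 * norm (base_point k x - base_point k y) powr \<alpha>"
      unfolding \<psi>_def by (rule K0[OF that(1,2)])
    also have "\<dots> \<le> \<bar>K0\<bar> * (real CARD('n) * e) powr \<alpha>"
      using n by (intro mult_mono) auto
    finally show ?thesis by (simp add: K_def powr_mult mult.assoc)
  qed
  \<comment> \<open>Chosen so that lateral displacements up to \<open>e\<close>, and the oscillation
    \<open>K * e powr \<alpha>\<close> they cause, both stay below \<open>h / 16\<close>.\<close>
  define e where "e = min (h / 16) ((h / (16 * (K + 1))) powr (1 / \<alpha>))"
  have e: "0 < e" "e \<le> h / 16" using h(1) K by (auto simp: e_def)
  have Ke: "K * e powr \<alpha> \<le> h / 16"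
  proof -
    have "K * e powr \<alpha> \<le> K * ((h / (16 * (K + 1))) powr (1 / \<alpha>)) powr \<alpha>"
      using e(1) \<alpha>_pos K by (intro mult_left_mono powr_mono2) (auto simp: e_def)
    also have "\<dots> = K * (h / (16 * (K + 1)))" using \<alpha>_pos h(1) K by (simp add: powr_powr)
    also have "\<dots> \<le> h / 16" using h(1) K by (simp add: field_simps)
    finally show ?thesis .
  qed
  have inbox: "x \<in> T ` \<Omega> \<longleftrightarrow> x $ k < \<psi> x" if "x \<in> box a b" for x
    using img that unfolding \<psi>_def by blast
  have y0box: "y0 \<in> box a b" using Tz by (simp add: y0_def)
  have "z \<notin> \<Omega>" using z open_dom by (simp add: frontier_def interior_open)
  then have "y0 \<notin> T ` \<Omega>" unfolding y0_def using ST by (metis imageE)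
  then have up: "\<psi> y0 \<le> y0 $ k" using inbox[OF y0box] by simp
  \<comment> \<open>The frontier point is a limit of points under the graph, so the graph cannot
    pass far below it: \<open>e\<close> for the height and \<open>K * e powr \<alpha>\<close> for
    the oscillation add up to at most \<open>h / 8\<close>.\<close>
  have lower: "y0 $ k - h / 8 \<le> \<psi> y0"
  proof -
    have "z \<in> closure \<Omega>" using z by (simp add: frontier_def)
    then obtain w where w: "w \<in> \<Omega>" "dist w z < e" using e(1) closure_approachable by blast
    have n: "\<bar>T w $ i - y0 $ i\<bar> \<le> e" for i
      using component_le_norm_cart[of "T w - y0" i] rigid_motion_dist[OF T, of w z] w(2)
      by (simp add: y0_def dist_norm)
    have "\<bar>T w $ i - y0 $ i\<bar> \<le> h" for i using n[of i] e(2) h(1) by linarith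
    then have wb: "T w \<in> box a b" by (rule h(2))
    have "T w $ k < \<psi> (T w)" using inbox[OF wb] w(1) by blast
    moreover have "\<bar>\<psi> (T w) - \<psi> y0\<bar> \<le> K * e powr \<alpha>"
      using e(1) n by (intro osc wb y0box) auto
    ultimately show ?thesis using n[of k] Ke e(2) by linarith
  qed
  define L where "L = e / 4"
  \<comment> \<open>\<open>y0\<close> sits laterally in the middle of a base of side
    \<open>L\<close>, at height \<open>h / 2\<close> above the floor. The graph then runs between
    \<open>5 / 16 * h\<close> and \<open>9 / 16 * h\<close> above the floor, leaving room for
    \<open>4 * L\<close> below and \<open>3 / 4 * h\<close> above.\<close>
  define cr where "cr = (\<chi> i. if i = k then y0 $ k - h / 2 else y0 $ i - L / 2)"
  have L: "0 < L" "L \<le> h / 64" using e by (auto simp: L_def)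
  have near: "\<bar>x $ i - y0 $ i\<bar> \<le> e" if "cr $ i - 2 * L \<le> x $ i \<and> x $ i \<le> cr $ i + 3 * L" "i \<noteq> k" for x i
    using that e(1) by (auto simp: cr_def L_def)
  \<comment> \<open>The Hoelder bound is available only for points of the box. Moving a point
    vertically to the height of \<open>y0\<close> puts it there and keeps the value of
    \<psi>.\<close>
  define proj where "proj x = (\<chi> i. if i = k then y0 $ k else x $ i)" for x :: "real^'n"
  have base_proj: "\<psi> (proj x) = \<psi> x" for x
    unfolding \<psi>_def by (rule arg_cong[where f = \<phi>]) (simp add: proj_def base_point_def vec_eq_iff)
  have latbox: "proj x \<in> box a b" if "\<And>i. i \<noteq> k \<Longrightarrow> cr $ i - 2 * L \<le> x $ i \<and> x $ i \<le> cr $ i + 3 * L" for x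
  proof (rule h(2))
    fix i show "\<bar>proj x $ i - y0 $ i\<bar> \<le> h"
      using near[OF that, of i] e(2) h(1) by (cases "i = k") (auto simp: proj_def)
  qed
  have \<psi>close: "\<bar>\<psi> x - \<psi> y0\<bar> \<le> h / 16" if x: "\<And>i. i \<noteq> k \<Longrightarrow> cr $ i - 2 * L \<le> x $ i \<and> x $ i \<le> cr $ i + 3 * L" for x
  proof -
    have "\<bar>\<psi> (proj x) - \<psi> y0\<bar> \<le> K * e powr \<alpha>"
      using near[OF x] e(1) by (intro osc latbox x y0box) (auto simp: proj_def)
    then show ?thesis using Ke by (simp add: base_proj)
  qed
  have crk: "cr $ k = y0 $ k - h / 2" by (simp add: cr_def)
  interpret chart: holder_chart \<Omega> p q \<alpha> \<beta> T S k cr L "3 / 4 * h" K \<psi>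
  proof
    show "\<bar>\<psi> x - \<psi> y\<bar> \<le> K * s powr \<alpha>"
      if x: "\<And>i. i \<noteq> k \<Longrightarrow> cr $ i - 2 * L \<le> x $ i \<and> x $ i \<le> cr $ i + 3 * L"
        and y: "\<And>i. i \<noteq> k \<Longrightarrow> cr $ i - 2 * L \<le> y $ i \<and> y $ i \<le> cr $ i + 3 * L"
        and s: "0 \<le> s" "\<And>i. i \<noteq> k \<Longrightarrow> \<bar>x $ i - y $ i\<bar> \<le> s" for x y s
    proof -
      have "\<bar>\<psi> (proj x) - \<psi> (proj y)\<bar> \<le> K * s powr \<alpha>"
        by (rule osc[OF latbox[OF x] latbox[OF y] s(1)]) (use s(2) in \<open>auto simp: proj_def\<close>)
      then show ?thesis by (simp add: base_proj)
    qed
    show "cr $ k + 4 * L < \<psi> x \<and> \<psi> x < cr $ k + 3 / 4 * h"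
      if x: "\<And>i. i \<noteq> k \<Longrightarrow> cr $ i - 2 * L \<le> x $ i \<and> x $ i \<le> cr $ i + 3 * L" for x
    proof -
      have "\<psi> x \<le> \<psi> y0 + h / 16" "\<psi> y0 - h / 16 \<le> \<psi> x" using \<psi>close[OF x] by linarith+
      then show ?thesis using up lower L h(1) unfolding crk by (intro conjI; linarith)
    qed
    show "x \<in> T ` \<Omega> \<longleftrightarrow> x $ k < \<psi> x"
      if x: "\<And>i. i \<noteq> k \<Longrightarrow> cr $ i - 2 * L \<le> x $ i \<and> x $ i \<le> cr $ i + 3 * L"
        and xk: "cr $ k - 2 * L \<le> x $ k" "x $ k \<le> cr $ k + 3 / 4 * h + 4 * L" for x
    proof (rule inbox, rule h(2))
      fix i
      show "\<bar>x $ i - y0 $ i\<bar> \<le> h"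
      proof (cases "i = k")
        case True
        then show ?thesis using xk L h(1) unfolding crk by (auto simp: abs_le_iff)
      next
        case False
        then show ?thesis using near[OF x[OF False] False] e(2) h(1) by linarith
      qed
    qed
  qed (use T S ST TS L h(1) K in auto)
  have "ball z (L / 2) \<inter> \<Omega> \<subseteq> T -` chart.E0"
  proof
    fix x assume x: "x \<in> ball z (L / 2) \<inter> \<Omega>"
    have n: "\<bar>T x $ i - y0 $ i\<bar> < L / 2" for i
      using component_le_norm_cart[of "T x - y0" i] rigid_motion_dist[OF T, of x z] x
      by (simp add: y0_def dist_norm norm_minus_commute)
    have lat: "cr $ i \<le> T x $ i \<and> T x $ i < cr $ i + L" if "i \<noteq> k" for i
    proof -
      have "cr $ i = y0 $ i - L / 2" using that by (simp add: cr_def)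
      then show ?thesis using n[of i] by linarith
    qed
    have k: "cr $ k \<le> T x $ k" "T x $ k \<le> cr $ k + 3 / 4 * h + 4 * L"
      using n[of k] L h(1) unfolding crk by linarith+
    have "T x \<in> T ` \<Omega> \<longleftrightarrow> T x $ k < \<psi> (T x)"
    proof (rule chart.graph)
      fix i assume "i \<noteq> k"
      from lat[OF this] show "cr $ i - 2 * L \<le> T x $ i \<and> T x $ i \<le> cr $ i + 3 * L" using L by linarith
    next
      show "cr $ k - 2 * L \<le> T x $ k" using k(1) L by linarith
    qed (rule k(2))
    then have "T x $ k < \<psi> (T x)" using x by blast
    then show "x \<in> T -` chart.E0" using lat k(1) by (simp add: chart.E0_def)
  qed
  then have "\<exists>Q. open_cube Q \<and> closure Q \<subseteq> \<Omega> \<and> Q \<noteq> {} \<and> transportable (ball z (L / 2) \<inter> \<Omega>) (bump Q)"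
    using chart.transportable_chart transportable_mono by blast
  then show ?thesis using L(1) by (intro exI[of _ "L / 2"]) simp
qed

text \<open>Compactness is used for the closure of \<Omega>: cubes serve the interior points and
  charts the frontier points, and all masses are linked to one cube \<open>Q0\<close> before the
  finite union is taken.\<close>

theorem transportable_domain:
  assumes sub: "locally_subgraph (holder_graph \<alpha>) \<Omega>"
  shows "\<exists>Q. transportable \<Omega> (bump Q)"
proof -
  obtain x0 where "x0 \<in> \<Omega>" using nonempty_dom by blast
  then obtain Q0 where Q0: "open_cube Q0" "x0 \<in> Q0" "closure Q0 \<subseteq> \<Omega>" using ex_cube by blast
  have "\<exists>r>0. transportable (ball z r \<inter> \<Omega>) (bump Q0)" if z: "z \<in> closure \<Omega>" for z
  proof (cases "z \<in> \<Omega>")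
    case True
    then obtain Q where Q: "open_cube Q" "z \<in> Q" "closure Q \<subseteq> \<Omega>" using ex_cube by blast
    obtain r where r: "0 < r" "ball z r \<subseteq> Q"
      using open_cube_open_bounded(1)[OF Q(1)] Q(2) open_contains_ball by blast
    have "transportable Q (bump Q)" using transportable_cube Q by blast
    then have "transportable Q (bump Q0)"
      using transportable_linked linked_any_cubes[OF Q(1,3) _ Q0(1,3)] Q(2) Q0(2) by blast
    then show ?thesis using r transportable_mono by blast
  next
    case False
    then have "z \<in> frontier \<Omega>" using z open_dom by (simp add: frontier_def interior_open)
    then obtain r Q where r: "0 < r" "open_cube Q" "closure Q \<subseteq> \<Omega>" "Q \<noteq> {}" "transportable (ball z r \<inter> \<Omega>) (bump Q)"
      using transportable_boundary[OF sub] by blast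
    then have "transportable (ball z r \<inter> \<Omega>) (bump Q0)"
      using transportable_linked linked_any_cubes[OF r(2-4) Q0(1,3)] Q0(2) by blast
    then show ?thesis using r(1) by blast
  qed
  then obtain r where r: "\<And>z. z \<in> closure \<Omega> \<Longrightarrow> 0 < r z" "\<And>z. z \<in> closure \<Omega> \<Longrightarrow> transportable (ball z (r z) \<inter> \<Omega>) (bump Q0)"
    by metis
  have K: "compact (closure \<Omega>)" using bounded_dom by (simp add: compact_closure)
  have cov: "closure \<Omega> \<subseteq> (\<Union>z\<in>closure \<Omega>. ball z (r z))" using r(1) by force
  obtain F where F: "F \<subseteq> closure \<Omega>" "finite F" "closure \<Omega> \<subseteq> (\<Union>z\<in>F. ball z (r z))"
    by (rule compactE_image[OF K _ cov]) auto
  have "transportable ((\<Union>z\<in>F. ball z (r z)) \<inter> \<Omega>) (bump Q0)"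
    using F(2,1)
  proof (induction F rule: finite_induct)
    case empty
    have "transportable Q0 (bump Q0)" using transportable_cube Q0 by blast
    then show ?case by (rule transportable_mono) simp
  next
    case (insert z F)
    have m: "ball z (r z) \<inter> \<Omega> \<in> sets \<mu>" unfolding sets_\<mu> using open_dom by (auto intro!: borel_open sets_completionI_sets)
    have eq: "(\<Union>w\<in>insert z F. ball w (r w)) \<inter> \<Omega> = (ball z (r z) \<inter> \<Omega>) \<union> ((\<Union>w\<in>F. ball w (r w)) \<inter> \<Omega>)"
      by auto
    show ?case unfolding eq
      by (rule transportable_Un[OF _ _ m]) (use insert r(2) in auto)
  qed
  then have "transportable \<Omega> (bump Q0)"
    by (rule transportable_mono) (use F(3) closure_subset[of \<Omega>] in blast)
  then show ?thesis by blast
qed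

section \<open>Assembling the covering and the decomposition\<close>

lemma nn_integral_on_subset:
  assumes U: "U \<subseteq> \<Omega>" "U \<in> sets lebesgue" and G: "\<And>x. x \<in> \<Omega> \<Longrightarrow> x \<notin> U \<Longrightarrow> G x = 0"
  shows "(\<integral>\<^sup>+x. ennreal (\<bar>G x\<bar> powr q * w x) \<partial>lebesgue_on U) = (\<integral>\<^sup>+x. ennreal (\<bar>G x\<bar> powr q * w x) \<partial>\<mu>)"
proof -
  have "(\<integral>\<^sup>+x. ennreal (\<bar>G x\<bar> powr q * w x) * indicator U x \<partial>lebesgue)
     = (\<integral>\<^sup>+x. ennreal (\<bar>G x\<bar> powr q * w x) * indicator \<Omega> x \<partial>lebesgue)"
    using U(1) G by (intro nn_integral_cong) (auto simp: indicator_def)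
  then show ?thesis using U \<Omega>_sets by (simp add: nn_integral_restrict_space)
qed

lemma integral_on_subset:
  fixes G :: "real^'n \<Rightarrow> real"
  assumes U: "U \<subseteq> \<Omega>" "U \<in> sets lebesgue" and G: "\<And>x. x \<in> \<Omega> \<Longrightarrow> x \<notin> U \<Longrightarrow> G x = 0"
  shows "integral\<^sup>L (lebesgue_on U) G = integral\<^sup>L \<mu> G"
proof -
  have "(\<integral>x. indicator U x *\<^sub>R G x \<partial>lebesgue) = (\<integral>x. indicator \<Omega> x *\<^sub>R G x \<partial>lebesgue)"
    using U(1) G by (intro Bochner_Integration.integral_cong) (auto simp: indicator_def)
  then show ?thesis using U \<Omega>_sets by (simp add: integral_restrict_space)
qed

theorem C_decomposition_exists:
  assumes sub: "locally_subgraph (holder_graph \<alpha>) \<Omega>"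
  shows "\<exists>(\<Gamma> :: nat set) (U :: nat \<Rightarrow> (real^'n) set) (C :: real).
    open_covering \<Omega> \<Gamma> U \<and> 0 < C \<and>
    (\<forall>g \<in> data_space. integral\<^sup>L \<mu> g = 0 \<longrightarrow>
       (\<exists>G. C_decomposition \<Omega> \<Gamma> U g G \<and>
          (\<Sum>\<^sub>\<infinity>t\<in>\<Gamma>. \<integral>\<^sup>+x. ennreal (\<bar>G t x\<bar> powr q * d x powr ((- \<beta> - \<alpha> + 1) * q)) \<partial>lebesgue_on (U t))
          \<le> ennreal C * data_norm g)) \<and>
    (\<exists>t0\<in>\<Gamma>. smooth_domain (U t0) \<and> 0 < setdist (U t0) (frontier \<Omega>) \<and>
       (\<forall>t \<in> \<Gamma> - {t0}. open_cube (U t) \<or> open_extended_cube (U t)))"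
proof -
  obtain Q where "transportable \<Omega> (bump Q)" using transportable_domain[OF sub] by blast
  then obtain \<Gamma> U C where good: "good_family \<Gamma> U" and C: "0 \<le> C"
    and neg: "negligible (\<Omega> - (\<Union>t\<in>\<Gamma>. U t))"
    and dec: "\<And>f. f \<in> data_space \<Longrightarrow> decomposes \<Gamma> U (\<lambda>x. f x - integral\<^sup>L \<mu> f * bump Q x) (ennreal C * data_norm f)"
    unfolding transportable_def transports_def by auto
  obtain x0 where "x0 \<in> \<Omega>" using nonempty_dom by blast
  then obtain r where r: "0 < r" "cball x0 r \<subseteq> \<Omega>" using open_dom open_contains_cball by blast
  define B where "B = ball x0 r"
  have clB: "compact (closure B)" "closure B \<subseteq> \<Omega>" using r by (auto simp: B_def)
  \<comment> \<open>Index 0 is reserved for the ball with the zero piece; the cubes are shifted by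
    one.\<close>
  define \<Delta> where "\<Delta> = insert 0 (Suc ` \<Gamma>)"
  define V where "V t = (case t of 0 \<Rightarrow> B | Suc s \<Rightarrow> U s)" for t
  have V [simp]: "V 0 = B" "V (Suc s) = U s" for s by (auto simp: V_def)
  have cube: "open_cube (U t)" "closure (U t) \<subseteq> \<Omega>" if "t \<in> \<Gamma>" for t
    using good that by (auto simp: good_family_def)
  have Vo: "open (V t)" "V t \<subseteq> \<Omega>" "compact (closure (V t))" "closure (V t) \<subseteq> \<Omega>" if t: "t \<in> \<Delta>" for t
  proof -
    show c: "closure (V t) \<subseteq> \<Omega>"
    proof (cases t)
      case (Suc s)
      then show ?thesis using t cube(2)[of s] by (auto simp: \<Delta>_def)
    qed (use clB in simp)
    then show "V t \<subseteq> \<Omega>" using closure_subset by blast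
    show "open (V t)" using t open_cube_open_bounded(1)[OF cube(1)] by (auto simp: \<Delta>_def B_def)
    show "compact (closure (V t))"
      using t clB open_cube_open_bounded(2)[OF cube(1)] by (auto simp: \<Delta>_def compact_closure)
  qed
  have Vm: "V t \<in> sets lebesgue" if "t \<in> \<Delta>" for t using Vo(1)[OF that] by simp
  have "finite {s \<in> \<Delta>. V s \<inter> V t \<noteq> {}}" if t: "t \<in> \<Delta>" for t
  proof -
    have "{s \<in> \<Delta>. V s \<inter> V t \<noteq> {}} \<subseteq> insert 0 (Suc ` {s \<in> \<Gamma>. U s \<inter> closure (V t) \<noteq> {}})"
    proof
      fix s assume s: "s \<in> {s \<in> \<Delta>. V s \<inter> V t \<noteq> {}}"
      show "s \<in> insert 0 (Suc ` {s \<in> \<Gamma>. U s \<inter> closure (V t) \<noteq> {}})"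
      proof (cases s)
        case (Suc i)
        have "V s \<inter> closure (V t) \<noteq> {}" using s closure_subset[of "V t"] by blast
        then have "i \<in> {s \<in> \<Gamma>. U s \<inter> closure (V t) \<noteq> {}}" using s Suc by (auto simp: \<Delta>_def)
        then show ?thesis using Suc by blast
      qed simp
    qed
    moreover have "finite {s \<in> \<Gamma>. U s \<inter> closure (V t) \<noteq> {}}"
      using good Vo[OF t] by (auto simp: good_family_def)
    ultimately show ?thesis using finite_subset by blast
  qed
  moreover have "negligible (\<Omega> - (\<Union>t\<in>\<Delta>. V t))"
    by (rule negligible_subset[OF neg]) (auto simp: \<Delta>_def)
  ultimately have cover: "open_covering \<Omega> \<Delta> V" using Vo by (simp add: open_covering_def)
  have "\<exists>G. C_decomposition \<Omega> \<Delta> V g G \<and>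
      (\<Sum>\<^sub>\<infinity>t\<in>\<Delta>. \<integral>\<^sup>+x. ennreal (\<bar>G t x\<bar> powr q * d x powr ((- \<beta> - \<alpha> + 1) * q)) \<partial>lebesgue_on (V t))
      \<le> ennreal (C + 1) * data_norm g"
    if g: "g \<in> data_space" "integral\<^sup>L \<mu> g = 0" for g
  proof -
    obtain G where G: "\<And>t. t \<in> \<Gamma> \<Longrightarrow> integrable \<mu> (G t) \<and> (\<forall>x\<in>\<Omega>. x \<notin> U t \<longrightarrow> G t x = 0) \<and> integral\<^sup>L \<mu> (G t) = 0"
      and sum: "AE x in \<mu>. ((\<lambda>t. G t x) has_sum g x) \<Gamma>"
      and norm: "(\<Sum>\<^sub>\<infinity>t\<in>\<Gamma>. piece_norm (G t)) \<le> ennreal C * data_norm g"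
      using dec[OF g(1)] g(2) unfolding decomposes_def by auto
    define H where "H t = (case t of 0 \<Rightarrow> (\<lambda>x. 0) | Suc s \<Rightarrow> G s)" for t
    have H [simp]: "H 0 = (\<lambda>x. 0)" "H (Suc s) = G s" for s by (auto simp: H_def)
    have Hp: "integrable \<mu> (H t)" "integral\<^sup>L \<mu> (H t) = 0" "\<And>x. x \<in> \<Omega> \<Longrightarrow> x \<notin> V t \<Longrightarrow> H t x = 0"
      if "t \<in> \<Delta>" for t using that G by (auto simp: \<Delta>_def)
    have hs: "((\<lambda>t. H t x) has_sum g x) \<Delta>" if "((\<lambda>t. G t x) has_sum g x) \<Gamma>" for x
    proof -
      have "((\<lambda>t. H t x) has_sum g x) (Suc ` \<Gamma>)"
        using that by (subst has_sum_reindex) (auto simp: o_def)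
      then show ?thesis
        by (subst has_sum_cong_neutral[where T = "Suc ` \<Gamma>" and g = "\<lambda>t. H t x"]) (auto simp: \<Delta>_def)
    qed
    have "C_decomposition \<Omega> \<Delta> V g H"
      unfolding C_decomposition_def
    proof (intro conjI ballI)
      show "AE x in \<mu>. ((\<lambda>t. H t x) has_sum g x) \<Delta>"
        by (rule AE_mp[OF sum AE_I2]) (use hs in simp)
      show "AE x in \<mu>. x \<notin> V t \<longrightarrow> H t x = 0" if "t \<in> \<Delta>" for t
        using Hp(3)[OF that] by (intro AE_I2) (simp add: space_\<mu>)
      show "integral\<^sup>L (lebesgue_on (V t)) (H t) = 0" if "t \<in> \<Delta>" for t
        using integral_on_subset[OF Vo(2) Vm Hp(3)] that Hp(2) by simp
    qed (rule Hp(1))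
    moreover have "(\<Sum>\<^sub>\<infinity>t\<in>\<Delta>. \<integral>\<^sup>+x. ennreal (\<bar>H t x\<bar> powr q * d x powr ((- \<beta> - \<alpha> + 1) * q)) \<partial>lebesgue_on (V t))
        \<le> ennreal (C + 1) * data_norm g"
    proof -
      have "(\<Sum>\<^sub>\<infinity>t\<in>\<Delta>. \<integral>\<^sup>+x. ennreal (\<bar>H t x\<bar> powr q * d x powr ((- \<beta> - \<alpha> + 1) * q)) \<partial>lebesgue_on (V t))
         = (\<Sum>\<^sub>\<infinity>t\<in>\<Delta>. piece_norm (H t))"
        unfolding piece_norm_def using nn_integral_on_subset[OF Vo(2) Vm Hp(3)] by (intro infsum_cong) simp
      also have "\<dots> = (\<Sum>\<^sub>\<infinity>t\<in>Suc ` \<Gamma>. piece_norm (H t))"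
        by (rule infsum_cong_neutral) (auto simp: \<Delta>_def piece_norm_def)
      also have "\<dots> = (\<Sum>\<^sub>\<infinity>t\<in>\<Gamma>. piece_norm (G t))"
        by (subst infsum_reindex) (auto simp: o_def)
      also have "\<dots> \<le> ennreal (C + 1) * data_norm g"
        using norm by (rule order_trans) (intro mult_right_mono ennreal_leI, auto)
      finally show ?thesis .
    qed
    ultimately show ?thesis by blast
  qed
  moreover have "smooth_domain (V 0)" using smooth_domain_ball[OF r(1)] by (simp add: B_def)
  moreover have "0 < setdist (V 0) (frontier \<Omega>)"
  proof -
    have "closure B \<inter> frontier \<Omega> = {}" using clB(2) open_dom by (auto simp: frontier_def interior_open)
    then have "0 < setdist (closure B) (frontier \<Omega>)"
      using clB(1) frontier_nonempty r(1) by (subst setdist_gt_0_compact_closed) (auto simp: B_def)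
    then show ?thesis by simp
  qed
  moreover have "\<forall>t\<in>\<Delta> - {0}. open_cube (V t)" using cube by (auto simp: \<Delta>_def)
  moreover have "0 \<in> \<Delta>" "0 < C + 1" using C by (auto simp: \<Delta>_def)
  ultimately show ?thesis using cover
    by (intro exI[of _ \<Delta>] exI[of _ V] exI[of _ "C + 1"]) blast
qed

end

theorem theorem4p3:
  fixes \<Omega> :: "(real^'n) set" and p q \<alpha> \<beta> :: real
  assumes "CARD('n) \<ge> 2"
    and "1 < p" and "1 < q" and "1 / p + 1 / q = 1"
    and "0 < \<alpha>" and "\<alpha> \<le> 1"
    and "bounded_holder_domain \<alpha> \<Omega>"
    and "\<beta> * p > - \<alpha>"
  shows "\<exists>(\<Gamma> :: nat set) (U :: nat \<Rightarrow> (real^'n) set) (C :: real).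
    open_covering \<Omega> \<Gamma> U \<and> 0 < C \<and>
    (\<forall>g \<in> weighted_Lq q \<Omega> (\<lambda>x. bdist \<Omega> x powr (- \<beta> * q)).
       integral\<^sup>L (lebesgue_on \<Omega>) g = 0 \<longrightarrow>
       (\<exists>G. C_decomposition \<Omega> \<Gamma> U g G \<and>
          (\<Sum>\<^sub>\<infinity>t\<in>\<Gamma>. \<integral>\<^sup>+x. ennreal (\<bar>G t x\<bar> powr q * bdist \<Omega> x powr ((- \<beta> - \<alpha> + 1) * q))
                            \<partial>lebesgue_on (U t))
          \<le> ennreal C * (\<integral>\<^sup>+x. ennreal (\<bar>g x\<bar> powr q * bdist \<Omega> x powr (- \<beta> * q))
                            \<partial>lebesgue_on \<Omega>))) \<and>
    (\<exists>t0\<in>\<Gamma>. smooth_domain (U t0) \<and> 0 < setdist (U t0) (frontier \<Omega>) \<and>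
       (\<forall>t \<in> \<Gamma> - {t0}. open_cube (U t) \<or> open_extended_cube (U t)))"
proof -
  interpret weighted_domain \<Omega> p q \<alpha> \<beta>
    by standard (use assms in \<open>auto simp: bounded_holder_domain_def euclidean_domain_def\<close>)
  have "locally_subgraph (holder_graph \<alpha>) \<Omega>"
    using assms(7) by (simp add: bounded_holder_domain_def)
  from C_decomposition_exists[OF this] show ?thesis unfolding data_norm_def .
qed

end
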